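(* Let $0\le\alpha<d$ and $1\le p\le q<\infty$ be such that $\frac1p-\frac1q\le\frac{\alpha}{d}$, and let $(U,V)$ be a pair of $n\times n$ matrix weights on $\mathbb{R}^d$. The following are equivalent: (1) $(U,V)\in A_{p,q}^\alpha$, i.e. $[U,V]_{A_{p,q}^\alpha}<\infty$; (2) $M'_{\alpha,U,V}:L^p(\mathbb{R}^d,\mathbb{C}^n)\to L^{q,\infty}(\mathbb{R}^d)$, i.e. there is $C<\infty$ with $\|M'_{\alpha,U,V}f\|_{L^{q,\infty}}\le C\|f\|_{L^p}$ for all $f\in L^p(\mathbb{R}^d,\mathbb{C}^n)$; (3) for every cube $Q$, $B_Q^\alpha:L^p(\mathbb{R}^d,\mathbb{C}^n)\to L^{q,\infty}(\mathbb{R}^d)$ with norm independent of $Q$, i.e. there is $C<\infty$ such that $\|B_Q^\alpha f\|_{L^{q,\infty}}\le C\|f\|_{L^p}$ for all cubes $Q$ and all $f\in L^p(\mathbb{R}^d,\mathbb{C}^n)$.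
   Context: Cubes $Q\subset\mathbb{R}^d$ have edges parallel to the coordinate axes; $p'$ is the conjugate exponent of $p$. A matrix weight is an $n\times n$ self-adjoint matrix function $U$ on $\mathbb{R}^d$ with locally integrable entries such that $U(x)$ is positive definite for a.e. $x$; powers $U^r$ are defined by diagonalization. $|\cdot|_{\mathrm{op}}$ is the operator norm. $\|g\|_{L^{q,\infty}}=\sup_{\lambda>0}\lambda|\{x:|g(x)|>\lambda\}|^{1/q}$. For $p>1$, $$[U,V]_{A_{p,q}^\alpha}=\sup_Q|Q|^{\frac{\alpha}{d}+\frac1q-\frac1p}\left(\frac1{|Q|}\int_Q\Big(\frac1{|Q|}\int_Q|U(x)^{\frac1q}V(y)^{-\frac1p}|_{\mathrm{op}}^{p'}\,dy\Big)^{\frac{q}{p'}}dx\right)^{\frac1q},$$ and for $p=1$, $$[U,V]_{A_{1,q}^\alpha}=\sup_Q|Q|^{\frac{\alpha}{d}+\frac1q-1}\operatorname*{ess\,sup}_{y\in Q}\left(\frac1{|Q|}\int_Q|U(x)^{\frac1q}V(y)^{-1}|_{\mathrm{op}}^{q}\,dx\right)^{\frac1q}.$$ For each cube $Q$, $\mathcal{U}_Q^q$ is the reducing operator of $U$: a fixed constant positive definite matrix such that $|\mathcal{U}_Q^qe|\approx\big(\frac1{|Q|}\int_Q|U(x)^{1/q}e|^q\,dx\big)^{1/q}$ for all $e\in\mathbb{C}^n$, with implicit constants depending only on $n$ (such matrices exist). The two-weight auxiliary maximal operator is $$M'_{\alpha,U,V}f(x)=\sup_Q|Q|^{\frac{\alpha}{d}}\frac1{|Q|}\int_Q|\mathcal{U}_Q^qV^{-\frac1p}(y)f(y)|\,dy\cdot\chi_Q(x),$$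 with supremum over all cubes $Q$, and $$B_Q^\alpha f(x)=|Q|^{\frac{\alpha}{d}}\frac1{|Q|}\int_Q|\mathcal{U}_Q^qV^{-\frac1p}(y)f(y)|\,dy\cdot\chi_Q(x).$$ *)

theory Defs
  imports "HOL-Probability.Essential_Supremum"
begin

(* Averages, suprema and (quasi-)norms are taken in ennreal, so that every quantity is defined
   and "finite" means "< top". The measure is the complete measure lebesgue. *)

(* Open cubes: the sets where a supremum over cubes of averages exceeds a level are then open,
   so the weak norm below measures measurable sets. *)
definition cubes :: "(real ^ 'd) set set" where
  "cubes = {box a (\<chi> i. a $ i + l) | a l. 0 < l}"

abbreviation vol :: "(real ^ 'd) set \<Rightarrow> real" where
  "vol Q \<equiv> measure lebesgue Q"

(* Meant for exponents r > 0, where top to the power r is top. *)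
definition enn_powr :: "ennreal \<Rightarrow> real \<Rightarrow> ennreal" where
  "enn_powr x r = (if x = top then top else ennreal (enn2real x powr r))"

definition nn_avg :: "(real ^ 'd) set \<Rightarrow> (real ^ 'd \<Rightarrow> ennreal) \<Rightarrow> ennreal" where
  "nn_avg Q g = (\<integral>\<^sup>+x\<in>Q. g x \<partial>lebesgue) / emeasure lebesgue Q"

definition ctranspose :: "complex ^ 'n ^ 'n \<Rightarrow> complex ^ 'n ^ 'n" where
  "ctranspose A = map_matrix cnj (transpose A)"

definition self_adjoint :: "complex ^ 'n ^ 'n \<Rightarrow> bool" where
  "self_adjoint A \<longleftrightarrow> ctranspose A = A"

(* The inner product of the library on complex ^ 'n is the real part of the Hermitian one;
   for self-adjoint A the Hermitian form of A is real, so nothing is lost. *)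
definition pos_def :: "complex ^ 'n ^ 'n \<Rightarrow> bool" where
  "pos_def A \<longleftrightarrow> self_adjoint A \<and> (\<forall>e. e \<noteq> 0 \<longrightarrow> 0 < (A *v e) \<bullet> e)"

definition unitary :: "complex ^ 'n ^ 'n \<Rightarrow> bool" where
  "unitary P \<longleftrightarrow> P ** ctranspose P = mat 1 \<and> ctranspose P ** P = mat 1"

definition real_diag :: "real ^ 'n \<Rightarrow> complex ^ 'n ^ 'n" where
  "real_diag w = (\<chi> i j. if i = j then of_real (w $ i) else 0)"

(* The result does not depend on the unitary diagonalization of the self-adjoint matrix A.
   Only used where A is positive definite, up to null sets. *)
definition mat_powr :: "complex ^ 'n ^ 'n \<Rightarrow> real \<Rightarrow> complex ^ 'n ^ 'n" where
  "mat_powr A r = (THE B. \<exists>P w. unitary P \<and> A = P ** real_diag w ** ctranspose P \<and>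
      B = P ** real_diag (\<chi> i. w $ i powr r) ** ctranspose P)"

abbreviation op_norm :: "complex ^ 'n ^ 'n \<Rightarrow> real" where
  "op_norm A \<equiv> onorm ((*v) A)"

definition matrix_weight :: "(real ^ 'd \<Rightarrow> complex ^ 'n ^ 'n) \<Rightarrow> bool" where
  "matrix_weight U \<longleftrightarrow>
     (\<forall>x. self_adjoint (U x)) \<and>
     (\<forall>i j K. compact K \<longrightarrow> (\<lambda>x. U x $ i $ j) absolutely_integrable_on K) \<and>
     (AE x in lebesgue. pos_def (U x))"

definition Apq_const ::
  "real \<Rightarrow> real \<Rightarrow> real \<Rightarrow> (real ^ 'd \<Rightarrow> complex ^ 'n ^ 'n) \<Rightarrow> (real ^ 'd \<Rightarrow> complex ^ 'n ^ 'n) \<Rightarrow> ennreal"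
where
  "Apq_const \<alpha> p q U V =
    (if p = 1 then
       (SUP Q\<in>cubes. ennreal (vol Q powr (\<alpha> / real CARD('d) + 1 / q - 1)) *
          esssup (lebesgue_on Q) (\<lambda>y.
            enn_powr (nn_avg Q (\<lambda>x.
              ennreal (op_norm (mat_powr (U x) (1 / q) ** mat_powr (V y) (- 1)) powr q))) (1 / q)))
     else
       (let p' = p / (p - 1) in
        SUP Q\<in>cubes. ennreal (vol Q powr (\<alpha> / real CARD('d) + 1 / q - 1 / p)) *
          enn_powr (nn_avg Q (\<lambda>x.
            enn_powr (nn_avg Q (\<lambda>y.
              ennreal (op_norm (mat_powr (U x) (1 / q) ** mat_powr (V y) (- (1 / p))) powr p')))
              (q / p')))
            (1 / q)))"

definition reducing_operators ::
  "real \<Rightarrow> real \<Rightarrow> real \<Rightarrow> (real ^ 'd \<Rightarrow> complex ^ 'n ^ 'n) \<Rightarrow> ((real ^ 'd) set \<Rightarrow> complex ^ 'n ^ 'n) \<Rightarrow> bool"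
where
  "reducing_operators c1 c2 q U R \<longleftrightarrow>
    (\<forall>Q\<in>cubes. pos_def (R Q) \<and>
      (\<forall>e. let N = enn_powr (nn_avg Q (\<lambda>x. ennreal (norm (mat_powr (U x) (1 / q) *v e) powr q))) (1 / q)
        in ennreal (c1 * norm (R Q *v e)) \<le> N \<and> N \<le> ennreal (c2 * norm (R Q *v e))))"

definition Lp_norm :: "real \<Rightarrow> (real ^ 'd \<Rightarrow> complex ^ 'n) \<Rightarrow> ennreal" where
  "Lp_norm p f = enn_powr (\<integral>\<^sup>+x. ennreal (norm (f x) powr p) \<partial>lebesgue) (1 / p)"

definition Lp :: "real \<Rightarrow> (real ^ 'd \<Rightarrow> complex ^ 'n) set" where
  "Lp p = {f \<in> borel_measurable lebesgue. Lp_norm p f < top}"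

definition weak_norm :: "real \<Rightarrow> (real ^ 'd \<Rightarrow> ennreal) \<Rightarrow> ennreal" where
  "weak_norm q g =
     (SUP t\<in>{0<..}. ennreal t * enn_powr (emeasure lebesgue {x. ennreal t < g x}) (1 / q))"

(* In the next two definitions R is a family of reducing operators of the first weight U, which
   enters only through R. *)
definition avg_op ::
  "real \<Rightarrow> real \<Rightarrow> ((real ^ 'd) set \<Rightarrow> complex ^ 'n ^ 'n) \<Rightarrow> (real ^ 'd \<Rightarrow> complex ^ 'n ^ 'n) \<Rightarrow>
   (real ^ 'd) set \<Rightarrow> (real ^ 'd \<Rightarrow> complex ^ 'n) \<Rightarrow> real ^ 'd \<Rightarrow> ennreal"
where
  "avg_op \<alpha> p R V Q f x =
     ennreal (vol Q powr (\<alpha> / real CARD('d))) *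
     nn_avg Q (\<lambda>y. ennreal (norm ((R Q ** mat_powr (V y) (- (1 / p))) *v f y))) * indicator Q x"

definition aux_maximal ::
  "real \<Rightarrow> real \<Rightarrow> ((real ^ 'd) set \<Rightarrow> complex ^ 'n ^ 'n) \<Rightarrow> (real ^ 'd \<Rightarrow> complex ^ 'n ^ 'n) \<Rightarrow>
   (real ^ 'd \<Rightarrow> complex ^ 'n) \<Rightarrow> real ^ 'd \<Rightarrow> ennreal"
where
  "aux_maximal \<alpha> p R V f x = (SUP Q\<in>cubes. avg_op \<alpha> p R V Q f x)"

end

theory Submission
  imports Defs
begin

text \<open>
The operator \<open>B\<^sub>Q\<close> produces a multiple of the indicator of \<open>Q\<close>, so its weak bound with
a constant independent of \<open>Q\<close> is an inequality between an average over \<open>Q\<close> and the norm of \<open>f\<close>,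
here called the testing bound. Each of the three conditions is equivalent to it.

The maximal operator dominates every \<open>B\<^sub>Q\<close>. Conversely, apply the testing bound to the
restriction of \<open>f\<close> to \<open>Q\<close>: a cube on which \<open>B\<^sub>Q f\<close> exceeds \<open>t\<close> satisfies
\<open>|Q| \<le> (C/t)\<^sup>q (\<integral>\<^sub>Q |f|\<^sup>p)\<^sup>q\<^sup>/\<^sup>p\<close>. The level set of the maximal function is the
union of these cubes; passing to a disjoint subfamily by Vitali's lemma and using \<open>q/p \<ge> 1\<close> to add
up the right-hand sides gives the weak type bound (\<open>weak_type_aux_maximal\<close>).

By Hoelder's inequality and its converse, the testing bound holds if and only if
the \<open>L\<^sup>p\<^sup>'\<close> average over \<open>Q\<close> of the operator norm of \<open>U\<^sub>Q V\<^sup>-\<^sup>1\<^sup>/\<^sup>p(y)\<close>, where \<open>U\<^sub>Q\<close> is the reducing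
operator, is bounded with the right power of \<open>|Q|\<close> (the essential supremum if \<open>p = 1\<close>).
It remains to see that in this average the reducing operator may be exchanged for \<open>U\<^sup>1\<^sup>/\<^sup>q(x)\<close>,
averaged in \<open>x\<close> to the power \<open>q\<close>. For \<open>p = 1\<close> this can be done for each fixed
\<open>y\<close>, column by column. For \<open>p > 1\<close> the average in \<open>y\<close> stands inside the
average in \<open>x\<close>, and the defining property of reducing operators concerns single vectors only.
But \<open>v \<mapsto> (avg\<^sub>y |V\<^sup>-\<^sup>1\<^sup>/\<^sup>p(y) v|\<^sup>p\<^sup>')\<^sup>1\<^sup>/\<^sup>p\<^sup>'\<close> is a norm, and by Auerbach's lemma
(\<open>Auerbach_coordinates\<close>) it is comparable to the sum of the moduli of \<open>n\<close> linear functionals,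
with constants depending on \<open>n\<close> alone. Since \<open>U\<^sup>1\<^sup>/\<^sup>q(x)\<close> is Hermitian, these functionals can be
moved to its other side, where they become \<open>n\<close> fixed vectors (\<open>dual_size_coordinates\<close>).

The powers of a matrix weight must be shown to exist and to be measurable: the spectral theorem gives
existence, a commutation argument uniqueness, and a compactness argument continuity on the positive
definite matrices (\<open>tendsto_mat_powr\<close>).
\<close>

section \<open>Diagonalization of Hermitian matrices\<close>

definition hinner :: "complex ^ 'n \<Rightarrow> complex ^ 'n \<Rightarrow> complex" where
  "hinner u v = (\<Sum>i\<in>UNIV. u $ i * cnj (v $ i))"

lemma Re_hinner: "Re (hinner u v) = u \<bullet> v"
  by (simp add: hinner_def inner_vec_def inner_complex_def)

lemma hinner_self: "hinner u u = of_real ((norm u)\<^sup>2)"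
proof -
  have "hinner u u = (\<Sum>i\<in>UNIV. of_real ((norm (u $ i))\<^sup>2))"
    unfolding hinner_def by (simp add: complex_norm_square del: of_real_power)
  also have "\<dots> = of_real ((norm u)\<^sup>2)"
    by (simp add: norm_vec_def L2_set_def sum_nonneg)
  finally show ?thesis .
qed

lemma hinner_commute: "hinner u v = cnj (hinner v u)"
  by (simp add: hinner_def mult.commute)

lemma hinner_scaleR_left: "hinner (c *\<^sub>R u) v = of_real c * hinner u v"
  unfolding hinner_def by (simp add: sum_distrib_left scaleR_conv_of_real[where 'a = complex] mult_ac)

lemma hinner_scaleR_right: "hinner u (c *\<^sub>R v) = of_real c * hinner u v"
  unfolding hinner_def by (simp add: sum_distrib_left scaleR_conv_of_real[where 'a = complex] mult_ac)

lemma hinner_add_left: "hinner (u + u') v = hinner u v + hinner u' v"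
  unfolding hinner_def by (simp add: sum.distrib algebra_simps)

lemma ctranspose_nth: "ctranspose A $ i $ j = cnj (A $ j $ i)"
  by (simp add: ctranspose_def map_matrix_def transpose_def)

lemma hinner_ctranspose: "hinner (A *v u) v = hinner u (ctranspose A *v v)"
  unfolding hinner_def matrix_vector_mult_def
  by (simp add: sum_distrib_left sum_distrib_right ctranspose_nth mult_ac)
     (rule sum.swap)

lemma self_adjoint_hinner: "self_adjoint A \<Longrightarrow> hinner (A *v u) v = hinner u (A *v v)"
  by (simp add: hinner_ctranspose self_adjoint_def)

lemma self_adjoint_inner: "self_adjoint A \<Longrightarrow> (A *v u) \<bullet> v = u \<bullet> (A *v v)"
  by (metis self_adjoint_hinner Re_hinner)

lemma ctranspose_mult: "ctranspose (A ** B) = ctranspose B ** ctranspose A"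
  by (simp add: vec_eq_iff ctranspose_nth matrix_matrix_mult_def mult.commute)

lemma ctranspose_ctranspose: "ctranspose (ctranspose A) = A"
  by (simp add: vec_eq_iff ctranspose_nth)

lemma ctranspose_real_diag: "ctranspose (real_diag w) = real_diag w"
  by (simp add: vec_eq_iff ctranspose_nth real_diag_def)

lemma real_diag_vec: "(real_diag w *v v) $ i = of_real (w $ i) * v $ i"
  by (simp add: real_diag_def matrix_vector_mult_def if_distrib[of "\<lambda>x. x * _"] cong: if_cong)

lemma matrix_vec_scaleR: "A *v (c *\<^sub>R v) = c *\<^sub>R (A *v (v::complex^'n))"
  by (simp add: linear_cmul matrix_vector_mul_bounded_linear bounded_linear.linear)

lemma continuous_hinner_left: "continuous_on S (\<lambda>v. hinner v p)"
  unfolding hinner_def by (intro continuous_intros)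

lemma continuous_on_matrix_vec: "continuous_on S (\<lambda>v. (A::complex^'n^'n) *v v)"
  by (rule linear_continuous_on) simp

text \<open>On the orthogonal complement of the eigenvectors found so far, a maximizer of the Rayleigh quotient
over the unit sphere is an eigenvector: its first variation vanishes. The complement is nonzero as long
as an index \<open>j0\<close> is left over.\<close>
lemma orthogonal_eigenvector:
  fixes A :: "complex ^ 'n ^ 'n" and p :: "'n \<Rightarrow> complex ^ 'n"
  assumes A: "self_adjoint A" and J: "j0 \<notin> J"
    and eig: "\<And>j. j \<in> J \<Longrightarrow> A *v p j = w j *\<^sub>R p j"
  obtains v c where "norm v = 1" "A *v v = c *\<^sub>R v" "\<And>j. j \<in> J \<Longrightarrow> hinner v (p j) = 0"
proof -
  define S where "S = {v. \<forall>j\<in>J. hinner v (p j) = 0}"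
  \<comment> \<open>Row \<open>j0\<close> of \<open>M\<close> is zero, so \<open>M\<close> is singular; a kernel vector is orthogonal to all \<open>p j\<close>.\<close>
  define M :: "complex^'n^'n" where "M = (\<chi> j i. if j \<in> J then cnj (p j $ i) else 0)"
  have "row j0 M = 0" using J by (simp add: M_def row_def vec_eq_iff)
  hence "det M = 0" by (rule det_zero_row)
  hence "\<not> (\<exists>B. B ** M = mat 1)"
    by (metis invertible_det_nz invertible_left_inverse)
  then obtain v0 where v0: "M *v v0 = 0" "v0 \<noteq> 0"
    unfolding matrix_left_invertible_ker by auto
  have "(M *v v0) $ j = hinner v0 (p j)" if "j \<in> J" for j
    using that by (simp add: M_def matrix_vector_mult_def hinner_def mult.commute)
  with v0 have v0S: "v0 \<in> S" by (simp add: S_def)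
  have S_scale: "c *\<^sub>R u \<in> S" if "u \<in> S" for c u
    using that by (simp add: S_def hinner_scaleR_left)
  have S_add: "u + u' \<in> S" if "u \<in> S" "u' \<in> S" for u u'
    using that by (simp add: S_def hinner_add_left)
  have S_A: "A *v u \<in> S" if "u \<in> S" for u
    using that by (simp add: S_def self_adjoint_hinner[OF A] eig hinner_scaleR_right)
  define K where "K = S \<inter> sphere 0 1"
  have "closed S"
  proof -
    have "S = (\<Inter>j\<in>J. {v. hinner v (p j) = 0})" by (auto simp: S_def)
    moreover have "closed {v. hinner v (p j) = 0}" for j
      by (intro closed_Collect_eq continuous_hinner_left continuous_on_const)
    ultimately show ?thesis by auto
  qed
  hence "compact K" unfolding K_def by (intro closed_Int_compact compact_sphere)
  moreover have "K \<noteq> {}"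
    using S_scale[OF v0S, of "1 / norm v0"] v0(2) unfolding K_def by force
  moreover have "continuous_on K (\<lambda>v. (A *v v) \<bullet> v)"
    by (intro continuous_intros continuous_on_matrix_vec)
  ultimately obtain v where v: "v \<in> K" and max: "\<And>u. u \<in> K \<Longrightarrow> (A *v u) \<bullet> u \<le> (A *v v) \<bullet> v"
    using continuous_attains_sup[of K "\<lambda>v. (A *v v) \<bullet> v"] by metis
  define c where "c = (A *v v) \<bullet> v"
  have vS: "v \<in> S" and v1: "norm v = 1" using v by (auto simp: K_def)
  have le: "(A *v u) \<bullet> u \<le> c * (u \<bullet> u)" if u: "u \<in> S" for u
  proof (cases "u = 0")
    case False
    have "(1 / norm u) *\<^sub>R u \<in> K" using S_scale[OF u] False by (simp add: K_def)
    from max[OF this] have "((A *v u) \<bullet> u) / (norm u)\<^sup>2 \<le> c"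
      by (simp add: matrix_vec_scaleR c_def power2_eq_square)
    thus ?thesis using False by (simp add: pos_divide_le_eq flip: power2_norm_eq_inner)
  qed simp
  define z where "z = A *v v - c *\<^sub>R v"
  have zS: "z \<in> S" using S_add[OF S_A[OF vS] S_scale[OF vS, of "-c"]] by (simp add: z_def)
  \<comment> \<open>The quadratic form of \<open>A - c\<close> is nonpositive on \<open>S\<close> and vanishes at \<open>v\<close>; evaluate it at \<open>v + t z\<close>.\<close>
  have quad: "2 * t * (z \<bullet> z) + t\<^sup>2 * ((A *v z) \<bullet> z - c * (z \<bullet> z)) \<le> 0" for t
  proof -
    have "(A *v (v + t *\<^sub>R z)) \<bullet> (v + t *\<^sub>R z) \<le> c * ((v + t *\<^sub>R z) \<bullet> (v + t *\<^sub>R z))"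
      by (intro le S_add S_scale vS zS)
    moreover have "(A *v z) \<bullet> v = (A *v v) \<bullet> z"
      using self_adjoint_inner[OF A, of z v] by (simp add: inner_commute)
    moreover have "v \<bullet> v = 1" using v1 by (simp add: norm_eq_1)
    ultimately have "2 * t * ((A *v v) \<bullet> z) + t\<^sup>2 * ((A *v z) \<bullet> z)
        \<le> 2 * t * c * (v \<bullet> z) + t\<^sup>2 * c * (z \<bullet> z)"
      by (simp add: matrix_vector_right_distrib matrix_vec_scaleR inner_add_left inner_add_right
          inner_commute[of z v] c_def[symmetric] algebra_simps power2_eq_square)
    moreover have zz: "z \<bullet> z = (A *v v) \<bullet> z - c * (v \<bullet> z)"
      by (subst (1) z_def) (simp add: inner_diff_left)
    have "2 * t * (z \<bullet> z) = 2 * t * ((A *v v) \<bullet> z) - 2 * t * c * (v \<bullet> z)"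
      by (subst zz) (simp add: right_diff_distrib)
    ultimately show ?thesis by (simp add: right_diff_distrib)
  qed
  have "z \<bullet> z \<le> 0"
  proof (rule ccontr)
    assume *: "\<not> z \<bullet> z \<le> 0"
    define b where "b = z \<bullet> z"
    define h where "h = (A *v z) \<bullet> z - c * (z \<bullet> z)"
    have b: "b > 0" using * unfolding b_def by linarith
    \<comment> \<open>Small enough for the term linear in \<open>t\<close> to dominate the quadratic one.\<close>
    define t where "t = b / (\<bar>h\<bar> + 1)"
    have t: "t > 0" using b by (simp add: t_def)
    have "t * (2 * b + t * h) \<le> 0" using quad[of t]
      by (simp add: b_def h_def algebra_simps power2_eq_square)
    hence "2 * b + t * h \<le> 0" using t by (simp add: mult_le_0_iff)
    moreover have "t * \<bar>h\<bar> \<le> b" using b by (simp add: t_def field_simps)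
    moreover have "- (t * \<bar>h\<bar>) \<le> t * h" using t by (metis abs_ge_minus_self abs_mult abs_of_pos minus_le_iff)
    ultimately show False using b by linarith
  qed
  hence "z = 0" by (metis inner_gt_zero_iff not_le)
  hence "A *v v = c *\<^sub>R v" by (simp add: z_def)
  thus thesis using that[of v c] vS v1 by (auto simp: S_def)
qed

lemma orthonormal_eigenvectors:
  fixes A :: "complex ^ 'n ^ 'n" and J :: "'n set"
  assumes A: "self_adjoint A"
  shows "\<exists>p w. \<forall>j\<in>J. A *v p j = w j *\<^sub>R p j \<and> (\<forall>k\<in>J. hinner (p j) (p k) = (if j = k then 1 else 0))"
proof -
  have "finite J" by simp
  thus ?thesis
  proof (induction J rule: finite_induct)
    case (insert j0 J)
    then obtain p w where pw: "\<forall>j\<in>J. A *v p j = w j *\<^sub>R p j \<and> (\<forall>k\<in>J. hinner (p j) (p k) = (if j = k then 1 else 0))"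
      by blast
    obtain v c where v: "norm v = 1" "A *v v = c *\<^sub>R v" "\<And>j. j \<in> J \<Longrightarrow> hinner v (p j) = 0"
      using orthogonal_eigenvector[OF A insert(2), of p w] pw by blast
    have v': "hinner (p j) v = 0" if "j \<in> J" for j
      using v(3)[OF that] by (subst hinner_commute) simp
    have "hinner v v = 1" using v(1) by (simp add: hinner_self)
    hence "\<forall>j\<in>insert j0 J. A *v (p(j0 := v)) j = (w(j0 := c)) j *\<^sub>R (p(j0 := v)) j \<and>
        (\<forall>k\<in>insert j0 J. hinner ((p(j0 := v)) j) ((p(j0 := v)) k) = (if j = k then 1 else 0))"
      using pw v v' insert(2) by auto
    thus ?case by blast
  qed simp
qed

lemma spectral_theorem:
  fixes A :: "complex ^ 'n ^ 'n"
  assumes A: "self_adjoint A"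
  obtains P w where "unitary P" "A = P ** real_diag w ** ctranspose P"
proof -
  obtain p :: "'n \<Rightarrow> complex ^ 'n" and w where "\<forall>j\<in>UNIV. A *v p j = w j *\<^sub>R p j \<and>
      (\<forall>k\<in>UNIV. hinner (p j) (p k) = (if j = k then 1 else 0))"
    using orthonormal_eigenvectors[OF A, of UNIV] by blast
  hence pw: "\<And>j. A *v p j = w j *\<^sub>R p j"
      "\<And>j k. hinner (p j) (p k) = (if j = k then 1 else 0)" by simp_all
  define P :: "complex^'n^'n" where "P = (\<chi> i j. p j $ i)"
  have "(ctranspose P ** P) $ k $ j = hinner (p j) (p k)" for j k
    by (simp add: matrix_matrix_mult_def ctranspose_nth P_def hinner_def mult.commute)
  hence PP: "ctranspose P ** P = mat 1" by (simp add: vec_eq_iff pw(2) mat_def)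
  hence PP': "P ** ctranspose P = mat 1" by (simp add: matrix_left_right_inverse)
  have "(A ** P) $ i $ j = (P ** real_diag (\<chi> j. w j)) $ i $ j" for i j
  proof -
    have "(A ** P) $ i $ j = (A *v p j) $ i"
      by (simp add: matrix_matrix_mult_def matrix_vector_mult_def P_def)
    thus ?thesis unfolding pw(1)
      by (simp add: matrix_matrix_mult_def real_diag_def P_def if_distrib[of "\<lambda>x. _ * x"]
          scaleR_conv_of_real[where 'a = complex] mult.commute cong: if_cong)
  qed
  hence "A ** P = P ** real_diag (\<chi> j. w j)" by (simp add: vec_eq_iff)
  hence "A = P ** real_diag (\<chi> j. w j) ** ctranspose P"
    by (metis PP' matrix_mul_assoc matrix_mul_rid)
  thus thesis using that[of P "\<chi> j. w j"] PP PP' by (simp add: unitary_def)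
qed

lemma diagonalization_eigenvector:
  assumes "unitary P" "A = P ** real_diag w ** ctranspose P"
  shows "A *v column j P = (w $ j) *\<^sub>R column j P" "norm (column j P) = 1"
proof -
  have "A ** P = P ** real_diag w"
    using assms by (metis matrix_mul_assoc matrix_mul_rid unitary_def)
  hence "(A ** P) $ i $ j = (P ** real_diag w) $ i $ j" for i by simp
  thus "A *v column j P = (w $ j) *\<^sub>R column j P"
    by (simp add: vec_eq_iff matrix_matrix_mult_def matrix_vector_mult_def column_def real_diag_def
       if_distrib[of "\<lambda>x. _ * x"] scaleR_conv_of_real[where 'a = complex] mult.commute cong: if_cong)
  have "hinner (column j P) (column j P) = (ctranspose P ** P) $ j $ j"
    by (simp add: hinner_def matrix_matrix_mult_def ctranspose_nth column_def mult.commute)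
  also have "\<dots> = 1" using assms by (simp add: unitary_def mat_def)
  finally have "complex_of_real ((norm (column j P))\<^sup>2) = complex_of_real 1" by (simp add: hinner_self)
  hence "(norm (column j P))\<^sup>2 = 1" unfolding of_real_eq_iff .
  thus "norm (column j P) = 1" by (metis abs_norm_cancel abs_1 power2_eq_iff_nonneg norm_ge_zero one_power2 zero_le_one)
qed

lemma inner_diagonalization:
  assumes "A = P ** real_diag w ** ctranspose P"
  shows "(A *v e) \<bullet> e = (\<Sum>i\<in>UNIV. w $ i * (norm ((ctranspose P *v e) $ i))\<^sup>2)"
proof -
  have "hinner (A *v e) e = hinner (real_diag w *v (ctranspose P *v e)) (ctranspose P *v e)"
    unfolding assms by (simp add: hinner_ctranspose ctranspose_ctranspose flip: matrix_vector_mul_assoc)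
  hence "(A *v e) \<bullet> e = (real_diag w *v (ctranspose P *v e)) \<bullet> (ctranspose P *v e)"
    by (metis Re_hinner)
  thus ?thesis
    by (simp add: inner_vec_def real_diag_vec power2_norm_eq_inner inner_complex_def algebra_simps sum.distrib)
qed

lemma self_adjoint_diagonalization: "self_adjoint (P ** real_diag w ** ctranspose P)"
  by (simp add: self_adjoint_def ctranspose_mult ctranspose_ctranspose ctranspose_real_diag matrix_mul_assoc)

lemma pos_def_diagonalization_iff:
  assumes P: "unitary P" and A: "A = P ** real_diag w ** ctranspose P"
  shows "pos_def A \<longleftrightarrow> (\<forall>i. 0 < w $ i)"
proof
  assume "pos_def A"
  show "\<forall>i. 0 < w $ i"
  proof
    fix i
    have "column i P \<noteq> 0" using diagonalization_eigenvector(2)[OF P A, of i] by auto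
    hence "0 < (A *v column i P) \<bullet> column i P" using \<open>pos_def A\<close> by (simp add: pos_def_def)
    thus "0 < w $ i"
      using diagonalization_eigenvector[OF P A, of i] by (simp add: norm_eq_1)
  qed
next
  assume w: "\<forall>i. 0 < w $ i"
  have "0 < (A *v e) \<bullet> e" if "e \<noteq> 0" for e
  proof -
    have "ctranspose P *v e \<noteq> 0"
    proof
      assume "ctranspose P *v e = 0"
      hence "P *v (ctranspose P *v e) = 0" by simp
      thus False using P that by (simp add: matrix_vector_mul_assoc unitary_def)
    qed
    then obtain i where "(ctranspose P *v e) $ i \<noteq> 0" by (auto simp: vec_eq_iff)
    thus ?thesis unfolding inner_diagonalization[OF A] using w
      by (intro sum_pos2[of _ i]) (auto intro!: mult_nonneg_nonneg simp: less_imp_le)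
  qed
  thus "pos_def A" using A by (auto simp: pos_def_def self_adjoint_diagonalization)
qed

text \<open>The unitary \<open>Q = P\<^sup>* P'\<close> intertwines the two diagonal matrices. Hence \<open>Q $ i $ j\<close> vanishes
unless \<open>w $ i = w' $ j\<close>, and so \<open>Q\<close> intertwines the images of the two diagonals under any
function \<open>f\<close>. This is what makes the definite description in \<^const>\<open>mat_powr\<close> denote a value.\<close>
lemma diagonal_function_unique:
  fixes P P' :: "complex ^ 'n ^ 'n"
  assumes P: "unitary P" and P': "unitary P'"
    and eq: "P ** real_diag w ** ctranspose P = P' ** real_diag w' ** ctranspose P'"
  shows "P ** real_diag (\<chi> i. f (w $ i)) ** ctranspose P = P' ** real_diag (\<chi> i. f (w' $ i)) ** ctranspose P'"
proof -
  define Q where "Q = ctranspose P ** P'"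
  have PQ: "P ** Q = P'" unfolding Q_def
    by (metis P matrix_mul_assoc matrix_mul_lid unitary_def)
  have nth: "(real_diag u ** Q) $ i $ j = of_real (u $ i) * Q $ i $ j"
      "(Q ** real_diag u) $ i $ j = Q $ i $ j * of_real (u $ j)" for u i j
    by (simp_all add: matrix_matrix_mult_def real_diag_def if_distrib[of "\<lambda>x. _ * x"]
        if_distrib[of "\<lambda>x. x * _"] cong: if_cong)
  have 1: "real_diag w ** Q = Q ** real_diag w'"
  proof -
    have "real_diag w ** Q = ctranspose P ** (P ** real_diag w ** ctranspose P) ** P'"
      unfolding Q_def by (metis P matrix_mul_assoc matrix_mul_lid unitary_def)
    also have "\<dots> = Q ** real_diag w' ** (ctranspose P' ** P')" unfolding eq Q_def by (simp add: matrix_mul_assoc)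
    finally show ?thesis using P' by (simp add: unitary_def)
  qed
  have 2: "real_diag (\<chi> i. f (w $ i)) ** Q = Q ** real_diag (\<chi> i. f (w' $ i))"
  proof -
    have "of_real (w $ i) * Q $ i $ j = Q $ i $ j * of_real (w' $ j)" for i j
      using 1 by (metis nth)
    hence "Q $ i $ j = 0 \<or> w $ i = w' $ j" for i j
      by (metis mult.commute mult_cancel_left of_real_eq_iff)
    hence "complex_of_real (f (w $ i)) * Q $ i $ j = Q $ i $ j * of_real (f (w' $ j))" for i j
      by (metis mult.commute mult_zero_left)
    thus ?thesis by (simp add: vec_eq_iff nth)
  qed
  have "P ** real_diag (\<chi> i. f (w $ i)) ** ctranspose P
      = P ** (real_diag (\<chi> i. f (w $ i)) ** (Q ** ctranspose P'))"
    unfolding Q_def by (metis P' matrix_mul_assoc matrix_mul_rid unitary_def)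
  also have "\<dots> = P ** Q ** real_diag (\<chi> i. f (w' $ i)) ** ctranspose P'"
    by (metis 2 matrix_mul_assoc)
  finally show ?thesis by (simp add: PQ)
qed

lemma mat_powr_diagonalization:
  assumes P: "unitary P" and A: "A = P ** real_diag w ** ctranspose P"
  shows "mat_powr A r = P ** real_diag (\<chi> i. w $ i powr r) ** ctranspose P"
  unfolding mat_powr_def
proof (rule the_equality)
  show "\<exists>P' w'. unitary P' \<and> A = P' ** real_diag w' ** ctranspose P' \<and>
      P ** real_diag (\<chi> i. w $ i powr r) ** ctranspose P = P' ** real_diag (\<chi> i. w' $ i powr r) ** ctranspose P'"
    using assms by blast
qed (use assms diagonal_function_unique[where f = "\<lambda>x. x powr r"] in metis)

lemma pos_def_mat_powr:
  assumes "pos_def A" shows "pos_def (mat_powr A r)"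
proof -
  obtain P w where Pw: "unitary P" "A = P ** real_diag w ** ctranspose P"
    using assms spectral_theorem unfolding pos_def_def by metis
  have "\<forall>i. 0 < w $ i" using pos_def_diagonalization_iff[OF Pw] assms by simp
  thus ?thesis unfolding mat_powr_diagonalization[OF Pw]
    by (subst pos_def_diagonalization_iff[OF Pw(1) refl]) (simp add: less_imp_neq[symmetric])
qed

section \<open>Operator norms and measurability of powers of matrix weights\<close>

lemma norm_vec_le_sum: "norm x \<le> (\<Sum>i\<in>UNIV. norm (x $ i))"
  by (simp add: norm_vec_def L2_set_le_sum)

text \<open>A norm on matrices that is visibly continuous and comparable to all the others.\<close>
definition entry_sum :: "complex ^ 'n ^ 'n \<Rightarrow> real" where
  "entry_sum A = (\<Sum>i\<in>UNIV. \<Sum>j\<in>UNIV. norm (A $ i $ j))"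

lemma norm_matrix_vec_le_entry_sum: "norm (A *v x) \<le> entry_sum A * norm x"
proof -
  have "norm (A *v x) \<le> (\<Sum>i\<in>UNIV. norm (\<Sum>j\<in>UNIV. A $ i $ j * x $ j))"
    using norm_vec_le_sum[of "A *v x"] by (simp add: matrix_vector_mult_def)
  also have "\<dots> \<le> (\<Sum>i\<in>UNIV. \<Sum>j\<in>UNIV. norm (A $ i $ j) * norm x)"
    by (intro sum_mono order_trans[OF norm_sum])
       (auto simp: norm_mult intro!: mult_left_mono Finite_Cartesian_Product.norm_nth_le)
  finally show ?thesis by (simp add: entry_sum_def sum_distrib_right)
qed

lemma norm_matrix_vec_le: "norm (A *v x) \<le> op_norm A * norm (x :: complex ^ 'n)"
  by (rule onorm) simp

lemma op_norm_nonneg: "0 \<le> op_norm (A :: complex ^ 'n ^ 'n)"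
  by (rule onorm_pos_le) simp

lemma op_norm_le_entry_sum: "op_norm (A :: complex ^ 'n ^ 'n) \<le> entry_sum A"
  by (rule onorm_le) (rule norm_matrix_vec_le_entry_sum)

lemma op_norm_triangle: "op_norm (A + B) \<le> op_norm A + op_norm (B :: complex ^ 'n ^ 'n)"
proof -
  have "(*v) (A + B) = (\<lambda>x. A *v x + B *v x)" by (simp add: fun_eq_iff matrix_vector_mult_add_rdistrib)
  thus ?thesis using onorm_triangle[of "(*v) A" "(*v) B"] by simp
qed

lemma tendsto_entry_sum [tendsto_intros]: "(f \<longlongrightarrow> A) F \<Longrightarrow> ((\<lambda>x. entry_sum (f x)) \<longlongrightarrow> entry_sum A) F"
  unfolding entry_sum_def by (intro tendsto_intros)

lemma tendsto_op_norm:
  fixes A :: "complex ^ 'n ^ 'n"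
  assumes "(f \<longlongrightarrow> A) F"
  shows "((\<lambda>x. op_norm (f x)) \<longlongrightarrow> op_norm A) F"
proof (rule Lim_transform_bound[THEN Lim_null[THEN iffD2]])
  show "\<forall>\<^sub>F x in F. norm (op_norm (f x) - op_norm A) \<le> norm (entry_sum (f x - A) + entry_sum (A - f x))"
  proof (rule always_eventually, rule allI)
    fix x
    have 1: "op_norm (f x) \<le> op_norm A + entry_sum (f x - A)"
      using op_norm_triangle[of A "f x - A"] op_norm_le_entry_sum[of "f x - A"] by simp
    have 2: "op_norm A \<le> op_norm (f x) + entry_sum (A - f x)"
      using op_norm_triangle[of "f x" "A - f x"] op_norm_le_entry_sum[of "A - f x"] by simp
    have 3: "0 \<le> entry_sum (A - f x)" "0 \<le> entry_sum (f x - A)" by (auto simp: entry_sum_def intro!: sum_nonneg)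
    show "norm (op_norm (f x) - op_norm A) \<le> norm (entry_sum (f x - A) + entry_sum (A - f x))"
      using 1 2 3 by simp
  qed
  have "((\<lambda>x. entry_sum (f x - A) + entry_sum (A - f x)) \<longlongrightarrow> entry_sum (A - A) + entry_sum (A - A)) F"
    by (intro tendsto_intros assms)
  thus "((\<lambda>x. entry_sum (f x - A) + entry_sum (A - f x)) \<longlongrightarrow> 0) F"
    by (simp add: entry_sum_def)
qed

lemma borel_measurable_op_norm: "(\<lambda>A :: complex ^ 'n ^ 'n. op_norm A) \<in> borel_measurable borel"
  by (intro borel_measurable_continuous_onI) (auto simp: continuous_on_def intro!: tendsto_op_norm tendsto_ident_at)

lemma tendsto_matrix_mult:
  fixes A B :: "complex ^ 'n ^ 'n"
  assumes "(f \<longlongrightarrow> A) F" "(g \<longlongrightarrow> B) F"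
  shows "((\<lambda>x. f x ** g x) \<longlongrightarrow> A ** B) F"
  unfolding matrix_matrix_mult_def by (intro tendsto_intros assms)

lemma tendsto_ctranspose:
  assumes "(f \<longlongrightarrow> A) F"
  shows "((\<lambda>x. ctranspose (f x)) \<longlongrightarrow> ctranspose A) F"
  unfolding ctranspose_def map_matrix_def transpose_def by (simp, intro tendsto_intros assms)

lemma tendsto_real_diag:
  assumes "(f \<longlongrightarrow> w) F"
  shows "((\<lambda>x. real_diag (f x)) \<longlongrightarrow> real_diag w) F"
  unfolding real_diag_def
proof (intro tendsto_vec_lambda)
  fix i j
  show "((\<lambda>x. if i = j then complex_of_real (f x $ i) else 0) \<longlongrightarrow> (if i = j then complex_of_real (w $ i) else 0)) F"
    by (cases "i = j") (auto intro!: tendsto_intros assms)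
qed

lemma norm_unitary_le: "unitary P \<Longrightarrow> norm P \<le> (real CARD('n))" for P :: "complex ^ 'n ^ 'n"
proof -
  assume P: "unitary P"
  have "(P ** ctranspose P) $ i $ i = hinner (P $ i) (P $ i)" for i
    by (simp add: matrix_matrix_mult_def ctranspose_nth hinner_def)
  hence "hinner (P $ i) (P $ i) = 1" for i using P by (simp add: unitary_def mat_def)
  hence "complex_of_real ((norm (P $ i))\<^sup>2) = complex_of_real 1" for i by (simp add: hinner_self)
  hence "(norm (P $ i))\<^sup>2 = 1" for i unfolding of_real_eq_iff .
  hence 1: "norm (P $ i) = 1" for i
    by (metis power2_eq_iff_nonneg norm_ge_zero one_power2 zero_le_one)
  have "norm P \<le> (\<Sum>i\<in>(UNIV::'n set). 1)" using norm_vec_le_sum[of P] by (simp add: 1)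
  thus ?thesis by simp
qed

text \<open>Otherwise some subsequence of the powers stays away from the limit. The unitary factors and the
eigenvalues of a convergent sequence are bounded, so along a further subsequence both converge, and
their limits diagonalize \<open>A\<close>. Uniqueness of the power then gives a contradiction; positivity of
the limiting eigenvalues is needed for the continuity of \<open>powr\<close> there.\<close>
lemma tendsto_mat_powr:
  fixes X :: "nat \<Rightarrow> complex ^ 'n ^ 'n"
  assumes X: "\<And>k. pos_def (X k)" and A: "pos_def A" and lim: "X \<longlonglongrightarrow> A"
  shows "(\<lambda>k. mat_powr (X k) r) \<longlonglongrightarrow> mat_powr A r"
proof (rule ccontr)
  assume "\<not> ?thesis"
  hence "\<exists>e>0. \<not> (\<forall>\<^sub>F k in sequentially. dist (mat_powr (X k) r) (mat_powr A r) < e)"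
    unfolding tendsto_iff by simp
  then obtain e where e: "e > 0"
      "\<not> (\<forall>\<^sub>F k in sequentially. dist (mat_powr (X k) r) (mat_powr A r) < e)" by metis
  have "infinite {k. \<not> dist (mat_powr (X k) r) (mat_powr A r) < e}"
    using e(2) by (simp flip: cofinite_eq_sequentially add: eventually_cofinite)
  from infinite_enumerate[OF this] obtain s :: "nat \<Rightarrow> nat" where s1: "strict_mono s"
      and s2: "\<forall>k. s k \<in> {k. \<not> dist (mat_powr (X k) r) (mat_powr A r) < e}" by blast
  have s: "strict_mono s" "\<And>k. \<not> dist (mat_powr (X (s k)) r) (mat_powr A r) < e"
    using s1 s2 by simp_all
  have "\<forall>k. \<exists>P w. unitary P \<and> X k = P ** real_diag w ** ctranspose P"
    using X spectral_theorem unfolding pos_def_def by metis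
  then obtain P w where Pw: "\<And>k. unitary (P k)" "\<And>k. X k = P k ** real_diag (w k) ** ctranspose (P k)"
    by metis
  have "Bseq (\<lambda>k. entry_sum (X k))"
    using tendsto_entry_sum[OF lim] by (intro convergent_imp_Bseq) (auto simp: convergent_def)
  then obtain M where M: "\<And>k. norm (entry_sum (X k)) \<le> M" by (auto simp: Bseq_def)
  have w: "norm (w k) \<le> real CARD('n) * M" for k
  proof -
    have "\<bar>w k $ j\<bar> \<le> M" for j
      using diagonalization_eigenvector[OF Pw(1)[of k] Pw(2)[of k], of j] M[of k]
        norm_matrix_vec_le_entry_sum[of "X k" "column j (P k)"] by simp
    hence "(\<Sum>j\<in>UNIV. norm (w k $ j)) \<le> (\<Sum>j\<in>(UNIV::'n set). M)" by (intro sum_mono) simp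
    thus ?thesis using norm_vec_le_sum[of "w k"] by simp
  qed
  have "compact (cball (0::complex^'n^'n) (real CARD('n)) \<times> cball (0::real^'n) (real CARD('n) * M))"
    by (intro compact_Times compact_cball)
  moreover have "\<forall>k. (P (s k), w (s k)) \<in> cball 0 (real CARD('n)) \<times> cball 0 (real CARD('n) * M)"
    using norm_unitary_le[OF Pw(1)] w by simp
  ultimately obtain l t where t: "strict_mono t" "((\<lambda>k. (P (s k), w (s k))) \<circ> t) \<longlonglongrightarrow> l"
    unfolding compact_def by meson
  obtain P0 w0 where l: "l = (P0, w0)" by fastforce
  define P' w' where "P' = (\<lambda>k. P (s (t k)))" and "w' = (\<lambda>k. w (s (t k)))"
  have P': "P' \<longlonglongrightarrow> P0" using tendsto_fst[OF t(2)] by (simp add: l P'_def o_def)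
  have w': "w' \<longlonglongrightarrow> w0" using tendsto_snd[OF t(2)] by (simp add: l w'_def o_def)
  have U': "unitary (P' k)" for k by (simp add: P'_def Pw)
  have "(\<lambda>k. P' k ** ctranspose (P' k)) \<longlonglongrightarrow> P0 ** ctranspose P0"
    by (intro tendsto_matrix_mult tendsto_ctranspose P')
  hence "P0 ** ctranspose P0 = mat 1"
    using U' by (simp add: unitary_def LIMSEQ_const_iff)
  hence P0: "unitary P0" by (simp add: unitary_def matrix_left_right_inverse)
  have lim': "(\<lambda>k. X (s (t k))) \<longlonglongrightarrow> A"
    using LIMSEQ_subseq_LIMSEQ[OF lim strict_mono_o[OF s(1) t(1)]] by (simp add: o_def)
  have X': "X (s (t k)) = P' k ** real_diag (w' k) ** ctranspose (P' k)" for k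
    by (simp add: P'_def w'_def Pw)
  have "(\<lambda>k. X (s (t k))) \<longlonglongrightarrow> P0 ** real_diag w0 ** ctranspose P0"
    unfolding X' by (intro tendsto_matrix_mult tendsto_ctranspose tendsto_real_diag P' w')
  hence A0: "A = P0 ** real_diag w0 ** ctranspose P0" using lim' LIMSEQ_unique by blast
  have w0: "0 < w0 $ i" for i using pos_def_diagonalization_iff[OF P0 A0] A by simp
  have "(\<lambda>k. \<chi> i. w' k $ i powr r) \<longlonglongrightarrow> (\<chi> i. w0 $ i powr r)"
    by (intro tendsto_vec_lambda tendsto_powr tendsto_vec_nth w' tendsto_const) (use w0 in \<open>auto simp: less_imp_neq[symmetric]\<close>)
  hence "(\<lambda>k. mat_powr (X (s (t k))) r) \<longlonglongrightarrow> mat_powr A r"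
    unfolding mat_powr_diagonalization[OF P0 A0] mat_powr_diagonalization[OF U' X']
    by (intro tendsto_matrix_mult tendsto_ctranspose tendsto_real_diag P')
  hence "\<forall>\<^sub>F k in sequentially. dist (mat_powr (X (s (t k))) r) (mat_powr A r) < e"
    using e(1) by (rule tendstoD)
  thus False using s(2) by (auto simp: eventually_sequentially)
qed

lemma continuous_on_mat_powr: "continuous_on {A. pos_def A} (\<lambda>A. mat_powr A r)"
  unfolding continuous_on_sequentially by (auto simp: o_def intro: tendsto_mat_powr)

lemma borel_measurable_vec_iff:
  fixes f :: "'a \<Rightarrow> 'b::euclidean_space ^ 'n"
  shows "f \<in> borel_measurable M \<longleftrightarrow> (\<forall>i. (\<lambda>x. f x $ i) \<in> borel_measurable M)"
proof safe
  fix i assume f: "f \<in> borel_measurable M"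
  have "(\<lambda>x::'b^'n. x $ i) \<in> borel_measurable borel"
    by (intro borel_measurable_continuous_onI continuous_intros)
  from measurable_compose[OF f this] show "(\<lambda>x. f x $ i) \<in> borel_measurable M" .
next
  assume *: "\<forall>i. (\<lambda>x. f x $ i) \<in> borel_measurable M"
  show "f \<in> borel_measurable M"
  proof (rule borel_measurable_euclidean_space[THEN iffD2], rule ballI)
    fix b :: "'b ^ 'n" assume "b \<in> Basis"
    then obtain i u where "b = axis i u" by (auto simp: Basis_vec_def)
    thus "(\<lambda>x. f x \<bullet> b) \<in> borel_measurable M"
      using * by (simp add: inner_axis borel_measurable_inner)
  qed
qed

lemma borel_measurable_locally_integrable:
  fixes f :: "real ^ 'd \<Rightarrow> 'b::euclidean_space"
  assumes "\<And>K. compact K \<Longrightarrow> f absolutely_integrable_on K"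
  shows "f \<in> borel_measurable lebesgue"
proof (rule borel_measurable_LIMSEQ_metric)
  fix k :: nat
  have "f absolutely_integrable_on cball 0 (real k)" by (intro assms compact_cball)
  thus "(\<lambda>x. indicator (cball 0 (real k)) x *\<^sub>R f x) \<in> borel_measurable lebesgue"
    by (auto simp: set_integrable_def)
next
  fix x :: "real ^ 'd"
  obtain N where N: "norm x \<le> real N" using real_arch_simple by blast
  have "\<forall>\<^sub>F k in sequentially. indicator (cball 0 (real k)) x *\<^sub>R f x = f x"
    using eventually_ge_at_top[of N] by eventually_elim (use N in \<open>auto simp: indicator_def\<close>)
  thus "(\<lambda>k. indicator (cball 0 (real k)) x *\<^sub>R f x) \<longlonglongrightarrow> f x" by (rule tendsto_eventually)
qed

lemma borel_measurable_matrix_weight: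
  assumes "matrix_weight U" shows "U \<in> borel_measurable lebesgue"
  using assms unfolding matrix_weight_def borel_measurable_vec_iff
  by (auto intro!: borel_measurable_locally_integrable)

text \<open>On the full-measure set where the weight is positive definite the power is a continuous function of
the matrix; the Lebesgue measure is complete, so the exceptional null set does no harm.\<close>
lemma borel_measurable_mat_powr:
  fixes U :: "real ^ 'd \<Rightarrow> complex ^ 'n ^ 'n"
  assumes "matrix_weight U"
  shows "(\<lambda>x. mat_powr (U x) r) \<in> borel_measurable lebesgue"
proof -
  define E where "E = {x. pos_def (U x)}"
  have ae: "AE x in lebesgue. x \<in> E" using assms by (simp add: E_def matrix_weight_def)
  have "Measurable.pred lebesgue (\<lambda>x. x \<notin> E)"
    using ae by (intro sets_completion_AE) (simp add: AE_completion_iff)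
  hence "{x \<in> space lebesgue. x \<notin> E} \<in> sets lebesgue" by (rule predE)
  hence "- E \<in> sets lebesgue" by (simp add: Compl_eq)
  hence E: "E \<in> sets lebesgue" by (simp add: Compl_in_sets_lebesgue)
  have "(\<lambda>x. mat_powr (U x) r) \<in> borel_measurable (restrict_space lebesgue E)"
  proof (rule measurable_compose[of U])
    show "U \<in> restrict_space lebesgue E \<rightarrow>\<^sub>M restrict_space borel {A. pos_def A}"
      using borel_measurable_matrix_weight[OF assms]
      by (intro measurable_restrict_space3) (auto simp: E_def)
    show "(\<lambda>A. mat_powr A r) \<in> borel_measurable (restrict_space borel {A. pos_def A})"
      by (intro borel_measurable_continuous_on_restrict continuous_on_mat_powr)
  qed
  hence "(\<lambda>x. if x \<in> E then mat_powr (U x) r else 0) \<in> borel_measurable lebesgue"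
    using E by (subst (asm) measurable_restrict_space_iff[where c = 0]) auto
  thus ?thesis
    by (rule borel_measurable_AE) (use ae in \<open>auto elim: eventually_mono\<close>)
qed

section \<open>Inequalities for \<open>L\<^sup>p\<close> norms\<close>

lemma enn_powr_ennreal: "0 \<le> x \<Longrightarrow> enn_powr (ennreal x) r = ennreal (x powr r)"
  by (simp add: enn_powr_def)

lemma enn_powr_mono: "0 \<le> r \<Longrightarrow> x \<le> y \<Longrightarrow> enn_powr x r \<le> enn_powr y r"
  by (auto simp: enn_powr_def top_unique less_top[symmetric] intro!: ennreal_leI powr_mono2 enn2real_mono)

lemma enn_powr_less_top_iff: "enn_powr x r < top \<longleftrightarrow> x < top"
  by (auto simp: enn_powr_def less_top)

lemma enn_powr_zero: "enn_powr 0 r = 0"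
  by (simp add: enn_powr_def)

lemma enn_powr_one: "enn_powr x 1 = x"
  by (cases x) (auto simp: enn_powr_def)

lemma enn_powr_enn_powr: "enn_powr (enn_powr x r) s = enn_powr x (r * s)"
  by (cases x) (auto simp: enn_powr_def powr_powr)

lemma enn_powr_mult: "enn_powr (x * y) r = enn_powr x r * enn_powr y r"
proof (cases "x = 0 \<or> y = 0")
  case False
  thus ?thesis
    by (cases x; cases y) (auto simp: enn_powr_def powr_mult ennreal_mult[symmetric] ennreal_mult_top
        ennreal_top_mult ennreal_mult_eq_top_iff)
qed (auto simp: enn_powr_zero)

lemma enn_powr_le_iff: "0 < r \<Longrightarrow> enn_powr x r \<le> y \<longleftrightarrow> x \<le> enn_powr y (1 / r)"
  by (metis enn_powr_enn_powr enn_powr_mono enn_powr_one less_imp_le nonzero_divide_eq_eq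
      mult.commute order_less_irrefl zero_le_divide_1_iff)

lemma le_enn_powr_iff: "0 < r \<Longrightarrow> y \<le> enn_powr x r \<longleftrightarrow> enn_powr y (1 / r) \<le> x"
  by (metis enn_powr_enn_powr enn_powr_mono enn_powr_one less_imp_le nonzero_divide_eq_eq
      mult.commute order_less_irrefl zero_le_divide_1_iff)

lemma borel_measurable_enn_powr: "(\<lambda>x. enn_powr x r) \<in> borel_measurable borel"
  unfolding enn_powr_def by measurable

lemma sum_powr_le:
  fixes f :: "'a \<Rightarrow> real"
  assumes "finite S" "\<And>i. i \<in> S \<Longrightarrow> 0 \<le> f i" "0 < r"
  shows "(\<Sum>i\<in>S. f i) powr r \<le> real (card S) powr r * (\<Sum>i\<in>S. f i powr r)"
proof (cases "S = {}")
  case False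
  define m where "m = Max (f ` S)"
  obtain k where k: "k \<in> S" "m = f k" using False assms(1) unfolding m_def
    by (metis (mono_tags) Max_in finite_imageI image_is_empty imageE)
  have le: "f i \<le> m" if "i \<in> S" for i using that assms(1) by (auto simp: m_def)
  have "(\<Sum>i\<in>S. f i) \<le> real (card S) * m" using sum_bounded_above[of S f m] le by simp
  hence "(\<Sum>i\<in>S. f i) powr r \<le> (real (card S) * m) powr r"
    using assms by (intro powr_mono2 sum_nonneg) auto
  also have "\<dots> = real (card S) powr r * f k powr r"
    by (simp add: k powr_mult)
  also have "\<dots> \<le> real (card S) powr r * (\<Sum>i\<in>S. f i powr r)"
    by (intro mult_left_mono member_le_sum k assms) auto
  finally show ?thesis .
qed simp

text \<open>Young's inequality, integrated after normalizing both factors. The values \<open>0\<close> and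
\<open>\<infinity>\<close> of the two integrals are treated separately.\<close>
lemma Hoelder_inequality:
  fixes g h :: "'a \<Rightarrow> real"
  assumes p: "1 < p" and g: "g \<in> borel_measurable M" "\<And>x. 0 \<le> g x"
    and h: "h \<in> borel_measurable M" "\<And>x. 0 \<le> h x"
  defines "p' \<equiv> p / (p - 1)"
  shows "(\<integral>\<^sup>+x. ennreal (g x * h x) \<partial>M)
    \<le> enn_powr (\<integral>\<^sup>+x. ennreal (g x powr p') \<partial>M) (1 / p') * enn_powr (\<integral>\<^sup>+x. ennreal (h x powr p) \<partial>M) (1 / p)"
proof -
  note [measurable] = g(1) h(1)
  have p': "p' > 1" and pp: "1 / p' + 1 / p = 1" using p by (auto simp: p'_def field_simps)
  define G where "G = (\<integral>\<^sup>+x. ennreal (g x powr p') \<partial>M)"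
  define H where "H = (\<integral>\<^sup>+x. ennreal (h x powr p) \<partial>M)"
  consider "G = 0 \<or> H = 0" | "G \<noteq> 0" "H \<noteq> 0" "G = top \<or> H = top" | "G \<noteq> 0" "H \<noteq> 0" "G \<noteq> top" "H \<noteq> top" by blast
  thus ?thesis
  proof cases
    case 1
    hence "AE x in M. ennreal (g x * h x) = 0"
    proof
      assume "G = 0"
      hence "AE x in M. ennreal (g x powr p') = 0" unfolding G_def by (subst (asm) nn_integral_0_iff_AE) auto
      thus ?thesis by eventually_elim (auto simp: ennreal_eq_0_iff)
    next
      assume "H = 0"
      hence "AE x in M. ennreal (h x powr p) = 0" unfolding H_def by (subst (asm) nn_integral_0_iff_AE) auto
      thus ?thesis by eventually_elim (auto simp: ennreal_eq_0_iff)
    qed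
    hence "(\<integral>\<^sup>+x. ennreal (g x * h x) \<partial>M) = 0" by (subst nn_integral_0_iff_AE) auto
    thus ?thesis by simp
  next
    case 2
    have pos: "enn_powr K r \<noteq> 0" if "K \<noteq> 0" for K r
      using that by (cases K) (auto simp: enn_powr_def)
    have "enn_powr G (1 / p') * enn_powr H (1 / p) = top"
      using 2(3) pos[OF 2(1)] pos[OF 2(2)] by (auto simp: enn_powr_def ennreal_mult_eq_top_iff)
    thus ?thesis unfolding G_def H_def by simp
  next
    case 3
    define \<gamma> where "\<gamma> = enn2real G"
    define \<eta> where "\<eta> = enn2real H"
    define a where "a = \<gamma> powr (1 / p')"
    define b where "b = \<eta> powr (1 / p)"
    have GH: "G = ennreal (\<gamma>)" "H = ennreal (\<eta>)" "\<gamma> > 0" "\<eta> > 0"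
      using 3 by (auto simp: \<gamma>_def \<eta>_def enn2real_positive_iff less_top zero_less_iff_neq_zero)
    have ab: "a > 0" "b > 0" using GH by (auto simp: a_def b_def)
    have ap: "a powr p' = \<gamma>" "b powr p = \<eta>"
      using p p' GH by (auto simp: a_def b_def powr_powr)
    have "ennreal (g x * h x) \<le> ennreal (a * b / (p' * \<gamma>)) * ennreal (g x powr p')
        + ennreal (a * b / (p * \<eta>)) * ennreal (h x powr p)" for x
    proof -
      have "(g x / a) * (h x / b) \<le> (g x / a) powr p' / p' + (h x / b) powr p / p"
        using p p' pp ab g(2)[of x] h(2)[of x] by (intro Youngs_inequality) auto
      also have "\<dots> = g x powr p' / (p' * \<gamma>) + h x powr p / (p * \<eta>)"
        using ab g(2)[of x] h(2)[of x] by (simp add: powr_divide ap mult.commute)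
      finally have "a * b * ((g x / a) * (h x / b)) \<le> a * b * (g x powr p' / (p' * \<gamma>) + h x powr p / (p * \<eta>))"
        using ab by (intro mult_left_mono) auto
      hence "g x * h x \<le> (a * b / (p' * \<gamma>)) * g x powr p' + (a * b / (p * \<eta>)) * h x powr p"
        using ab by (simp add: field_simps)
      thus ?thesis using ab p p' GH
        by (simp add: ennreal_mult[symmetric] ennreal_plus[symmetric] ennreal_leI del: ennreal_plus)
    qed
    hence "(\<integral>\<^sup>+x. ennreal (g x * h x) \<partial>M) \<le> (\<integral>\<^sup>+x. ennreal (a * b / (p' * \<gamma>)) * ennreal (g x powr p')
        + ennreal (a * b / (p * \<eta>)) * ennreal (h x powr p) \<partial>M)"
      by (intro nn_integral_mono)
    also have "\<dots> = ennreal (a * b / (p' * \<gamma>)) * G + ennreal (a * b / (p * \<eta>)) * H"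
      unfolding G_def H_def by (subst nn_integral_add) (auto simp: nn_integral_cmult)
    also have "\<dots> = ennreal (a * b / (p' * \<gamma>) * \<gamma> + a * b / (p * \<eta>) * \<eta>)"
      using ab p p' GH(3,4) unfolding GH(1,2) by (simp add: ennreal_mult[symmetric] ennreal_plus[symmetric] del: ennreal_plus)
    also have "a * b / (p' * \<gamma>) * \<gamma> + a * b / (p * \<eta>) * \<eta> = a * b * (1 / p' + 1 / p)"
      using GH p p' by (simp add: field_simps)
    also have "ennreal \<dots> = enn_powr G (1 / p') * enn_powr H (1 / p)"
      using ab GH by (simp add: pp enn_powr_ennreal a_def b_def ennreal_mult)
    finally show ?thesis unfolding G_def H_def .
  qed
qed

text \<open>The converse of Hoelder's inequality. Testing with \<open>h = min(g, k)\<close> to the power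
\<open>p' - 1\<close> bounds the norm of the truncation \<open>min(g, k)\<close>; truncation makes this norm finite,
so that it can be cancelled. Then let \<open>k\<close> tend to infinity.\<close>
lemma Lp_dual_bound:
  fixes g :: "'a \<Rightarrow> real"
  assumes M: "finite_measure M" and p: "1 < p" and C: "0 \<le> C"
    and g: "g \<in> borel_measurable M" "\<And>x. 0 \<le> g x"
    and bound: "\<And>h. h \<in> borel_measurable M \<Longrightarrow> (\<And>x. 0 \<le> h x) \<Longrightarrow>
      (\<integral>\<^sup>+x. ennreal (h x powr p) \<partial>M) < top \<Longrightarrow>
      (\<integral>\<^sup>+x. ennreal (g x * h x) \<partial>M) \<le> ennreal C * enn_powr (\<integral>\<^sup>+x. ennreal (h x powr p) \<partial>M) (1 / p)"
  defines "p' \<equiv> p / (p - 1)"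
  shows "enn_powr (\<integral>\<^sup>+x. ennreal (g x powr p') \<partial>M) (1 / p') \<le> ennreal C"
proof -
  note [measurable] = g(1)
  interpret finite_measure M by fact
  have p': "p' > 1" and pp: "1 - 1 / p = 1 / p'" "(p' - 1) * p = p'" using p by (auto simp: p'_def field_simps)
  define G where "G k x = min (g x) (real k)" for k x
  have G0: "0 \<le> G k x" for k x using g by (simp add: G_def)
  have [measurable]: "G k \<in> borel_measurable M" for k unfolding G_def by measurable
  have le: "(\<integral>\<^sup>+x. ennreal (G k x powr p') \<partial>M) \<le> ennreal (C powr p')" for k
  proof -
    define I where "I = (\<integral>\<^sup>+x. ennreal (G k x powr p') \<partial>M)"
    have "I \<le> (\<integral>\<^sup>+x. ennreal (real k powr p') \<partial>M)" unfolding I_def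
      using G0 p' by (intro nn_integral_mono ennreal_leI powr_mono2) (auto simp: G_def)
    also have "\<dots> < top" by (simp add: ennreal_mult_less_top emeasure_eq_measure)
    finally have fin: "I < top" .
    define h where "h x = G k x powr (p' - 1)" for x
    have hp: "(\<integral>\<^sup>+x. ennreal (h x powr p) \<partial>M) = I"
      unfolding h_def I_def by (simp add: powr_powr pp)
    have "I \<le> (\<integral>\<^sup>+x. ennreal (g x * h x) \<partial>M)" unfolding I_def
    proof (intro nn_integral_mono ennreal_leI)
      fix x
      have "G k x powr p' = G k x * G k x powr (p' - 1)"
        using G0[of k x] by (subst powr_mult_base) auto
      also have "\<dots> \<le> g x * h x" unfolding h_def by (intro mult_right_mono) (auto simp: G_def)
      finally show "G k x powr p' \<le> g x * h x" .
    qed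
    also have "\<dots> \<le> ennreal C * enn_powr I (1 / p)"
    proof -
      have "h \<in> borel_measurable M" unfolding h_def by measurable
      from bound[OF this] show ?thesis using fin unfolding hp by (simp add: h_def)
    qed
    finally have *: "I \<le> ennreal C * enn_powr I (1 / p)" .
    obtain i where i: "I = ennreal i" "0 \<le> i" using fin by (cases I) auto
    show ?thesis
    proof (cases "i = 0")
      case False
      have "i \<le> C * i powr (1 / p)" using * C i
        by (simp add: enn_powr_ennreal ennreal_mult[symmetric])
      hence "i * i powr (- (1 / p)) \<le> C * i powr (1 / p) * i powr (- (1 / p))" by (intro mult_right_mono) auto
      also have "\<dots> = C" using False i by (simp add: mult.assoc flip: powr_add)
      also have "i * i powr (- (1 / p)) = i powr (1 / p')"
        using i(2) by (simp add: powr_mult_base pp)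
      finally have "(i powr (1 / p')) powr p' \<le> C powr p'" using p' by (intro powr_mono2) auto
      hence "i \<le> C powr p'" using p' i by (simp add: powr_powr)
      thus ?thesis using i unfolding I_def[symmetric] by (simp add: ennreal_leI)
    qed (use i in \<open>simp add: I_def[symmetric]\<close>)
  qed
  have "(\<integral>\<^sup>+x. ennreal (g x powr p') \<partial>M) = (\<integral>\<^sup>+x. (SUP k. ennreal (G k x powr p')) \<partial>M)"
  proof (intro nn_integral_cong antisym)
    fix x
    obtain k where "g x \<le> real k" using real_arch_simple by blast
    hence "G k x = g x" by (simp add: G_def)
    thus "ennreal (g x powr p') \<le> (SUP k. ennreal (G k x powr p'))" by (metis SUP_upper UNIV_I)
    show "(SUP k. ennreal (G k x powr p')) \<le> ennreal (g x powr p')"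
      using G0 p' by (intro SUP_least ennreal_leI powr_mono2) (auto simp: G_def)
  qed
  also have "\<dots> = (SUP k. \<integral>\<^sup>+x. ennreal (G k x powr p') \<partial>M)"
    using G0 p' by (intro nn_integral_monotone_convergence_SUP)
      (auto simp: incseq_def le_fun_def intro!: ennreal_leI powr_mono2, auto simp: G_def)
  also have "\<dots> \<le> ennreal (C powr p')" by (intro SUP_least le)
  finally show ?thesis using p' C by (simp add: enn_powr_le_iff enn_powr_ennreal)
qed

text \<open>The endpoint of the previous duality: test with the indicators of the sets where \<open>g\<close> exceeds
\<open>C\<close> by a fixed amount.\<close>
lemma L1_dual_bound:
  fixes g :: "'a \<Rightarrow> real"
  assumes M: "finite_measure M" and C: "0 \<le> C"
    and g: "g \<in> borel_measurable M" "\<And>x. 0 \<le> g x"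
    and bound: "\<And>h. h \<in> borel_measurable M \<Longrightarrow> (\<And>x. 0 \<le> h x) \<Longrightarrow>
      (\<integral>\<^sup>+x. ennreal (h x) \<partial>M) < top \<Longrightarrow>
      (\<integral>\<^sup>+x. ennreal (g x * h x) \<partial>M) \<le> ennreal C * (\<integral>\<^sup>+x. ennreal (h x) \<partial>M)"
  shows "AE x in M. g x \<le> C"
proof -
  note [measurable] = g(1)
  interpret finite_measure M by fact
  have "AE x in M. g x \<le> C + 1 / real (Suc k)" for k
  proof -
    define E where "E = {x \<in> space M. g x > C + 1 / real (Suc k)}"
    have [measurable]: "E \<in> sets M" unfolding E_def by measurable
    define m where "m = measure M E"
    have m: "emeasure M E = ennreal m" by (simp add: m_def emeasure_eq_measure)
    have m0: "0 \<le> m" by (simp add: m_def)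
    have "ennreal ((C + 1 / real (Suc k)) * m) = (\<integral>\<^sup>+x. ennreal (C + 1 / real (Suc k)) * indicator E x \<partial>M)"
      using C m0 by (simp add: nn_integral_cmult_indicator m ennreal_mult del: of_nat_Suc)
    also have "\<dots> \<le> (\<integral>\<^sup>+x. ennreal (g x * indicator E x) \<partial>M)"
      by (intro nn_integral_mono) (auto simp: indicator_def E_def intro!: ennreal_leI)
    also have "\<dots> \<le> ennreal C * (\<integral>\<^sup>+x. ennreal (indicator E x) \<partial>M)"
      by (intro bound) (auto simp: ennreal_indicator m)
    also have "\<dots> = ennreal (C * m)" using C m0 by (simp add: ennreal_indicator m ennreal_mult)
    finally have "(C + 1 / real (Suc k)) * m \<le> C * m" using C m0 by simp
    hence "1 / real (Suc k) * m \<le> 0" by (simp add: distrib_right)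
    hence "m = 0" using m0 by (simp add: divide_le_0_iff)
    hence "E \<in> null_sets M" using m by (auto simp: null_sets_def)
    thus ?thesis by (rule AE_I') (auto simp: E_def)
  qed
  hence "AE x in M. \<forall>k. g x \<le> C + 1 / real (Suc k)" by (simp add: AE_all_countable)
  thus ?thesis
  proof eventually_elim
    case (elim x)
    show ?case
    proof (rule field_le_epsilon)
      fix e :: real assume "e > 0"
      then obtain k where "1 / real (Suc k) < e" using nat_approx_posE by blast
      thus "g x \<le> C + e" using elim by (meson add_left_mono less_imp_le order_trans)
    qed
  qed
qed

lemma convex_powr_nonneg:
  assumes p: "1 \<le> p" and x: "0 \<le> x" and y: "0 \<le> y" and t: "0 \<le> t" "t \<le> 1"
  shows "((1 - t) * x + t * y) powr p \<le> (1 - t) * x powr p + t * y powr (p::real)"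
proof -
  have aux: "(s * x) powr p \<le> s * x powr p" if "0 \<le> s" "s \<le> 1" "0 \<le> x" for s x :: real
  proof -
    have "s powr p \<le> s powr 1" using that p using powr_mono'[of 1 p s] by simp
    thus ?thesis using that by (simp add: powr_mult mult_right_mono)
  qed
  consider "x = 0" | "y = 0" | "x > 0" "y > 0" using x y by linarith
  thus ?thesis
  proof cases
    case 3
    from convex_onD[OF powr_convex[OF p] t, of x y] 3 show ?thesis by simp
  qed (use aux[of t y] aux[of "1 - t" x] x y t p in auto)
qed

text \<open>Stated for a function dominated by a sum, with upper bounds \<open>a\<close> and \<open>b\<close> in place of the
norms, so that no finiteness has to be discussed. The reason is that the unit ball of the norm is
convex: \<open>(f + g) / (a + b)\<close> is the convex combination of \<open>f / a\<close> and \<open>g / b\<close> with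
weight \<open>t = b / (a + b)\<close>.\<close>
lemma Minkowski_inequality:
  fixes f g h :: "'a \<Rightarrow> real"
  assumes p: "1 \<le> p" and f[measurable]: "f \<in> borel_measurable M" and f0: "\<And>x. 0 \<le> f x"
    and g[measurable]: "g \<in> borel_measurable M" and g0: "\<And>x. 0 \<le> g x"
    and h0: "\<And>x. 0 \<le> h x" and hle: "\<And>x. h x \<le> f x + g x"
    and a: "0 < a" "(\<integral>\<^sup>+x. ennreal (f x powr p) \<partial>M) \<le> ennreal (a powr p)"
    and b: "0 < b" "(\<integral>\<^sup>+x. ennreal (g x powr p) \<partial>M) \<le> ennreal (b powr p)"
  shows "(\<integral>\<^sup>+x. ennreal (h x powr p) \<partial>M) \<le> ennreal ((a + b) powr p)"
proof -
  define t where "t = b / (a + b)"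
  have t: "0 \<le> t" "t \<le> 1" "1 - t = a / (a + b)" using a b by (auto simp: t_def field_simps)
  define cf where "cf = (a + b) powr p * (1 - t) / a powr p"
  define cg where "cg = (a + b) powr p * t / b powr p"
  have c0: "0 \<le> cf" "0 \<le> cg" using t a b unfolding cf_def cg_def by (intro divide_nonneg_nonneg mult_nonneg_nonneg, auto)+
  have "h x powr p \<le> cf * f x powr p + cg * g x powr p" for x
  proof -
    have "h x \<le> (a + b) * ((1 - t) * (f x / a) + t * (g x / b))"
    proof -
      have ab: "a + b \<noteq> 0" using a b by simp
      have "(a + b) * (a / (a + b) * (f x / a)) = f x" "(a + b) * (b / (a + b) * (g x / b)) = g x"
        using ab a b by simp_all
      thus ?thesis unfolding t(3) using hle[of x] by (simp add: t_def distrib_left)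
    qed
    hence "h x powr p \<le> ((a + b) * ((1 - t) * (f x / a) + t * (g x / b))) powr p"
      using p h0 by (intro powr_mono2) auto
    also have "\<dots> = (a + b) powr p * ((1 - t) * (f x / a) + t * (g x / b)) powr p"
      by (rule powr_mult)
    also have "\<dots> \<le> (a + b) powr p * ((1 - t) * (f x / a) powr p + t * (g x / b) powr p)"
      using t a b f0 g0 p by (intro mult_left_mono convex_powr_nonneg) auto
    also have "\<dots> = cf * f x powr p + cg * g x powr p"
      using a b f0 g0 by (simp add: powr_divide cf_def cg_def algebra_simps)
    finally show ?thesis .
  qed
  hence "(\<integral>\<^sup>+x. ennreal (h x powr p) \<partial>M)
      \<le> (\<integral>\<^sup>+x. ennreal cf * ennreal (f x powr p) + ennreal cg * ennreal (g x powr p) \<partial>M)"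
    using c0 by (intro nn_integral_mono)
      (simp add: ennreal_mult[symmetric] ennreal_plus[symmetric] ennreal_leI del: ennreal_plus)
  also have "\<dots> = ennreal cf * (\<integral>\<^sup>+x. ennreal (f x powr p) \<partial>M) + ennreal cg * (\<integral>\<^sup>+x. ennreal (g x powr p) \<partial>M)"
    by (subst nn_integral_add) (auto simp: nn_integral_cmult)
  also have "\<dots> \<le> ennreal cf * ennreal (a powr p) + ennreal cg * ennreal (b powr p)"
    by (intro add_mono mult_left_mono a b) auto
  also have "\<dots> = ennreal (cf * a powr p + cg * b powr p)"
    using c0 by (simp add: ennreal_mult)
  also have "cf * a powr p + cg * b powr p = (a + b) powr p"
  proof -
    have "cf * a powr p = (a + b) powr p * (1 - t)" "cg * b powr p = (a + b) powr p * t"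
      using a b by (simp_all add: cf_def cg_def)
    thus ?thesis by (simp add: right_diff_distrib)
  qed
  finally show ?thesis .
qed

section \<open>Auerbach coordinates and norms of matrix products\<close>

lemma norm_vector_smult: "norm (c *s v) = norm c * norm (v :: complex ^ 'n)"
  by (simp add: norm_vec_def norm_mult L2_set_right_distrib)

lemma matrix_vec_smult: "A *v (c *s v) = c *s (A *v (v :: complex ^ 'n))"
  by (simp add: vec_eq_iff matrix_vector_mult_def sum_distrib_left mult_ac)

text \<open>Every norm on the \<open>n\<close>-dimensional space lies between the maximum and the sum of the moduli of
suitable linear coordinates, with no loss of constants. Among the matrices \<open>A\<close> with columns in
the unit ball choose one with maximal determinant in modulus and take \<open>B\<close> to be its inverse.
By Cramer's rule the \<open>j\<close>-th coordinate of \<open>v\<close> is the factor by which the determinant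
changes when column \<open>j\<close> is replaced by \<open>v\<close>; by maximality this factor is at most
\<open>1\<close> for \<open>v\<close> in the unit ball.\<close>
lemma Auerbach_coordinates:
  fixes \<rho> :: "complex ^ 'n \<Rightarrow> real"
  assumes triangle: "\<And>u v. \<rho> (u + v) \<le> \<rho> u + \<rho> v"
    and homog: "\<And>c v. \<rho> (c *s v) = norm c * \<rho> v"
    and pos: "\<And>v. v \<noteq> 0 \<Longrightarrow> 0 < \<rho> v"
  shows "\<exists>B :: complex ^ 'n ^ 'n. \<forall>v. (\<forall>j. norm ((B *v v) $ j) \<le> \<rho> v) \<and>
      \<rho> v \<le> (\<Sum>j\<in>UNIV. norm ((B *v v) $ j))"
proof -
  have zero: "\<rho> 0 = 0" using homog[of 0 0] by simp
  have nonneg: "0 \<le> \<rho> v" for v using pos[of v] zero by (cases "v = 0") auto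
  have sum: "\<rho> (\<Sum>i\<in>S. f i) \<le> (\<Sum>i\<in>S. \<rho> (f i))" if "finite S" for S and f :: "'n \<Rightarrow> complex ^ 'n"
    using that
  proof (induction S rule: finite_induct)
    case (insert i S)
    thus ?case using triangle[of "f i" "sum f S"] by simp
  qed (simp add: zero)
  define K where "K = (\<Sum>i\<in>(UNIV::'n set). \<rho> (axis i 1))"
  have K0: "0 \<le> K" unfolding K_def by (intro sum_nonneg nonneg)
  have bound: "\<rho> v \<le> K * norm v" for v
  proof -
    have "v = (\<Sum>i\<in>UNIV. v $ i *s axis i 1)" by (simp add: basis_expansion)
    hence "\<rho> v \<le> (\<Sum>i\<in>UNIV. \<rho> (v $ i *s axis i 1))" using sum[of UNIV "\<lambda>i. v $ i *s axis i 1"] by simp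
    also have "\<dots> \<le> (\<Sum>i\<in>UNIV. norm v * \<rho> (axis i 1))" unfolding homog
      by (intro sum_mono mult_right_mono nonneg Finite_Cartesian_Product.norm_nth_le)
    finally show ?thesis by (simp add: K_def sum_distrib_left mult.commute)
  qed
  have lip: "\<bar>\<rho> u - \<rho> v\<bar> \<le> K * norm (u - v)" for u v
    using triangle[of "u - v" v] triangle[of "v - u" u] bound[of "u - v"] bound[of "v - u"]
    by (simp add: norm_minus_commute abs_le_iff)
  have cont: "continuous_on S \<rho>" for S
    unfolding continuous_on_def
  proof (intro ballI)
    fix x
    have "((\<lambda>v. \<rho> v - \<rho> x) \<longlongrightarrow> 0) (at x within S)"
    proof (rule Lim_transform_bound)
      show "\<forall>\<^sub>F v in at x within S. norm (\<rho> v - \<rho> x) \<le> norm (K * norm (v - x))"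
        using lip K0 by (intro always_eventually) (auto simp: abs_mult)
      have "((\<lambda>v. K * norm (v - x)) \<longlongrightarrow> K * norm (x - x)) (at x within S)" by (intro tendsto_intros)
      thus "((\<lambda>v. K * norm (v - x)) \<longlongrightarrow> 0) (at x within S)" by simp
    qed
    thus "(\<rho> \<longlongrightarrow> \<rho> x) (at x within S)" by (simp add: LIM_zero_iff)
  qed
  have "\<exists>x\<in>sphere (0::complex^'n) 1. \<forall>y\<in>sphere 0 1. \<rho> x \<le> \<rho> y"
    by (intro continuous_attains_inf cont compact_sphere) simp
  then obtain x where x: "norm x = 1" "\<And>y. norm y = 1 \<Longrightarrow> \<rho> x \<le> \<rho> y" by auto
  define m where "m = \<rho> x"
  have m: "m > 0" using x(1) by (auto simp: m_def intro!: pos)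
  have lower: "m * norm v \<le> \<rho> v" for v
  proof (cases "v = 0")
    case False
    define u where "u = complex_of_real (1 / norm v) *s v"
    have "norm u = 1" using False by (simp add: u_def norm_vector_smult norm_divide)
    hence "m \<le> \<rho> u" unfolding m_def by (rule x(2))
    also have "\<rho> u = \<rho> v / norm v" unfolding u_def homog by (simp add: norm_divide)
    finally show ?thesis using False by (simp add: pos_le_divide_eq)
  qed (simp add: zero)
  define S where "S = {A :: complex ^ 'n ^ 'n. \<forall>j. \<rho> (column j A) \<le> 1}"
  have col_cont: "continuous_on UNIV (\<lambda>A :: complex ^ 'n ^ 'n. \<rho> (column j A))" for j
    unfolding column_def
    by (intro continuous_on_compose2[OF cont[of UNIV]] continuous_intros) auto
  have "closed S"
  proof -
    have "S = (\<Inter>j. {A. \<rho> (column j A) \<le> 1})" by (auto simp: S_def)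
    thus ?thesis by (auto intro!: closed_INT closed_Collect_le col_cont continuous_on_const)
  qed
  moreover have "bounded S"
  proof (rule boundedI)
    fix A assume A: "A \<in> S"
    have "norm (A $ i $ j) \<le> 1 / m" for i j
    proof -
      have "norm (A $ i $ j) \<le> norm (column j A)"
        using Finite_Cartesian_Product.norm_nth_le[of "column j A" i] by (simp add: column_def)
      also have "norm (column j A) \<le> 1 / m"
      proof -
        have "\<rho> (column j A) \<le> 1" using A by (simp add: S_def)
        hence "m * norm (column j A) \<le> 1" using lower[of "column j A"] by linarith
        thus ?thesis using m by (simp add: pos_le_divide_eq mult.commute)
      qed
      finally show ?thesis .
    qed
    hence "entry_sum A \<le> (\<Sum>i\<in>(UNIV::'n set). \<Sum>j\<in>(UNIV::'n set). 1 / m)"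
      unfolding entry_sum_def by (intro sum_mono)
    moreover have "norm A \<le> entry_sum A"
      unfolding entry_sum_def by (rule order_trans[OF norm_vec_le_sum]) (intro sum_mono norm_vec_le_sum)
    ultimately show "norm A \<le> (\<Sum>i\<in>(UNIV::'n set). \<Sum>j\<in>(UNIV::'n set). 1 / m)" by simp
  qed
  ultimately have "compact S" by (simp add: compact_eq_bounded_closed)
  \<comment> \<open>A nonsingular competitor, so the maximal determinant does not vanish; \<open>K + 1\<close> avoids division by zero.\<close>
  moreover have diag: "mat (complex_of_real (1 / (K + 1))) \<in> S"
  proof -
    have axis: "\<rho> (axis j 1) \<le> K" for j unfolding K_def by (intro member_le_sum nonneg) auto
    have col: "column j (mat (complex_of_real (1 / (K + 1)))) = complex_of_real (1 / (K + 1)) *s axis j 1" for j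
      by (simp add: vec_eq_iff column_def mat_def axis_def)
    have "\<rho> (column j (mat (complex_of_real (1 / (K + 1))))) = 1 / (K + 1) * \<rho> (axis j 1)" for j
      unfolding col homog norm_of_real using K0 by simp
    moreover have "1 / (K + 1) * \<rho> (axis j 1) \<le> 1" for j using axis[of j] K0 by (simp add: divide_le_eq)
    ultimately show ?thesis by (simp add: S_def)
  qed
  moreover have "continuous_on S (\<lambda>A. norm (det A))"
    unfolding det_def by (intro continuous_intros)
  ultimately obtain A where A: "A \<in> S" and max: "\<And>A'. A' \<in> S \<Longrightarrow> norm (det A') \<le> norm (det A)"
    using continuous_attains_sup[of S "\<lambda>A. norm (det A)"] by blast
  have "det (mat (complex_of_real (1 / (K + 1))) :: complex ^ 'n ^ 'n) \<noteq> 0"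
  proof -
    have "complex_of_real (1 / (K + 1)) \<noteq> 0" using K0 unfolding of_real_eq_0_iff by simp
    thus ?thesis by (subst det_diagonal) (auto simp: mat_def simp del: of_real_divide of_real_add)
  qed
  hence detA: "det A \<noteq> 0" using max[OF diag] by fastforce
  then obtain B where B: "A ** B = mat 1"
    using invertible_det_nz invertible_right_inverse by blast
  have coord: "v = A *v (B *v v)" for v by (simp add: matrix_vector_mul_assoc B)
  have le1: "norm ((B *v v) $ j) \<le> 1" if v: "\<rho> v \<le> 1" for v j
  proof -
    \<comment> \<open>Written with \<open>A *v (B *v v)\<close>, which equals \<open>v\<close>, to match the form of Cramer's rule.\<close>
    define A' :: "complex^'n^'n" where "A' = (\<chi> i k. if k = j then (A *v (B *v v)) $ i else A $ i $ k)"
    have "column k A' = (if k = j then v else column k A)" for k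
      by (auto simp: A'_def column_def vec_eq_iff coord[symmetric])
    hence "A' \<in> S" using A v by (auto simp: S_def)
    hence "norm (det A') \<le> norm (det A)" by (rule max)
    moreover have "det A' = (B *v v) $ j * det A" unfolding A'_def by (rule cramer_lemma)
    ultimately show ?thesis using detA by (simp add: norm_mult)
  qed
  have "norm ((B *v v) $ j) \<le> \<rho> v" for v j
  proof (cases "v = 0")
    case False
    define u where "u = complex_of_real (1 / \<rho> v) *s v"
    have "\<rho> u \<le> 1" using pos[OF False] by (simp add: u_def homog norm_divide)
    from le1[OF this, of j] show ?thesis using pos[OF False]
      by (simp add: u_def matrix_vec_smult norm_mult norm_divide)
  qed (simp add: zero)
  moreover have "\<rho> v \<le> (\<Sum>j\<in>UNIV. norm ((B *v v) $ j))" for v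
  proof -
    have "v = (\<Sum>j\<in>UNIV. (B *v v) $ j *s column j A)"
      by (subst coord) (simp only: matrix_mult_sum)
    hence "\<rho> v \<le> (\<Sum>j\<in>UNIV. \<rho> ((B *v v) $ j *s column j A))" by (metis finite sum)
    also have "\<dots> \<le> (\<Sum>j\<in>UNIV. norm ((B *v v) $ j))" unfolding homog
      using A by (intro sum_mono mult_left_le) (auto simp: S_def)
    finally show ?thesis .
  qed
  ultimately show ?thesis by blast
qed

lemma op_norm_le_sum_columns: "op_norm A \<le> (\<Sum>i\<in>UNIV. norm (A *v axis i 1))" for A :: "complex ^ 'n ^ 'n"
proof (rule onorm_le)
  fix x :: "complex ^ 'n"
  have "A *v x = (\<Sum>i\<in>UNIV. x $ i *s (A *v axis i 1))"
  proof -
    have "A *v axis i 1 = column i A" for i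
      by (simp add: vec_eq_iff matrix_vector_mult_def column_def axis_def if_distrib cong: if_cong)
    thus ?thesis by (simp only: matrix_mult_sum)
  qed
  hence "norm (A *v x) \<le> (\<Sum>i\<in>UNIV. norm (x $ i *s (A *v axis i 1)))" using norm_sum by metis
  also have "\<dots> \<le> (\<Sum>i\<in>UNIV. norm x * norm (A *v axis i 1))" unfolding norm_vector_smult
    by (intro sum_mono mult_right_mono Finite_Cartesian_Product.norm_nth_le) auto
  finally show "norm (A *v x) \<le> (\<Sum>i\<in>UNIV. norm (A *v axis i 1)) * norm x"
    by (simp add: sum_distrib_left mult.commute)
qed

lemma norm_column_le_op_norm: "norm (A *v axis i 1) \<le> op_norm A" for A :: "complex ^ 'n ^ 'n"
  using norm_matrix_vec_le[of A "axis i 1"] by simp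

text \<open>The two products are adjoint to each other.\<close>
lemma op_norm_mult_commute:
  fixes A B :: "complex ^ 'n ^ 'n"
  assumes "self_adjoint A" "self_adjoint B"
  shows "op_norm (A ** B) = op_norm (B ** A)"
proof -
  have le: "op_norm (X ** Y) \<le> op_norm (Y ** X)" if X: "self_adjoint X" and Y: "self_adjoint Y"
    for X Y :: "complex ^ 'n ^ 'n"
  proof (rule onorm_le)
    fix v :: "complex ^ 'n"
    define w where "w = (X ** Y) *v v"
    have "norm w * norm w = (X *v (Y *v v)) \<bullet> w"
      by (simp add: w_def matrix_vector_mul_assoc power2_eq_square flip: power2_norm_eq_inner)
    also have "\<dots> = v \<bullet> ((Y ** X) *v w)"
      by (simp add: self_adjoint_inner[OF X] self_adjoint_inner[OF Y] flip: matrix_vector_mul_assoc)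
    also have "\<dots> \<le> norm v * (op_norm (Y ** X) * norm w)"
      by (rule order_trans[OF norm_cauchy_schwarz]) (intro mult_left_mono norm_matrix_vec_le, simp)
    finally have "norm w * norm w \<le> (op_norm (Y ** X) * norm v) * norm w" by (simp add: mult_ac)
    thus "norm ((X ** Y) *v v) \<le> op_norm (Y ** X) * norm v" unfolding w_def[symmetric]
      by (cases "w = 0") (auto simp: op_norm_nonneg mult_nonneg_nonneg dest!: mult_right_le_imp_le)
  qed
  show ?thesis using le[OF assms] le[OF assms(2,1)] by simp
qed

lemma pos_def_mult_nonzero: "pos_def A \<Longrightarrow> v \<noteq> 0 \<Longrightarrow> A *v v \<noteq> 0"
  by (metis inner_zero_left less_irrefl pos_def_def)

lemma pos_def_surj:
  assumes "pos_def (A :: complex ^ 'n ^ 'n)" obtains u where "v = A *v u"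
proof -
  have "\<exists>B. B ** A = mat 1" unfolding matrix_left_invertible_ker using pos_def_mult_nonzero[OF assms] by blast
  then obtain B where "A ** B = mat 1" using matrix_left_right_inverse by blast
  hence "v = A *v (B *v v)" by (simp add: matrix_vector_mul_assoc)
  thus thesis by (rule that)
qed

section \<open>Averages over cubes and reducing operators\<close>

lemma cube_volume:
  fixes a :: "real ^ 'd"
  assumes "0 < l"
  shows "vol (box a (\<chi> i. a $ i + l)) = l ^ CARD('d)"
proof -
  have "(\<chi> i. a $ i + l) \<bullet> b - a \<bullet> b = l" if "b \<in> Basis" for b :: "real ^ 'd"
    using that by (auto simp: Basis_vec_def inner_axis)
  moreover from this have "a \<bullet> b \<le> (\<chi> i. a $ i + l) \<bullet> b" if "b \<in> Basis" for b
    using that assms by (smt (verit))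
  ultimately show ?thesis
    by (simp add: measure_lborel_box inner_diff_left)
qed

lemma cubeD:
  assumes "Q \<in> cubes"
  shows cube_open: "open Q" and cube_sets: "Q \<in> sets lebesgue" and cube_vol_pos: "0 < vol Q"
    and cube_emeasure: "emeasure lebesgue Q = ennreal (vol Q)" and cube_lmeasurable: "Q \<in> lmeasurable"
proof -
  obtain a :: "real ^ 'a" and l where al: "Q = box a (\<chi> i. a $ i + l)" "0 < l" using assms by (auto simp: cubes_def)
  show "open Q" "Q \<in> lmeasurable" by (simp_all add: al open_box)
  thus "Q \<in> sets lebesgue" "emeasure lebesgue Q = ennreal (vol Q)"
    by (auto simp: emeasure_eq_measure2)
  show "0 < vol Q" using cube_volume[OF al(2), of a] al by simp
qed

lemma nn_avg_restrict:
  assumes "Q \<in> cubes"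
  shows "nn_avg Q g = ennreal (1 / vol Q) * (\<integral>\<^sup>+x. g x \<partial>lebesgue_on Q)"
  using cubeD[OF assms] unfolding nn_avg_def
  by (simp add: nn_integral_restrict_space divide_ennreal_def inverse_ennreal inverse_eq_divide mult.commute)

lemma integral_eq_nn_avg:
  assumes "Q \<in> cubes"
  shows "(\<integral>\<^sup>+x. g x \<partial>lebesgue_on Q) = ennreal (vol Q) * nn_avg Q g"
  using cubeD[OF assms] by (simp add: nn_avg_restrict[OF assms] ennreal_mult[symmetric] flip: mult.assoc)

lemma nn_avg_mono_AE:
  assumes "Q \<in> cubes" "AE x in lebesgue. x \<in> Q \<longrightarrow> g x \<le> h x"
  shows "nn_avg Q g \<le> nn_avg Q h"
  unfolding nn_avg_restrict[OF assms(1)]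
  using assms cubeD[OF assms(1)] by (intro mult_left_mono nn_integral_mono_AE) (auto simp: AE_restrict_space_iff)

lemma nn_avg_cmult:
  assumes "Q \<in> cubes" "g \<in> borel_measurable lebesgue"
  shows "nn_avg Q (\<lambda>x. c * g x) = c * nn_avg Q g"
  unfolding nn_avg_restrict[OF assms(1)]
  using assms(2) by (subst nn_integral_cmult) (auto intro: measurable_restrict_space1 simp: mult.left_commute)

lemma nn_avg_sum:
  assumes "Q \<in> cubes" "\<And>i. i \<in> I \<Longrightarrow> g i \<in> borel_measurable lebesgue"
  shows "nn_avg Q (\<lambda>x. \<Sum>i\<in>I. g i x) = (\<Sum>i\<in>I. nn_avg Q (g i))"
  unfolding nn_avg_restrict[OF assms(1)]
  using assms(2) by (subst nn_integral_sum) (auto intro: measurable_restrict_space1 simp: sum_distrib_left)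

lemma nn_avg_const:
  assumes "Q \<in> cubes" shows "nn_avg Q (\<lambda>x. c) = c"
  using cubeD[OF assms]
  by (simp add: nn_avg_restrict[OF assms] emeasure_restrict_space space_restrict_space
      ennreal_mult[symmetric] mult.left_commute[of _ c])

text \<open>Cubes have positive measure, so no property can both hold and fail almost everywhere on one. Used
to draw points from sets of full measure.\<close>
lemma cube_AE_false:
  assumes "Q \<in> cubes" "AE x in lebesgue. x \<in> Q \<longrightarrow> P x" "AE x in lebesgue. x \<in> Q \<longrightarrow> \<not> P x"
  shows False
proof -
  have "AE x in lebesgue. x \<notin> Q" using assms(2,3) by eventually_elim auto
  hence "emeasure lebesgue Q = 0"
    using cubeD[OF assms(1)] by (subst (asm) AE_iff_measurable[of Q]) auto
  thus False using cubeD[OF assms(1)] by simp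
qed

lemma borel_measurable_matrix_mult:
  fixes f g :: "'a \<Rightarrow> complex ^ 'n ^ 'n"
  assumes "f \<in> borel_measurable M" "g \<in> borel_measurable M"
  shows "(\<lambda>x. f x ** g x) \<in> borel_measurable M"
  using assms unfolding borel_measurable_vec_iff matrix_matrix_mult_def
  by (auto intro!: borel_measurable_sum borel_measurable_times)

lemma borel_measurable_matrix_vec:
  fixes f :: "'a \<Rightarrow> complex ^ 'n ^ 'n" and g :: "'a \<Rightarrow> complex ^ 'n"
  assumes "f \<in> borel_measurable M" "g \<in> borel_measurable M"
  shows "(\<lambda>x. f x *v g x) \<in> borel_measurable M"
  using assms unfolding borel_measurable_vec_iff matrix_vector_mult_def
  by (auto intro!: borel_measurable_sum borel_measurable_times)

lemma op_norm_powr_le_sum: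
  fixes A :: "complex ^ 'n ^ 'n"
  assumes "0 < r"
  shows "ennreal (op_norm A powr r) \<le> ennreal (real CARD('n) powr r) * (\<Sum>i\<in>UNIV. ennreal (norm (A *v axis i 1) powr r))"
proof -
  have "op_norm A powr r \<le> (\<Sum>i\<in>UNIV. norm (A *v axis i 1)) powr r"
    using assms by (intro powr_mono2 op_norm_le_sum_columns op_norm_nonneg) auto
  also have "\<dots> \<le> real CARD('n) powr r * (\<Sum>i\<in>UNIV. norm (A *v axis i 1) powr r)"
    using assms by (intro sum_powr_le) auto
  finally show ?thesis by (simp add: ennreal_mult[symmetric] sum_nonneg ennreal_leI)
qed

lemma column_powr_le_op_norm:
  fixes A :: "complex ^ 'n ^ 'n"
  assumes "0 < r"
  shows "ennreal (norm (A *v axis i 1) powr r) \<le> ennreal (op_norm A powr r)"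
  using assms by (intro ennreal_leI powr_mono2 norm_column_le_op_norm) auto

text \<open>For Hermitian \<open>X\<close> the entries of row \<open>j\<close> of \<open>B ** X\<close> are the conjugates of the
components of \<open>X\<close> applied to the conjugated \<open>j\<close>-th row of \<open>B\<close>. So the entry sum of \<open>B ** X\<close> is
comparable to a sum of norms of \<open>X\<close> at fixed vectors, which is the kind of quantity that reducing
operators control.\<close>
lemma entry_sum_columns:
  fixes B X :: "complex ^ 'n ^ 'n"
  assumes X: "self_adjoint X" and q: "0 < q"
  defines "b \<equiv> \<lambda>j. (\<chi> k. cnj (B $ j $ k)) :: complex ^ 'n"
  shows "norm (X *v b j) \<le> entry_sum (B ** X)"
    and "entry_sum (B ** X) powr q \<le> (real CARD('n) * real CARD('n)) powr q * (\<Sum>j\<in>UNIV. norm (X *v b j) powr q)"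
proof -
  have ct: "cnj (X $ k $ i) = X $ i $ k" for i k
    by (metis X ctranspose_nth self_adjoint_def)
  have eq: "norm ((B ** X) $ j $ i) = norm ((X *v b j) $ i)" for i j
  proof -
    have "cnj ((B ** X) $ j $ i) = (X *v b j) $ i"
      by (simp add: matrix_matrix_mult_def matrix_vector_mult_def b_def ct mult.commute)
    thus ?thesis by (metis complex_mod_cnj)
  qed
  have "norm (X *v b j) \<le> (\<Sum>i\<in>UNIV. norm ((B ** X) $ j $ i))"
    unfolding eq by (rule norm_vec_le_sum)
  also have "\<dots> \<le> entry_sum (B ** X)" unfolding entry_sum_def
    by (rule member_le_sum[where f = "\<lambda>j. \<Sum>i\<in>UNIV. norm ((B ** X) $ j $ i)"]) (auto intro: sum_nonneg)
  finally show "norm (X *v b j) \<le> entry_sum (B ** X)" .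
  have "entry_sum (B ** X) \<le> (\<Sum>j\<in>UNIV. \<Sum>i\<in>(UNIV::'n set). norm (X *v b j))"
    unfolding entry_sum_def eq by (intro sum_mono Finite_Cartesian_Product.norm_nth_le)
  hence "entry_sum (B ** X) \<le> real CARD('n) * (\<Sum>j\<in>UNIV. norm (X *v b j))"
    by (simp add: sum_distrib_left)
  moreover have "0 \<le> entry_sum (B ** X)" by (auto simp: entry_sum_def intro!: sum_nonneg)
  ultimately have "entry_sum (B ** X) powr q \<le> (real CARD('n) * (\<Sum>j\<in>UNIV. norm (X *v b j))) powr q"
    using q by (intro powr_mono2) auto
  also have "\<dots> = real CARD('n) powr q * (\<Sum>j\<in>UNIV. norm (X *v b j)) powr q" by (rule powr_mult)
  also have "\<dots> \<le> real CARD('n) powr q * (real CARD('n) powr q * (\<Sum>j\<in>UNIV. norm (X *v b j) powr q))"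
    using q by (intro mult_left_mono sum_powr_le) auto
  also have "\<dots> = (real CARD('n) * real CARD('n)) powr q * (\<Sum>j\<in>UNIV. norm (X *v b j) powr q)"
    by (simp add: powr_mult)
  finally show "entry_sum (B ** X) powr q \<le> (real CARD('n) * real CARD('n)) powr q * (\<Sum>j\<in>UNIV. norm (X *v b j) powr q)" .
qed

locale reduced_weights =
  fixes U V :: "real ^ 'd \<Rightarrow> complex ^ 'n ^ 'n"
    and R :: "(real ^ 'd) set \<Rightarrow> complex ^ 'n ^ 'n"
    and p q c1 c2 :: real
  assumes p: "1 \<le> p" and q: "1 \<le> q" and U: "matrix_weight U" and V: "matrix_weight V"
    and c1: "0 < c1" and c2: "0 < c2" and R: "reducing_operators c1 c2 q U R"
begin

definition U_root :: "real ^ 'd \<Rightarrow> complex ^ 'n ^ 'n" where "U_root x = mat_powr (U x) (1 / q)"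
definition V_inv_root :: "real ^ 'd \<Rightarrow> complex ^ 'n ^ 'n" where "V_inv_root y = mat_powr (V y) (- (1 / p))"

lemma q_pos: "0 < q" using q by simp

lemma borel_measurable_U_root [measurable]: "U_root \<in> borel_measurable lebesgue"
  unfolding U_root_def by (rule borel_measurable_mat_powr[OF U])

lemma borel_measurable_V_inv_root [measurable]: "V_inv_root \<in> borel_measurable lebesgue"
  unfolding V_inv_root_def by (rule borel_measurable_mat_powr[OF V])

lemma pos_def_U_root: "AE x in lebesgue. pos_def (U_root x)"
  using U unfolding matrix_weight_def U_root_def by (auto elim: eventually_mono intro: pos_def_mat_powr)

lemma pos_def_V_inv_root: "AE x in lebesgue. pos_def (V_inv_root x)"
  using V unfolding matrix_weight_def V_inv_root_def by (auto elim: eventually_mono intro: pos_def_mat_powr)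

lemma pos_def_R: "Q \<in> cubes \<Longrightarrow> pos_def (R Q)"
  using R by (auto simp: reducing_operators_def)

lemma self_adjoint_pos_def: "pos_def A \<Longrightarrow> self_adjoint A"
  by (simp add: pos_def_def)

lemma measurable_norm_U_root [measurable]: "(\<lambda>x. norm (U_root x *v e)) \<in> borel_measurable lebesgue"
  by (rule measurable_compose[OF borel_measurable_matrix_vec borel_measurable_norm]) auto

lemma measurable_norm_V_inv_root [measurable]: "(\<lambda>x. norm (V_inv_root x *v e)) \<in> borel_measurable lebesgue"
  by (rule measurable_compose[OF borel_measurable_matrix_vec borel_measurable_norm]) auto

lemma measurable_op_norm_V_inv_root [measurable]: "(\<lambda>x. op_norm (A ** V_inv_root x)) \<in> borel_measurable lebesgue"
  by (rule measurable_compose[OF _ borel_measurable_op_norm]) (auto intro: borel_measurable_matrix_mult)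

lemma measurable_entry_sum_U_root [measurable]: "(\<lambda>x. entry_sum (B ** U_root x)) \<in> borel_measurable lebesgue"
proof -
  have "(\<lambda>x. B ** U_root x) \<in> borel_measurable lebesgue" by (intro borel_measurable_matrix_mult) auto
  thus ?thesis unfolding entry_sum_def borel_measurable_vec_iff
    by (intro borel_measurable_sum measurable_compose[OF _ borel_measurable_norm]) auto
qed

lemma reducing_lower:
  assumes "Q \<in> cubes"
  shows "ennreal (c1 powr q) * ennreal (norm (R Q *v e) powr q) \<le> nn_avg Q (\<lambda>x. ennreal (norm (U_root x *v e) powr q))"
proof -
  have "ennreal (c1 * norm (R Q *v e)) \<le> enn_powr (nn_avg Q (\<lambda>x. ennreal (norm (U_root x *v e) powr q))) (1 / q)"
    using R assms by (simp add: reducing_operators_def Let_def U_root_def)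
  hence "enn_powr (ennreal (c1 * norm (R Q *v e))) q \<le> nn_avg Q (\<lambda>x. ennreal (norm (U_root x *v e) powr q))"
    using q_pos by (simp add: le_enn_powr_iff)
  thus ?thesis using c1 by (simp add: enn_powr_ennreal enn_powr_mult ennreal_mult)
qed

lemma reducing_upper:
  assumes "Q \<in> cubes"
  shows "nn_avg Q (\<lambda>x. ennreal (norm (U_root x *v e) powr q)) \<le> ennreal (c2 powr q) * ennreal (norm (R Q *v e) powr q)"
proof -
  have "enn_powr (nn_avg Q (\<lambda>x. ennreal (norm (U_root x *v e) powr q))) (1 / q) \<le> ennreal (c2 * norm (R Q *v e))"
    using R assms by (simp add: reducing_operators_def Let_def U_root_def)
  hence "nn_avg Q (\<lambda>x. ennreal (norm (U_root x *v e) powr q)) \<le> enn_powr (ennreal (c2 * norm (R Q *v e))) q"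
    using q_pos by (simp add: enn_powr_le_iff)
  thus ?thesis using c2 by (simp add: enn_powr_ennreal enn_powr_mult ennreal_mult)
qed

text \<open>By \<open>entry_sum_columns\<close> the reducing property for single vectors lifts to functionals
\<open>entry_sum (B ** X)\<close> of the Hermitian matrix \<open>X\<close>, with constants independent of
\<open>B\<close> and of the cube. The next lemma is the reverse bound.\<close>
lemma avg_entry_sum_le:
  assumes Q: "Q \<in> cubes"
  shows "nn_avg Q (\<lambda>x. ennreal (entry_sum (B ** U_root x) powr q))
     \<le> ennreal ((real CARD('n) * real CARD('n)) powr q * c2 powr q * real CARD('n)) * ennreal (entry_sum (B ** R Q) powr q)"
proof -
  let ?b = "\<lambda>j. (\<chi> k. cnj (B $ j $ k)) :: complex ^ 'n"
  let ?N = "(real CARD('n) * real CARD('n)) powr q"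
  have "nn_avg Q (\<lambda>x. ennreal (entry_sum (B ** U_root x) powr q))
      \<le> nn_avg Q (\<lambda>x. ennreal ?N * (\<Sum>j\<in>UNIV. ennreal (norm (U_root x *v ?b j) powr q)))"
  proof (rule nn_avg_mono_AE[OF Q])
    show "AE x in lebesgue. x \<in> Q \<longrightarrow> ennreal (entry_sum (B ** U_root x) powr q)
        \<le> ennreal ?N * (\<Sum>j\<in>UNIV. ennreal (norm (U_root x *v ?b j) powr q))"
      using pos_def_U_root
    proof eventually_elim
      case (elim x)
      from entry_sum_columns(2)[OF self_adjoint_pos_def[OF elim] q_pos, of B]
      show ?case by (simp add: ennreal_mult[symmetric] sum_nonneg ennreal_leI)
    qed
  qed
  also have "\<dots> = ennreal ?N * (\<Sum>j\<in>UNIV. nn_avg Q (\<lambda>x. ennreal (norm (U_root x *v ?b j) powr q)))"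
    by (subst nn_avg_cmult[OF Q]) (auto simp del: sum_ennreal simp: nn_avg_sum[OF Q])
  also have "\<dots> \<le> ennreal ?N * (\<Sum>j\<in>(UNIV::'n set). ennreal (c2 powr q) * ennreal (entry_sum (B ** R Q) powr q))"
  proof (intro mult_left_mono sum_mono)
    fix j
    have "norm (R Q *v ?b j) powr q \<le> entry_sum (B ** R Q) powr q"
      using entry_sum_columns(1)[OF self_adjoint_pos_def[OF pos_def_R[OF Q]] q_pos] q_pos by (intro powr_mono2) auto
    hence "ennreal (c2 powr q) * ennreal (norm (R Q *v ?b j) powr q) \<le> ennreal (c2 powr q) * ennreal (entry_sum (B ** R Q) powr q)"
      by (intro mult_left_mono ennreal_leI) auto
    thus "nn_avg Q (\<lambda>x. ennreal (norm (U_root x *v ?b j) powr q)) \<le> ennreal (c2 powr q) * ennreal (entry_sum (B ** R Q) powr q)"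
      using reducing_upper[OF Q] order_trans by blast
  qed auto
  also have "\<dots> = ennreal (?N * c2 powr q * real CARD('n)) * ennreal (entry_sum (B ** R Q) powr q)"
    by (simp add: ennreal_mult ennreal_of_nat_eq_real_of_nat mult_ac)
  finally show ?thesis .
qed

lemma entry_sum_le_avg:
  assumes Q: "Q \<in> cubes"
  shows "ennreal (entry_sum (B ** R Q) powr q)
     \<le> ennreal ((real CARD('n) * real CARD('n)) powr q / c1 powr q * real CARD('n)) * nn_avg Q (\<lambda>x. ennreal (entry_sum (B ** U_root x) powr q))"
proof -
  let ?b = "\<lambda>j. (\<chi> k. cnj (B $ j $ k)) :: complex ^ 'n"
  let ?N = "(real CARD('n) * real CARD('n)) powr q"
  let ?A = "nn_avg Q (\<lambda>x. ennreal (entry_sum (B ** U_root x) powr q))"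
  have "ennreal (entry_sum (B ** R Q) powr q) \<le> ennreal ?N * (\<Sum>j\<in>UNIV. ennreal (norm (R Q *v ?b j) powr q))"
    using entry_sum_columns(2)[OF self_adjoint_pos_def[OF pos_def_R[OF Q]] q_pos, of B]
    by (simp add: ennreal_mult[symmetric] sum_nonneg ennreal_leI)
  also have "\<dots> \<le> ennreal ?N * (\<Sum>j\<in>(UNIV::'n set). ennreal (1 / c1 powr q) * ?A)"
  proof (intro mult_left_mono sum_mono)
    fix j
    have "ennreal (norm (R Q *v ?b j) powr q) = ennreal (1 / c1 powr q) * (ennreal (c1 powr q) * ennreal (norm (R Q *v ?b j) powr q))"
      using c1 by (simp add: ennreal_mult[symmetric])
    also have "\<dots> \<le> ennreal (1 / c1 powr q) * nn_avg Q (\<lambda>x. ennreal (norm (U_root x *v ?b j) powr q))"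
      by (intro mult_left_mono reducing_lower[OF Q]) auto
    also have "\<dots> \<le> ennreal (1 / c1 powr q) * ?A"
    proof (intro mult_left_mono nn_avg_mono_AE[OF Q])
      show "AE x in lebesgue. x \<in> Q \<longrightarrow> ennreal (norm (U_root x *v ?b j) powr q) \<le> ennreal (entry_sum (B ** U_root x) powr q)"
        using pos_def_U_root
      proof eventually_elim
        case (elim x)
        show ?case using entry_sum_columns(1)[OF self_adjoint_pos_def[OF elim] q_pos] q_pos
          by (intro impI ennreal_leI powr_mono2) auto
      qed
    qed auto
    finally show "ennreal (norm (R Q *v ?b j) powr q) \<le> ennreal (1 / c1 powr q) * ?A" .
  qed auto
  also have "\<dots> = ennreal (?N / c1 powr q * real CARD('n)) * ?A"
  proof -
    have "ennreal (?N / c1 powr q * real CARD('n)) = ennreal ?N * (ennreal (real CARD('n)) * ennreal (1 / c1 powr q))"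
      using c1 by (simp add: ennreal_mult[symmetric] mult.commute)
    thus ?thesis by (simp add: ennreal_of_nat_eq_real_of_nat mult.assoc)
  qed
  finally show ?thesis .
qed

end

section \<open>The dual average at the reducing operator\<close>

context reduced_weights
begin

text \<open>The conjugate exponent; every lemma about it assumes \<open>1 < p\<close>.\<close>
definition p' :: real where "p' = p / (p - 1)"

text \<open>The inner expression of the constant \<open>A\<^sub>p\<^sub>,\<^sub>q\<close> as a function of the matrix that stands to the
left of \<open>V\<^sup>-\<^sup>1\<^sup>/\<^sup>p\<close>. The constant averages it over \<open>A = U\<^sup>1\<^sup>/\<^sup>q(x)\<close>, while the operator norm of
\<open>B\<^sub>Q\<close> is governed by its value at the reducing operator.\<close>
definition dual_size :: "(real ^ 'd) set \<Rightarrow> complex ^ 'n ^ 'n \<Rightarrow> ennreal" where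
  "dual_size Q A = enn_powr (nn_avg Q (\<lambda>y. ennreal (op_norm (A ** V_inv_root y) powr p'))) (q / p')"

definition dual_avg :: "(real ^ 'd) set \<Rightarrow> complex ^ 'n \<Rightarrow> ennreal" where
  "dual_avg Q v = nn_avg Q (\<lambda>y. ennreal (norm (V_inv_root y *v v) powr p'))"

lemma p'_pos: "1 < p \<Longrightarrow> 1 < p'" by (simp add: p'_def)

lemma nn_avg_op_norm_commute:
  assumes "Q \<in> cubes" "self_adjoint A"
  shows "nn_avg Q (\<lambda>y. ennreal (op_norm (A ** V_inv_root y) powr p')) = nn_avg Q (\<lambda>y. ennreal (op_norm (V_inv_root y ** A) powr p'))"
proof -
  have "AE y in lebesgue. op_norm (A ** V_inv_root y) = op_norm (V_inv_root y ** A)"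
    using pos_def_V_inv_root by eventually_elim (use assms in \<open>auto intro: op_norm_mult_commute self_adjoint_pos_def\<close>)
  hence "AE y in lebesgue. y \<in> Q \<longrightarrow> ennreal (op_norm (A ** V_inv_root y) powr p') = ennreal (op_norm (V_inv_root y ** A) powr p')"
    by eventually_elim auto
  thus ?thesis
    by (intro antisym nn_avg_mono_AE[OF assms(1)]) (auto elim: eventually_mono)
qed

text \<open>If one invertible matrix has finite dual size, all averages of \<open>|V\<^sup>-\<^sup>1\<^sup>/\<^sup>p v|\<close> to the power
\<open>p'\<close> are finite: every vector is in the range of that matrix.\<close>
lemma dual_avg_finite:
  assumes Q: "Q \<in> cubes" and p1: "1 < p" and A: "pos_def A" and fin: "dual_size Q A < top"
  shows "dual_avg Q v < top"
proof -
  obtain u where u: "v = A *v u" using pos_def_surj[OF A] .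
  have "norm (V_inv_root y *v v) \<le> op_norm (V_inv_root y ** A) * norm u" for y
    using norm_matrix_vec_le[of "V_inv_root y ** A" u] by (simp add: u matrix_vector_mul_assoc)
  hence "norm (V_inv_root y *v v) powr p' \<le> norm u powr p' * op_norm (V_inv_root y ** A) powr p'" for y
    using powr_mono2[of p' "norm (V_inv_root y *v v)" "norm u * op_norm (V_inv_root y ** A)"] p'_pos[OF p1]
    by (simp add: powr_mult mult.commute)
  hence "dual_avg Q v \<le> nn_avg Q (\<lambda>y. ennreal (norm u powr p') * ennreal (op_norm (V_inv_root y ** A) powr p'))"
    unfolding dual_avg_def
    by (intro nn_avg_mono_AE[OF Q] always_eventually) (simp add: ennreal_mult[symmetric] ennreal_leI)
  also have "\<dots> = ennreal (norm u powr p') * nn_avg Q (\<lambda>y. ennreal (op_norm (V_inv_root y ** A) powr p'))"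
  proof (rule nn_avg_cmult[OF Q])
    have "(\<lambda>y. op_norm (V_inv_root y ** A)) \<in> borel_measurable lebesgue"
      by (rule measurable_compose[OF _ borel_measurable_op_norm]) (auto intro: borel_measurable_matrix_mult)
    thus "(\<lambda>y. ennreal (op_norm (V_inv_root y ** A) powr p')) \<in> borel_measurable lebesgue" by measurable
  qed
  also have "\<dots> < top" using fin
    by (simp add: dual_size_def enn_powr_less_top_iff nn_avg_op_norm_commute[OF Q self_adjoint_pos_def[OF A]] ennreal_mult_less_top)
  finally show ?thesis .
qed

text \<open>Once finite, the \<open>L\<^sup>p\<^sup>'\<close> average of \<open>|V\<^sup>-\<^sup>1\<^sup>/\<^sup>p v|\<close> is a norm in the constant vector
\<open>v\<close>, to which Auerbach coordinates apply.\<close>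
definition dual_norm :: "(real ^ 'd) set \<Rightarrow> complex ^ 'n \<Rightarrow> real" where
  "dual_norm Q v = enn2real (dual_avg Q v) powr (1 / p')"

lemma dual_norm_nonneg: "0 \<le> dual_norm Q v" by (simp add: dual_norm_def)

lemma dual_avg_eq:
  assumes "1 < p" "dual_avg Q v < top"
  shows "dual_avg Q v = ennreal (dual_norm Q v powr p')"
  using assms p'_pos by (simp add: dual_norm_def powr_powr)

lemma dual_norm_pos:
  assumes Q: "Q \<in> cubes" and p1: "1 < p" and fin: "dual_avg Q v < top" and v: "v \<noteq> 0"
  shows "0 < dual_norm Q v"
proof (rule ccontr)
  assume "\<not> 0 < dual_norm Q v"
  hence "dual_avg Q v = 0" using dual_avg_eq[OF p1 fin] dual_norm_nonneg[of Q v] by simp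
  hence "(\<integral>\<^sup>+y. ennreal (norm (V_inv_root y *v v) powr p') \<partial>lebesgue_on Q) = 0"
    unfolding dual_avg_def integral_eq_nn_avg[OF Q] by simp
  hence "AE y in lebesgue_on Q. ennreal (norm (V_inv_root y *v v) powr p') = 0"
    by (subst (asm) nn_integral_0_iff_AE) (auto intro!: measurable_restrict_space1)
  hence 1: "AE y in lebesgue. y \<in> Q \<longrightarrow> ennreal (norm (V_inv_root y *v v) powr p') = 0"
    using cube_sets[OF Q] by (simp add: AE_restrict_space_iff)
  have 2: "AE y in lebesgue. y \<in> Q \<longrightarrow> ennreal (norm (V_inv_root y *v v) powr p') \<noteq> 0"
    using pos_def_V_inv_root by eventually_elim (use pos_def_mult_nonzero v in \<open>auto simp: ennreal_eq_0_iff\<close>)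
  show False using cube_AE_false[OF Q 1 2] .
qed

lemma dual_avg_zero: "dual_avg Q 0 = 0"
  unfolding dual_avg_def by (simp add: nn_avg_def)

lemma dual_norm_zero: "dual_norm Q 0 = 0"
  by (simp add: dual_norm_def dual_avg_zero)

lemma dual_norm_triangle:
  assumes Q: "Q \<in> cubes" and p1: "1 < p" and fin: "\<And>v. dual_avg Q v < top"
  shows "dual_norm Q (u + v) \<le> dual_norm Q u + dual_norm Q v"
proof (cases "u = 0 \<or> v = 0")
  case True
  thus ?thesis by (auto simp: dual_norm_zero)
next
  case False
  define k where "k = vol Q powr (1 / p')"
  have k: "0 < k" "k powr p' = vol Q"
    using cube_vol_pos[OF Q] p'_pos[OF p1] by (auto simp: k_def powr_powr)
  have pos: "0 < dual_norm Q u" "0 < dual_norm Q v"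
    using False dual_norm_pos[OF Q p1 fin] by auto
  have int: "(\<integral>\<^sup>+y. ennreal (norm (V_inv_root y *v w) powr p') \<partial>lebesgue_on Q) = ennreal ((k * dual_norm Q w) powr p')" for w
    unfolding integral_eq_nn_avg[OF Q] dual_avg_def[symmetric] dual_avg_eq[OF p1 fin]
    using cube_vol_pos[OF Q] by (simp add: powr_mult k ennreal_mult)
  have "(\<integral>\<^sup>+y. ennreal (norm (V_inv_root y *v (u + v)) powr p') \<partial>lebesgue_on Q)
      \<le> ennreal ((k * dual_norm Q u + k * dual_norm Q v) powr p')"
    using p'_pos[OF p1] k pos
    by (intro Minkowski_inequality[where f = "\<lambda>y. norm (V_inv_root y *v u)" and g = "\<lambda>y. norm (V_inv_root y *v v)"])
      (auto simp: int matrix_vector_right_distrib norm_triangle_ineq intro!: measurable_restrict_space1)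
  hence "(k * dual_norm Q (u + v)) powr p' \<le> (k * (dual_norm Q u + dual_norm Q v)) powr p'"
    by (simp add: int distrib_left)
  hence "k * dual_norm Q (u + v) \<le> k * (dual_norm Q u + dual_norm Q v)"
    using powr_less_mono2[of p' "k * (dual_norm Q u + dual_norm Q v)" "k * dual_norm Q (u + v)"]
      p'_pos[OF p1] k pos by (meson add_nonneg_nonneg less_imp_le less_le_trans mult_nonneg_nonneg not_le zero_less_one)
  thus ?thesis using k by simp
qed

lemma dual_norm_smult:
  assumes Q: "Q \<in> cubes" and p1: "1 < p" and fin: "\<And>v. dual_avg Q v < top"
  shows "dual_norm Q (c *s v) = norm c * dual_norm Q v"
proof -
  have "dual_avg Q (c *s v) = nn_avg Q (\<lambda>y. ennreal (norm c powr p') * ennreal (norm (V_inv_root y *v v) powr p'))"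
    unfolding dual_avg_def matrix_vec_smult norm_vector_smult by (simp add: powr_mult ennreal_mult)
  also have "\<dots> = ennreal (norm c powr p') * dual_avg Q v"
    unfolding dual_avg_def by (rule nn_avg_cmult[OF Q]) auto
  finally have "dual_avg Q (c *s v) = ennreal ((norm c * dual_norm Q v) powr p')"
    unfolding dual_avg_eq[OF p1 fin] by (simp add: powr_mult ennreal_mult)
  thus ?thesis unfolding dual_norm_def[of Q "c *s v"] using p'_pos[OF p1]
    by (simp add: powr_powr dual_norm_nonneg)
qed

text \<open>The decisive step for \<open>p > 1\<close>: Auerbach coordinates of the norm \<open>dual_norm Q\<close> linearize the dual
size. For all Hermitian \<open>A\<close> simultaneously it is comparable to \<open>entry_sum (B ** A)\<close> to the power
\<open>q\<close>, and the constants depend only on the dimension and on the exponents. The matrix \<open>A0\<close>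
only serves to know that the norm is finite.\<close>
lemma dual_size_coordinates:
  assumes Q: "Q \<in> cubes" and p1: "1 < p" and A0: "pos_def A0" "dual_size Q A0 < top"
  shows "\<exists>B. \<forall>A. self_adjoint A \<longrightarrow>
     ennreal (entry_sum (B ** A) powr q) \<le> ennreal ((real CARD('n) * real CARD('n)) powr q) * dual_size Q A \<and>
     dual_size Q A \<le> ennreal ((real CARD('n) powr p' * real CARD('n)) powr (q / p')) * ennreal (entry_sum (B ** A) powr q)"
proof -
  note fin = dual_avg_finite[OF Q p1 A0]
  note p' = p'_pos[OF p1]
  let ?N = "real CARD('n)"
  obtain B :: "complex ^ 'n ^ 'n" where B: "\<And>v j. norm ((B *v v) $ j) \<le> dual_norm Q v"
      "\<And>v. dual_norm Q v \<le> (\<Sum>j\<in>UNIV. norm ((B *v v) $ j))"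
    using Auerbach_coordinates[of "dual_norm Q", OF dual_norm_triangle[OF Q p1 fin]
        dual_norm_smult[OF Q p1 fin] dual_norm_pos[OF Q p1 fin]] by blast
  have nth: "(B ** A) $ j $ i = (B *v (A *v axis i 1)) $ j" for A :: "complex ^ 'n ^ 'n" and i j
    by (simp add: matrix_vector_mul_assoc)
       (simp add: matrix_vector_mult_def axis_def if_distrib cong: if_cong)
  show ?thesis
  proof (intro exI[of _ B] allI impI conjI)
    fix A :: "complex ^ 'n ^ 'n" assume A: "self_adjoint A"
    define \<tau> where "\<tau> = entry_sum (B ** A)"
    have \<tau>0: "0 \<le> \<tau>" by (auto simp: \<tau>_def entry_sum_def intro!: sum_nonneg)
    define X where "X = nn_avg Q (\<lambda>y. ennreal (op_norm (A ** V_inv_root y) powr p'))"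
    have X: "X = nn_avg Q (\<lambda>y. ennreal (op_norm (V_inv_root y ** A) powr p'))"
      unfolding X_def by (rule nn_avg_op_norm_commute[OF Q A])
    have GX: "dual_size Q A = enn_powr X (q / p')" by (simp add: dual_size_def X_def)
    have col: "(V_inv_root y ** A) *v axis i 1 = V_inv_root y *v (A *v axis i 1)" for y i
      by (simp add: matrix_vector_mul_assoc)
    have \<tau>1: "dual_norm Q (A *v axis i 1) \<le> \<tau>" for i
    proof -
      have "dual_norm Q (A *v axis i 1) \<le> (\<Sum>j\<in>UNIV. norm ((B ** A) $ j $ i))" unfolding nth by (rule B)
      also have "\<dots> \<le> \<tau>" unfolding \<tau>_def entry_sum_def
        by (intro sum_mono member_le_sum[where f = "\<lambda>i. norm ((B ** A) $ j $ i)" for j]) auto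
      finally show ?thesis .
    qed
    \<comment> \<open>Each of the \<open>n\<^sup>2\<close> summands of \<open>\<tau>\<close> is at most the dual norm of a column of \<open>A\<close>.\<close>
    have "\<exists>i. \<tau> \<le> ?N * ?N * dual_norm Q (A *v axis i 1)"
    proof (rule ccontr)
      assume "\<nexists>i. \<tau> \<le> ?N * ?N * dual_norm Q (A *v axis i 1)"
      hence less: "dual_norm Q (A *v axis i 1) < \<tau> / (?N * ?N)" for i
        by (simp add: not_le pos_less_divide_eq mult.commute)
      have "\<tau> < (\<Sum>j\<in>(UNIV::'n set). \<Sum>i\<in>(UNIV::'n set). \<tau> / (?N * ?N))"
        unfolding \<tau>_def[of] entry_sum_def[of "B ** A"]
        by (intro sum_strict_mono) (auto simp: nth intro: order_le_less_trans[OF B(1)] less[unfolded \<tau>_def entry_sum_def nth])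
      thus False by simp
    qed
    then obtain i where i: "\<tau> \<le> ?N * ?N * dual_norm Q (A *v axis i 1)" by blast
    have "dual_avg Q (A *v axis i 1) \<le> X" unfolding X dual_avg_def
      using p' column_powr_le_op_norm[of p' "V_inv_root y ** A" i for y]
      by (intro nn_avg_mono_AE[OF Q] always_eventually) (simp add: col)
    hence "enn_powr (dual_avg Q (A *v axis i 1)) (q / p') \<le> dual_size Q A"
      unfolding GX using p' q_pos by (intro enn_powr_mono) auto
    moreover have "enn_powr (dual_avg Q (A *v axis i 1)) (q / p') = ennreal (dual_norm Q (A *v axis i 1) powr q)"
      unfolding dual_avg_eq[OF p1 fin] using p' by (simp add: enn_powr_ennreal powr_powr)
    ultimately have d: "ennreal (dual_norm Q (A *v axis i 1) powr q) \<le> dual_size Q A" by simp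
    have "\<tau> powr q \<le> (?N * ?N * dual_norm Q (A *v axis i 1)) powr q"
      using i \<tau>0 q_pos by (intro powr_mono2) auto
    hence "ennreal (\<tau> powr q) \<le> ennreal ((?N * ?N) powr q) * ennreal (dual_norm Q (A *v axis i 1) powr q)"
      by (simp add: powr_mult ennreal_mult[symmetric] ennreal_leI)
    also have "\<dots> \<le> ennreal ((?N * ?N) powr q) * dual_size Q A" by (intro mult_left_mono d) auto
    finally show "ennreal (entry_sum (B ** A) powr q) \<le> ennreal ((?N * ?N) powr q) * dual_size Q A" unfolding \<tau>_def .
    have "X \<le> nn_avg Q (\<lambda>y. ennreal (?N powr p') * (\<Sum>i\<in>UNIV. ennreal (norm (V_inv_root y *v (A *v axis i 1)) powr p')))"
      unfolding X using p' op_norm_powr_le_sum[of p' "V_inv_root y ** A" for y]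
      by (intro nn_avg_mono_AE[OF Q] always_eventually) (simp add: col del: sum_ennreal)
    also have "\<dots> = ennreal (?N powr p') * (\<Sum>i\<in>UNIV. dual_avg Q (A *v axis i 1))"
      unfolding dual_avg_def by (subst nn_avg_cmult[OF Q]) (auto simp: nn_avg_sum[OF Q] simp del: sum_ennreal)
    also have "\<dots> \<le> ennreal (?N powr p') * (\<Sum>i\<in>(UNIV::'n set). ennreal (\<tau> powr p'))"
      unfolding dual_avg_eq[OF p1 fin] using \<tau>1 p'
      by (intro mult_left_mono sum_mono ennreal_leI powr_mono2) (auto simp: dual_norm_nonneg)
    also have "\<dots> = ennreal (?N powr p' * ?N * \<tau> powr p')"
      by (simp add: ennreal_mult ennreal_of_nat_eq_real_of_nat mult.assoc)
    finally have "dual_size Q A \<le> enn_powr (ennreal (?N powr p' * ?N * \<tau> powr p')) (q / p')"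
      unfolding GX using p' q_pos by (intro enn_powr_mono) auto
    also have "\<dots> = ennreal ((?N powr p' * ?N) powr (q / p') * \<tau> powr q)"
      using p' by (simp add: enn_powr_ennreal powr_mult powr_powr)
    finally show "dual_size Q A \<le> ennreal ((?N powr p' * ?N) powr (q / p')) * ennreal (entry_sum (B ** A) powr q)"
      unfolding \<tau>_def by (simp add: ennreal_mult)
  qed
qed

text \<open>Through the coordinates of \<open>dual_size_coordinates\<close> the average over \<open>U\<^sup>1\<^sup>/\<^sup>q(x)\<close> is compared with
the value at the reducing operator. Finiteness of the right-hand side is what provides the coordinates;
for the reverse bound below, finiteness of the average provides a point \<open>x0\<close> that does.\<close>
lemma avg_dual_size_le:
  assumes p1: "1 < p"
  shows "\<exists>K\<ge>0. \<forall>Q\<in>cubes. dual_size Q (R Q) < top \<longrightarrow> nn_avg Q (\<lambda>x. dual_size Q (U_root x)) \<le> ennreal K * dual_size Q (R Q)"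
proof -
  let ?N = "real CARD('n)"
  define k1 where "k1 = (?N * ?N) powr q"
  define k2 where "k2 = (?N powr p' * ?N) powr (q / p')"
  define k3 where "k3 = (?N * ?N) powr q * c2 powr q * ?N"
  have k: "0 \<le> k1" "0 \<le> k2" "0 \<le> k3" by (auto simp: k1_def k2_def k3_def)
  show ?thesis
  proof (intro exI[of _ "k2 * (k3 * k1)"] conjI ballI impI)
    fix Q :: "(real ^ 'd) set" assume Q: "Q \<in> cubes" and fin: "dual_size Q (R Q) < top"
    obtain B where B: "\<And>A. self_adjoint A \<Longrightarrow> ennreal (entry_sum (B ** A) powr q) \<le> ennreal k1 * dual_size Q A"
        "\<And>A. self_adjoint A \<Longrightarrow> dual_size Q A \<le> ennreal k2 * ennreal (entry_sum (B ** A) powr q)"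
      using dual_size_coordinates[OF Q p1 pos_def_R[OF Q] fin] unfolding k1_def k2_def by blast
    have "nn_avg Q (\<lambda>x. dual_size Q (U_root x)) \<le> nn_avg Q (\<lambda>x. ennreal k2 * ennreal (entry_sum (B ** U_root x) powr q))"
      by (intro nn_avg_mono_AE[OF Q] eventually_mono[OF pos_def_U_root]) (auto intro: B self_adjoint_pos_def)
    also have "\<dots> = ennreal k2 * nn_avg Q (\<lambda>x. ennreal (entry_sum (B ** U_root x) powr q))"
      by (intro nn_avg_cmult[OF Q]) auto
    also have "\<dots> \<le> ennreal k2 * (ennreal k3 * ennreal (entry_sum (B ** R Q) powr q))"
      unfolding k3_def by (intro mult_left_mono avg_entry_sum_le[OF Q]) auto
    also have "\<dots> \<le> ennreal k2 * (ennreal k3 * (ennreal k1 * dual_size Q (R Q)))"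
      by (intro mult_left_mono B self_adjoint_pos_def pos_def_R Q) auto
    also have "\<dots> = ennreal (k2 * (k3 * k1)) * dual_size Q (R Q)"
      using k by (simp add: ennreal_mult mult.assoc)
    finally show "nn_avg Q (\<lambda>x. dual_size Q (U_root x)) \<le> ennreal (k2 * (k3 * k1)) * dual_size Q (R Q)" .
  qed (use k in auto)
qed

lemma dual_size_le_avg:
  assumes p1: "1 < p"
  shows "\<exists>K\<ge>0. \<forall>Q\<in>cubes. nn_avg Q (\<lambda>x. dual_size Q (U_root x)) < top \<longrightarrow> dual_size Q (R Q) \<le> ennreal K * nn_avg Q (\<lambda>x. dual_size Q (U_root x))"
proof -
  let ?N = "real CARD('n)"
  define k1 where "k1 = (?N * ?N) powr q"
  define k2 where "k2 = (?N powr p' * ?N) powr (q / p')"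
  define k3 where "k3 = (?N * ?N) powr q / c1 powr q * ?N"
  have k: "0 < k1" "0 \<le> k2" "0 \<le> k3" by (auto simp: k1_def k2_def k3_def)
  show ?thesis
  proof (intro exI[of _ "k2 * (k3 * k1)"] conjI ballI impI)
    fix Q :: "(real ^ 'd) set" assume Q: "Q \<in> cubes" and fin: "nn_avg Q (\<lambda>x. dual_size Q (U_root x)) < top"
    have "\<exists>x. pos_def (U_root x) \<and> dual_size Q (U_root x) < top"
    proof (rule ccontr)
      assume *: "\<nexists>x. pos_def (U_root x) \<and> dual_size Q (U_root x) < top"
      have "nn_avg Q (\<lambda>x. top) \<le> nn_avg Q (\<lambda>x. dual_size Q (U_root x))"
        using * by (intro nn_avg_mono_AE[OF Q] eventually_mono[OF pos_def_U_root]) (auto simp: less_top)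
      thus False using fin by (simp add: nn_avg_const[OF Q] top_unique)
    qed
    then obtain x0 where x0: "pos_def (U_root x0)" "dual_size Q (U_root x0) < top" by blast
    obtain B where B: "\<And>A. self_adjoint A \<Longrightarrow> ennreal (entry_sum (B ** A) powr q) \<le> ennreal k1 * dual_size Q A"
        "\<And>A. self_adjoint A \<Longrightarrow> dual_size Q A \<le> ennreal k2 * ennreal (entry_sum (B ** A) powr q)"
      using dual_size_coordinates[OF Q p1 x0] unfolding k1_def k2_def by blast
    have le: "ennreal (1 / k1) * ennreal (entry_sum (B ** A) powr q) \<le> dual_size Q A" if "self_adjoint A" for A
    proof -
      have "ennreal (1 / k1) * ennreal (entry_sum (B ** A) powr q) \<le> ennreal (1 / k1) * (ennreal k1 * dual_size Q A)"
        by (intro mult_left_mono B that) auto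
      also have "\<dots> = dual_size Q A" using k by (simp add: ennreal_mult[symmetric] flip: mult.assoc)
      finally show ?thesis .
    qed
    have "ennreal (1 / k1) * nn_avg Q (\<lambda>x. ennreal (entry_sum (B ** U_root x) powr q))
        = nn_avg Q (\<lambda>x. ennreal (1 / k1) * ennreal (entry_sum (B ** U_root x) powr q))"
      by (intro nn_avg_cmult[OF Q, symmetric]) auto
    also have "\<dots> \<le> nn_avg Q (\<lambda>x. dual_size Q (U_root x))"
      by (intro nn_avg_mono_AE[OF Q] eventually_mono[OF pos_def_U_root]) (auto intro: le self_adjoint_pos_def)
    finally have "ennreal k1 * (ennreal (1 / k1) * nn_avg Q (\<lambda>x. ennreal (entry_sum (B ** U_root x) powr q)))
        \<le> ennreal k1 * nn_avg Q (\<lambda>x. dual_size Q (U_root x))" by (rule mult_left_mono) simp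
    hence avg: "nn_avg Q (\<lambda>x. ennreal (entry_sum (B ** U_root x) powr q)) \<le> ennreal k1 * nn_avg Q (\<lambda>x. dual_size Q (U_root x))"
      using k by (simp add: ennreal_mult[symmetric] flip: mult.assoc)
    have "dual_size Q (R Q) \<le> ennreal k2 * ennreal (entry_sum (B ** R Q) powr q)"
      by (intro B self_adjoint_pos_def pos_def_R Q)
    also have "\<dots> \<le> ennreal k2 * (ennreal k3 * nn_avg Q (\<lambda>x. ennreal (entry_sum (B ** U_root x) powr q)))"
      unfolding k3_def by (intro mult_left_mono entry_sum_le_avg[OF Q]) auto
    also have "\<dots> \<le> ennreal k2 * (ennreal k3 * (ennreal k1 * nn_avg Q (\<lambda>x. dual_size Q (U_root x))))"
      by (intro mult_left_mono avg) auto
    also have "\<dots> = ennreal (k2 * (k3 * k1)) * nn_avg Q (\<lambda>x. dual_size Q (U_root x))"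
      using k by (simp add: ennreal_mult mult.assoc)
    finally show "dual_size Q (R Q) \<le> ennreal (k2 * (k3 * k1)) * nn_avg Q (\<lambda>x. dual_size Q (U_root x))" .
  qed (use k in auto)
qed

text \<open>With an arbitrary fixed matrix on the right, the reducing operator can be inserted column by column.
This and the next lemma replace the Auerbach argument when \<open>p = 1\<close>, where \<open>A\<close> is \<open>V\<^sup>-\<^sup>1(y)\<close>
for fixed \<open>y\<close>.\<close>
lemma op_norm_le_avg:
  assumes Q: "Q \<in> cubes"
  shows "ennreal (op_norm (R Q ** A) powr q)
     \<le> ennreal (real CARD('n) powr q / c1 powr q * real CARD('n)) * nn_avg Q (\<lambda>x. ennreal (op_norm (U_root x ** A) powr q))"
proof -
  let ?A = "nn_avg Q (\<lambda>x. ennreal (op_norm (U_root x ** A) powr q))"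
  have "ennreal (norm (R Q *v (A *v axis i 1)) powr q) \<le> ennreal (1 / c1 powr q) * ?A" for i
  proof -
    have "ennreal (norm (R Q *v (A *v axis i 1)) powr q)
        = ennreal (1 / c1 powr q) * (ennreal (c1 powr q) * ennreal (norm (R Q *v (A *v axis i 1)) powr q))"
      using c1 by (simp add: ennreal_mult[symmetric])
    also have "\<dots> \<le> ennreal (1 / c1 powr q) * nn_avg Q (\<lambda>x. ennreal (norm (U_root x *v (A *v axis i 1)) powr q))"
      by (intro mult_left_mono reducing_lower[OF Q]) auto
    also have "\<dots> \<le> ennreal (1 / c1 powr q) * ?A"
      using column_powr_le_op_norm[OF q_pos, of "U_root x ** A" i for x]
      by (intro mult_left_mono nn_avg_mono_AE[OF Q] always_eventually) (auto simp: matrix_vector_mul_assoc)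
    finally show ?thesis .
  qed
  hence "(\<Sum>i\<in>UNIV. ennreal (norm ((R Q ** A) *v axis i 1) powr q)) \<le> (\<Sum>i\<in>(UNIV::'n set). ennreal (1 / c1 powr q) * ?A)"
    by (intro sum_mono) (simp add: matrix_vector_mul_assoc)
  hence "ennreal (op_norm (R Q ** A) powr q) \<le> ennreal (real CARD('n) powr q) * (\<Sum>i\<in>(UNIV::'n set). ennreal (1 / c1 powr q) * ?A)"
    by (intro order_trans[OF op_norm_powr_le_sum[OF q_pos]] mult_left_mono) auto
  also have "\<dots> = ennreal (real CARD('n) powr q / c1 powr q * real CARD('n)) * ?A"
  proof -
    have "ennreal (real CARD('n) powr q / c1 powr q * real CARD('n))
        = ennreal (real CARD('n) powr q) * (ennreal (real CARD('n)) * ennreal (1 / c1 powr q))"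
      using c1 by (simp add: ennreal_mult[symmetric] mult.commute)
    thus ?thesis by (simp add: ennreal_of_nat_eq_real_of_nat mult.assoc)
  qed
  finally show ?thesis .
qed

lemma avg_op_norm_le:
  assumes Q: "Q \<in> cubes"
  shows "nn_avg Q (\<lambda>x. ennreal (op_norm (U_root x ** A) powr q))
     \<le> ennreal (real CARD('n) powr q * c2 powr q * real CARD('n)) * ennreal (op_norm (R Q ** A) powr q)"
proof -
  have "nn_avg Q (\<lambda>x. ennreal (op_norm (U_root x ** A) powr q))
      \<le> nn_avg Q (\<lambda>x. ennreal (real CARD('n) powr q) * (\<Sum>i\<in>UNIV. ennreal (norm (U_root x *v (A *v axis i 1)) powr q)))"
    using op_norm_powr_le_sum[OF q_pos, of "U_root x ** A" for x]
    by (intro nn_avg_mono_AE[OF Q] always_eventually) (simp add: matrix_vector_mul_assoc del: sum_ennreal)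
  also have "\<dots> = ennreal (real CARD('n) powr q) * (\<Sum>i\<in>UNIV. nn_avg Q (\<lambda>x. ennreal (norm (U_root x *v (A *v axis i 1)) powr q)))"
    by (subst nn_avg_cmult[OF Q]) (auto simp: nn_avg_sum[OF Q] simp del: sum_ennreal)
  also have "\<dots> \<le> ennreal (real CARD('n) powr q) * (\<Sum>i\<in>(UNIV::'n set). ennreal (c2 powr q) * ennreal (op_norm (R Q ** A) powr q))"
    using column_powr_le_op_norm[OF q_pos, of "R Q ** A"]
    by (intro mult_left_mono sum_mono order_trans[OF reducing_upper[OF Q]]) (auto simp: matrix_vector_mul_assoc)
  also have "\<dots> = ennreal (real CARD('n) powr q * c2 powr q * real CARD('n)) * ennreal (op_norm (R Q ** A) powr q)"
    by (simp add: ennreal_mult ennreal_of_nat_eq_real_of_nat mult_ac)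
  finally show ?thesis .
qed

text \<open>Tonelli's theorem. The essential supremum of a nonmeasurable function is infinite by convention, so
this is needed to bound the constant for \<open>p = 1\<close>.\<close>
lemma measurable_avg_op_norm:
  assumes Q: "Q \<in> cubes"
  shows "(\<lambda>y. nn_avg Q (\<lambda>x. ennreal (op_norm (U_root x ** V_inv_root y) powr q))) \<in> borel_measurable lebesgue"
proof -
  interpret Q: finite_measure "lebesgue_on Q"
    by (rule finite_measure_lebesgue_on[OF cube_lmeasurable[OF Q]])
  have "(\<lambda>z. U_root (snd z)) \<in> borel_measurable (lebesgue \<Otimes>\<^sub>M lebesgue_on Q)"
    by (rule measurable_compose[OF measurable_snd]) (simp add: measurable_restrict_space1)
  moreover have "(\<lambda>z. V_inv_root (fst z)) \<in> borel_measurable (lebesgue \<Otimes>\<^sub>M lebesgue_on Q)"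
    by (rule measurable_compose[OF measurable_fst]) simp
  ultimately have "(\<lambda>z. op_norm (U_root (snd z) ** V_inv_root (fst z))) \<in> borel_measurable (lebesgue \<Otimes>\<^sub>M lebesgue_on Q)"
    by (intro measurable_compose[OF borel_measurable_matrix_mult borel_measurable_op_norm])
  hence "(\<lambda>z. ennreal (op_norm (U_root (snd z) ** V_inv_root (fst z)) powr q)) \<in> borel_measurable (lebesgue \<Otimes>\<^sub>M lebesgue_on Q)"
    by measurable
  hence "(\<lambda>y. \<integral>\<^sup>+x. ennreal (op_norm (U_root x ** V_inv_root y) powr q) \<partial>lebesgue_on Q) \<in> borel_measurable lebesgue"
    by (intro Q.borel_measurable_nn_integral) (simp add: case_prod_beta')
  thus ?thesis unfolding nn_avg_restrict[OF Q] by measurable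
qed

end

section \<open>The testing inequality and duality\<close>

lemma ennreal_mult_assoc2:
  "0 \<le> a \<Longrightarrow> 0 \<le> b \<Longrightarrow> ennreal a * (ennreal b * x) = ennreal (a * b) * x"
  by (simp add: ennreal_mult mult.assoc)

text \<open>On multiples of the indicator of a cube the weak and the strong norm agree.\<close>
lemma weak_norm_cube:
  assumes Q: "Q \<in> cubes" and q: "0 < q"
  shows "weak_norm q (\<lambda>x. c * indicator Q x) = c * ennreal (vol Q powr (1 / q))"
proof -
  define k where "k = ennreal (vol Q powr (1 / q))"
  have set: "{x. ennreal t < c * indicator Q x} = (if ennreal t < c then Q else {})" for t
    by (auto simp: indicator_def)
  have k: "enn_powr (emeasure lebesgue Q) (1 / q) = k"
    unfolding cube_emeasure[OF Q] k_def by (simp add: enn_powr_ennreal)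
  have tm: "ennreal t * enn_powr (emeasure lebesgue {x. ennreal t < c * indicator Q x}) (1 / q)
      = (if ennreal t < c then ennreal t * k else 0)" for t
    unfolding set by (simp add: k enn_powr_zero)
  show ?thesis unfolding weak_norm_def tm k_def[symmetric]
  proof (rule antisym)
    show "(SUP t\<in>{0<..}. if ennreal t < c then ennreal t * k else 0) \<le> c * k"
      by (intro SUP_least) (auto intro!: mult_right_mono)
    have "c \<le> (SUP t\<in>{t. 0 < t \<and> ennreal t < c}. ennreal t)"
    proof (rule dense_le)
      fix y assume y: "y < c"
      then obtain r where r: "y = ennreal r" "0 \<le> r" by (cases y) (auto simp: less_top)
      show "y \<le> (SUP t\<in>{t. 0 < t \<and> ennreal t < c}. ennreal t)"
        using r y by (cases "r = 0") (auto intro: SUP_upper)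
    qed
    hence "c * k \<le> (SUP t\<in>{t. 0 < t \<and> ennreal t < c}. ennreal t) * k" by (rule mult_right_mono) simp
    also have "\<dots> = (SUP t\<in>{t. 0 < t \<and> ennreal t < c}. ennreal t * k)" by (rule SUP_mult_right_ennreal)
    also have "\<dots> \<le> (SUP t\<in>{0<..}. if ennreal t < c then ennreal t * k else 0)"
    proof (rule SUP_least)
      fix t assume "t \<in> {t. 0 < t \<and> ennreal t < c}"
      thus "ennreal t * k \<le> (SUP t\<in>{0<..}. if ennreal t < c then ennreal t * k else 0)"
        by (intro SUP_upper2[of t]) auto
    qed
    finally show "c * k \<le> (SUP t\<in>{0<..}. if ennreal t < c then ennreal t * k else 0)" .
  qed
qed

context reduced_weights
begin

text \<open>The uniform weak type bound for the operators \<open>B\<^sub>Q\<close>, with the weak norm evaluated by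
\<open>weak_norm_cube\<close>. All three conditions of the theorem are compared with it.\<close>
definition testing_bound :: "real \<Rightarrow> real \<Rightarrow> bool" where
  "testing_bound \<alpha> C \<longleftrightarrow> (\<forall>Q\<in>cubes. \<forall>f\<in>Lp p.
     ennreal (vol Q powr (\<alpha> / real CARD('d) + 1 / q)) * nn_avg Q (\<lambda>y. ennreal (norm ((R Q ** V_inv_root y) *v f y)))
       \<le> ennreal C * Lp_norm p f)"

lemma weak_norm_avg_op:
  assumes Q: "Q \<in> cubes"
  shows "weak_norm q (avg_op \<alpha> p R V Q f) =
    ennreal (vol Q powr (\<alpha> / real CARD('d) + 1 / q)) * nn_avg Q (\<lambda>y. ennreal (norm ((R Q ** V_inv_root y) *v f y)))"
proof -
  let ?A = "nn_avg Q (\<lambda>y. ennreal (norm ((R Q ** V_inv_root y) *v f y)))"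
  have "avg_op \<alpha> p R V Q f = (\<lambda>x. (ennreal (vol Q powr (\<alpha> / real CARD('d))) * ?A) * indicator Q x)"
    by (simp add: fun_eq_iff avg_op_def V_inv_root_def)
  hence "weak_norm q (avg_op \<alpha> p R V Q f) = (ennreal (vol Q powr (\<alpha> / real CARD('d))) * ?A) * ennreal (vol Q powr (1 / q))"
    using weak_norm_cube[OF Q q_pos] by simp
  also have "\<dots> = ennreal (vol Q powr (\<alpha> / real CARD('d)) * vol Q powr (1 / q)) * ?A"
    by (simp add: ennreal_mult mult_ac)
  finally show ?thesis by (simp add: powr_add)
qed

lemma testing_bound_iff:
  "(\<exists>C<top. \<forall>Q\<in>cubes. \<forall>f\<in>Lp p. weak_norm q (avg_op \<alpha> p R V Q f) \<le> C * Lp_norm p f)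
    \<longleftrightarrow> (\<exists>C\<ge>0. testing_bound \<alpha> C)"
proof
  assume "\<exists>C<top. \<forall>Q\<in>cubes. \<forall>f\<in>Lp p. weak_norm q (avg_op \<alpha> p R V Q f) \<le> C * Lp_norm p f"
  then obtain C where C: "C < top" "\<And>Q f. Q \<in> cubes \<Longrightarrow> f \<in> Lp p \<Longrightarrow> weak_norm q (avg_op \<alpha> p R V Q f) \<le> C * Lp_norm p f"
    by blast
  then obtain c where "C = ennreal c" "0 \<le> c" by (cases C) auto
  thus "\<exists>C\<ge>0. testing_bound \<alpha> C" using C(2) weak_norm_avg_op unfolding testing_bound_def by auto
next
  assume "\<exists>C\<ge>0. testing_bound \<alpha> C"
  then obtain c where "0 \<le> c" "testing_bound \<alpha> c" by blast
  thus "\<exists>C<top. \<forall>Q\<in>cubes. \<forall>f\<in>Lp p. weak_norm q (avg_op \<alpha> p R V Q f) \<le> C * Lp_norm p f"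
    using weak_norm_avg_op unfolding testing_bound_def by (intro exI[of _ "ennreal c"]) auto
qed

lemma LpD:
  assumes "f \<in> Lp p"
  shows "f \<in> borel_measurable lebesgue" "(\<integral>\<^sup>+x. ennreal (norm (f x) powr p) \<partial>lebesgue) < top"
  using assms by (auto simp: Lp_def Lp_norm_def enn_powr_less_top_iff)

lemma cube_integral_le:
  assumes "Q \<in> cubes"
  shows "(\<integral>\<^sup>+x. g x \<partial>lebesgue_on Q) \<le> (\<integral>\<^sup>+x. g x \<partial>lebesgue)"
  using cube_sets[OF assms]
  by (simp add: nn_integral_restrict_space) (intro nn_integral_mono, simp add: indicator_def)

lemma avg_norm_le_avg_op_norm: "nn_avg Q (\<lambda>y. ennreal (norm ((R Q ** V_inv_root y) *v f y)))
   \<le> nn_avg Q (\<lambda>y. ennreal (op_norm (R Q ** V_inv_root y) * norm (f y)))" if "Q \<in> cubes"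
  using that by (intro nn_avg_mono_AE always_eventually) (auto intro!: ennreal_leI norm_matrix_vec_le)

text \<open>Hoelder's inequality on the cube; the powers of the volume match because \<open>1/p + 1/p' = 1\<close>.\<close>
lemma testing_bound_of_dual:
  assumes p1: "1 < p" and K: "0 \<le> K"
    and bound: "\<And>Q. Q \<in> cubes \<Longrightarrow>
      ennreal (vol Q powr (\<alpha> / real CARD('d) + 1 / q - 1 / p)) * enn_powr (dual_size Q (R Q)) (1 / q) \<le> ennreal K"
  shows "testing_bound \<alpha> K"
  unfolding testing_bound_def
proof (intro ballI)
  fix Q :: "(real ^ 'd) set" and f :: "real ^ 'd \<Rightarrow> complex ^ 'n" assume Q: "Q \<in> cubes" and f: "f \<in> Lp p"
  note p' = p'_pos[OF p1]
  note v = cube_vol_pos[OF Q]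
  define X where "X = nn_avg Q (\<lambda>y. ennreal (op_norm (R Q ** V_inv_root y) powr p'))"
  let ?b = "\<alpha> / real CARD('d) + 1 / q"
  have "(\<integral>\<^sup>+y. ennreal (op_norm (R Q ** V_inv_root y) * norm (f y)) \<partial>lebesgue_on Q)
      \<le> enn_powr (\<integral>\<^sup>+y. ennreal (op_norm (R Q ** V_inv_root y) powr p') \<partial>lebesgue_on Q) (1 / p') *
        enn_powr (\<integral>\<^sup>+y. ennreal (norm (f y) powr p) \<partial>lebesgue_on Q) (1 / p)"
    unfolding p'_def using LpD(1)[OF f]
    by (intro Hoelder_inequality p1 op_norm_nonneg norm_ge_zero measurable_restrict_space1
        measurable_compose[OF _ borel_measurable_norm]) auto
  also have "\<dots> \<le> (ennreal (vol Q powr (1 / p')) * enn_powr X (1 / p')) * Lp_norm p f"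
    unfolding Lp_norm_def integral_eq_nn_avg[OF Q, of "\<lambda>y. ennreal (op_norm (R Q ** V_inv_root y) powr p')"] X_def[symmetric]
      enn_powr_mult
    using p1 p' v cube_integral_le[OF Q, of "\<lambda>y. ennreal (norm (f y) powr p)"]
    by (intro mult_mono enn_powr_mono) (auto simp: enn_powr_ennreal)
  finally have H: "(\<integral>\<^sup>+y. ennreal (op_norm (R Q ** V_inv_root y) * norm (f y)) \<partial>lebesgue_on Q)
     \<le> (ennreal (vol Q powr (1 / p')) * enn_powr X (1 / p')) * Lp_norm p f" .
  have "ennreal (vol Q powr ?b) * nn_avg Q (\<lambda>y. ennreal (norm ((R Q ** V_inv_root y) *v f y)))
     \<le> ennreal (vol Q powr ?b) * (ennreal (1 / vol Q) * ((ennreal (vol Q powr (1 / p')) * enn_powr X (1 / p')) * Lp_norm p f))"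
    by (intro mult_left_mono order_trans[OF avg_norm_le_avg_op_norm[OF Q]])
       (auto simp: nn_avg_restrict[OF Q] intro!: mult_left_mono H)
  also have "\<dots> = (ennreal (vol Q powr ?b * (1 / vol Q) * vol Q powr (1 / p')) * enn_powr X (1 / p')) * Lp_norm p f"
    using v by (simp add: ennreal_mult_assoc2 mult.assoc)
  also have "vol Q powr ?b * (1 / vol Q) * vol Q powr (1 / p') = vol Q powr (?b - 1 / p)"
  proof -
    have "1 / vol Q = vol Q powr (- 1)" using v by (simp add: powr_minus_divide)
    moreover have "?b + (- 1) + 1 / p' = ?b - 1 / p" using p1 by (simp add: p'_def field_simps)
    ultimately show ?thesis by (metis powr_add)
  qed
  also have "enn_powr X (1 / p') = enn_powr (dual_size Q (R Q)) (1 / q)"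
    unfolding dual_size_def X_def[symmetric] enn_powr_enn_powr using q_pos by simp
  finally have "ennreal (vol Q powr ?b) * nn_avg Q (\<lambda>y. ennreal (norm ((R Q ** V_inv_root y) *v f y)))
    \<le> (ennreal (vol Q powr (?b - 1 / p)) * enn_powr (dual_size Q (R Q)) (1 / q)) * Lp_norm p f" .
  also have "\<dots> \<le> ennreal K * Lp_norm p f" by (intro mult_right_mono bound Q) auto
  finally show "ennreal (vol Q powr ?b) * nn_avg Q (\<lambda>y. ennreal (norm ((R Q ** V_inv_root y) *v f y))) \<le> ennreal K * Lp_norm p f" .
qed

lemma testing_bound_of_dual_1:
  assumes p1: "p = 1" and K: "0 \<le> K"
    and bound: "\<And>Q. Q \<in> cubes \<Longrightarrow>
      AE y in lebesgue_on Q. vol Q powr (\<alpha> / real CARD('d) + 1 / q - 1) * op_norm (R Q ** V_inv_root y) \<le> K"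
  shows "testing_bound \<alpha> K"
  unfolding testing_bound_def
proof (intro ballI)
  fix Q :: "(real ^ 'd) set" and f :: "real ^ 'd \<Rightarrow> complex ^ 'n" assume Q: "Q \<in> cubes" and f: "f \<in> Lp p"
  note v = cube_vol_pos[OF Q]
  let ?b = "\<alpha> / real CARD('d) + 1 / q"
  have m[measurable]: "(\<lambda>y. op_norm (R Q ** V_inv_root y)) \<in> borel_measurable (lebesgue_on Q)" "f \<in> borel_measurable (lebesgue_on Q)"
    using LpD(1)[OF f] by (auto intro: measurable_restrict_space1)
  have vb: "vol Q powr ?b * (1 / vol Q) = vol Q powr (?b - 1)"
    using v by (simp add: powr_diff)
  have "ennreal (vol Q powr ?b) * nn_avg Q (\<lambda>y. ennreal (norm ((R Q ** V_inv_root y) *v f y)))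
     \<le> ennreal (vol Q powr ?b) * (ennreal (1 / vol Q) * (\<integral>\<^sup>+y. ennreal (op_norm (R Q ** V_inv_root y) * norm (f y)) \<partial>lebesgue_on Q))"
    by (intro mult_left_mono order_trans[OF avg_norm_le_avg_op_norm[OF Q]]) (auto simp: nn_avg_restrict[OF Q])
  also have "\<dots> = ennreal (vol Q powr (?b - 1)) * (\<integral>\<^sup>+y. ennreal (op_norm (R Q ** V_inv_root y) * norm (f y)) \<partial>lebesgue_on Q)"
    unfolding vb[symmetric] using v by (intro ennreal_mult_assoc2) auto
  also have "\<dots> = (\<integral>\<^sup>+y. ennreal (vol Q powr (?b - 1)) * ennreal (op_norm (R Q ** V_inv_root y) * norm (f y)) \<partial>lebesgue_on Q)"
    by (intro nn_integral_cmult[symmetric]) measurable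
  also have "\<dots> \<le> (\<integral>\<^sup>+y. ennreal K * ennreal (norm (f y)) \<partial>lebesgue_on Q)"
  proof (intro nn_integral_mono_AE eventually_mono[OF bound[OF Q]])
    fix y assume "vol Q powr (?b - 1) * op_norm (R Q ** V_inv_root y) \<le> K"
    hence "vol Q powr (?b - 1) * op_norm (R Q ** V_inv_root y) * norm (f y) \<le> K * norm (f y)"
      by (intro mult_right_mono) auto
    thus "ennreal (vol Q powr (?b - 1)) * ennreal (op_norm (R Q ** V_inv_root y) * norm (f y)) \<le> ennreal K * ennreal (norm (f y))"
      using K by (subst (1 2) ennreal_mult[symmetric])
        (auto simp: mult.assoc intro!: ennreal_leI mult_nonneg_nonneg op_norm_nonneg)
  qed
  also have "\<dots> = ennreal K * (\<integral>\<^sup>+y. ennreal (norm (f y)) \<partial>lebesgue_on Q)" by (intro nn_integral_cmult) measurable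
  also have "\<dots> \<le> ennreal K * (\<integral>\<^sup>+y. ennreal (norm (f y)) \<partial>lebesgue)"
    by (intro mult_left_mono cube_integral_le Q) auto
  also have "\<dots> = ennreal K * Lp_norm p f" by (simp add: Lp_norm_def p1 enn_powr_one)
  finally show "ennreal (vol Q powr ?b) * nn_avg Q (\<lambda>y. ennreal (norm ((R Q ** V_inv_root y) *v f y))) \<le> ennreal K * Lp_norm p f" .
qed

text \<open>Testing with \<open>f = h e\<^sub>i\<close> supported in \<open>Q\<close> turns the bound into a scalar one for the
\<open>i\<close>-th column, to which \<open>Lp_dual_bound\<close> and \<open>L1_dual_bound\<close> apply.\<close>
lemma testing_bound_scalar:
  assumes T: "testing_bound \<alpha> C" and C: "0 \<le> C" and Q: "Q \<in> cubes"
    and h: "h \<in> borel_measurable (lebesgue_on Q)" "\<And>y. 0 \<le> h y"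
    and fin: "(\<integral>\<^sup>+y. ennreal (h y powr p) \<partial>lebesgue_on Q) < top"
  shows "(\<integral>\<^sup>+y. ennreal (norm ((R Q ** V_inv_root y) *v axis i 1) * h y) \<partial>lebesgue_on Q)
     \<le> ennreal (C * vol Q powr (1 - \<alpha> / real CARD('d) - 1 / q)) * enn_powr (\<integral>\<^sup>+y. ennreal (h y powr p) \<partial>lebesgue_on Q) (1 / p)"
proof -
  note v = cube_vol_pos[OF Q]
  let ?b = "\<alpha> / real CARD('d) + 1 / q"
  define f where "f = (\<lambda>y. if y \<in> Q then complex_of_real (h y) *s axis i 1 else (0 :: complex ^ 'n))"
  have "(\<lambda>y. complex_of_real (h y) *s axis i 1 :: complex ^ 'n) \<in> borel_measurable (lebesgue_on Q)"
    unfolding borel_measurable_vec_iff using h(1) by (auto intro!: borel_measurable_times borel_measurable_of_real)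
  hence fm: "f \<in> borel_measurable lebesgue"
    unfolding f_def using cube_sets[OF Q] by (subst (asm) measurable_restrict_space_iff[where c = 0]) auto
  have nf: "norm (f y) = h y * indicator Q y" for y
    using h(2)[of y] by (auto simp: f_def norm_vector_smult)
  have "(\<integral>\<^sup>+y. ennreal (norm (f y) powr p) \<partial>lebesgue) = (\<integral>\<^sup>+y. ennreal (h y powr p) * indicator Q y \<partial>lebesgue)"
    unfolding nf by (intro nn_integral_cong) (auto simp: indicator_def)
  also have "\<dots> = (\<integral>\<^sup>+y. ennreal (h y powr p) \<partial>lebesgue_on Q)"
    using cube_sets[OF Q] by (simp add: nn_integral_restrict_space)
  finally have If: "(\<integral>\<^sup>+y. ennreal (norm (f y) powr p) \<partial>lebesgue) = (\<integral>\<^sup>+y. ennreal (h y powr p) \<partial>lebesgue_on Q)" .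
  hence fL: "f \<in> Lp p" and Lf: "Lp_norm p f = enn_powr (\<integral>\<^sup>+y. ennreal (h y powr p) \<partial>lebesgue_on Q) (1 / p)"
    using fm fin by (auto simp: Lp_def Lp_norm_def enn_powr_less_top_iff)
  define J where "J = (\<integral>\<^sup>+y. ennreal (norm ((R Q ** V_inv_root y) *v axis i 1) * h y) \<partial>lebesgue_on Q)"
  have J: "(\<integral>\<^sup>+y. ennreal (norm ((R Q ** V_inv_root y) *v f y)) \<partial>lebesgue_on Q) = J"
    unfolding J_def
  proof (intro nn_integral_cong)
    fix y assume "y \<in> space (lebesgue_on Q)"
    hence "f y = complex_of_real (h y) *s axis i 1" by (simp add: f_def space_restrict_space)
    thus "ennreal (norm ((R Q ** V_inv_root y) *v f y)) = ennreal (norm ((R Q ** V_inv_root y) *v axis i 1) * h y)"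
      using h(2)[of y] by (simp only: matrix_vec_smult norm_vector_smult norm_of_real abs_of_nonneg mult.commute)
  qed
  have "ennreal (vol Q powr ?b) * nn_avg Q (\<lambda>y. ennreal (norm ((R Q ** V_inv_root y) *v f y))) \<le> ennreal C * Lp_norm p f"
    using T[unfolded testing_bound_def, THEN bspec, OF Q, THEN bspec, OF fL] .
  hence "ennreal (vol Q powr ?b) * (ennreal (1 / vol Q) * J) \<le> ennreal C * Lp_norm p f"
    unfolding nn_avg_restrict[OF Q] J .
  hence "ennreal (vol Q powr (1 - ?b)) * (ennreal (vol Q powr ?b) * (ennreal (1 / vol Q) * J))
      \<le> ennreal (vol Q powr (1 - ?b)) * (ennreal C * Lp_norm p f)"
    by (rule mult_left_mono) simp
  also have "ennreal (vol Q powr (1 - ?b)) * (ennreal (vol Q powr ?b) * (ennreal (1 / vol Q) * J))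
      = ennreal (vol Q powr (1 - ?b) * vol Q powr ?b * (1 / vol Q)) * J"
    using v by (subst (2) ennreal_mult_assoc2, simp, simp, subst ennreal_mult_assoc2) (simp_all add: mult.assoc)
  also have "vol Q powr (1 - ?b) * vol Q powr ?b * (1 / vol Q) = 1"
    using v by (simp flip: powr_add)
  also have "ennreal (vol Q powr (1 - ?b)) * (ennreal C * Lp_norm p f) = ennreal (C * vol Q powr (1 - ?b)) * Lp_norm p f"
    using C by (simp add: ennreal_mult mult_ac)
  finally show ?thesis unfolding J_def[symmetric] Lf by (simp add: diff_diff_eq)
qed

lemma measurable_norm_mult_V_inv_root:
  fixes A :: "complex ^ 'n ^ 'n"
  shows "(\<lambda>y. norm ((A ** V_inv_root y) *v e)) \<in> borel_measurable (lebesgue_on Q)"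
  by (rule measurable_restrict_space1)
     (rule measurable_compose[OF borel_measurable_matrix_vec borel_measurable_norm], auto intro: borel_measurable_matrix_mult)

lemma dual_of_testing_bound:
  assumes p1: "1 < p" and C: "0 \<le> C" and T: "testing_bound \<alpha> C"
  shows "\<exists>K\<ge>0. \<forall>Q\<in>cubes.
    ennreal (vol Q powr (\<alpha> / real CARD('d) + 1 / q - 1 / p)) * enn_powr (dual_size Q (R Q)) (1 / q) \<le> ennreal K"
proof -
  note p' = p'_pos[OF p1]
  let ?N = "real CARD('n)"
  define k where "k = (?N powr p' * ?N) powr (1 / p')"
  show ?thesis
  proof (intro exI[of _ "k * C"] conjI ballI)
    fix Q :: "(real ^ 'd) set" assume Q: "Q \<in> cubes"
    note v = cube_vol_pos[OF Q]
    let ?e = "1 - \<alpha> / real CARD('d) - 1 / q"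
    define c where "c = C * vol Q powr ?e"
    have c: "0 \<le> c" using C by (simp add: c_def)
    define X where "X = nn_avg Q (\<lambda>y. ennreal (op_norm (R Q ** V_inv_root y) powr p'))"
    interpret Q: finite_measure "lebesgue_on Q"
      by (rule finite_measure_lebesgue_on[OF cube_lmeasurable[OF Q]])
    have "enn_powr (\<integral>\<^sup>+y. ennreal (norm ((R Q ** V_inv_root y) *v axis i 1) powr p') \<partial>lebesgue_on Q) (1 / p') \<le> ennreal c" for i
      unfolding p'_def c_def using C
      by (intro Lp_dual_bound[OF Q.finite_measure_axioms p1] measurable_norm_mult_V_inv_root testing_bound_scalar[OF T C Q]) auto
    hence col: "(\<integral>\<^sup>+y. ennreal (norm ((R Q ** V_inv_root y) *v axis i 1) powr p') \<partial>lebesgue_on Q) \<le> ennreal (c powr p')" for i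
      using p' c by (simp add: enn_powr_le_iff enn_powr_ennreal)
    have "(\<integral>\<^sup>+y. ennreal (op_norm (R Q ** V_inv_root y) powr p') \<partial>lebesgue_on Q)
        \<le> (\<integral>\<^sup>+y. ennreal (?N powr p') * (\<Sum>i\<in>UNIV. ennreal (norm ((R Q ** V_inv_root y) *v axis i 1) powr p')) \<partial>lebesgue_on Q)"
      using p' by (intro nn_integral_mono op_norm_powr_le_sum) auto
    also have "\<dots> = ennreal (?N powr p') * (\<Sum>i\<in>UNIV. \<integral>\<^sup>+y. ennreal (norm ((R Q ** V_inv_root y) *v axis i 1) powr p') \<partial>lebesgue_on Q)"
    proof -
      note [measurable] = measurable_norm_mult_V_inv_root
      show ?thesis by (subst nn_integral_cmult) (auto simp: nn_integral_sum simp del: sum_ennreal)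
    qed
    also have "\<dots> \<le> ennreal (?N powr p') * (\<Sum>i\<in>(UNIV::'n set). ennreal (c powr p'))"
      by (intro mult_left_mono sum_mono col) auto
    also have "\<dots> = ennreal (?N powr p' * ?N * c powr p')"
      by (simp add: ennreal_mult ennreal_of_nat_eq_real_of_nat mult.assoc)
    finally have "X \<le> ennreal (1 / vol Q) * ennreal (?N powr p' * ?N * c powr p')"
      unfolding X_def nn_avg_restrict[OF Q] by (rule mult_left_mono) simp
    hence "X \<le> ennreal (1 / vol Q * (?N powr p' * ?N * c powr p'))"
      using v by (simp add: ennreal_mult[symmetric])
    hence "enn_powr X (1 / p') \<le> enn_powr (ennreal (1 / vol Q * (?N powr p' * ?N * c powr p'))) (1 / p')"
      using p' by (intro enn_powr_mono) auto
    also have "\<dots> = ennreal ((1 / vol Q) powr (1 / p') * (k * c))"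
    proof -
      have "(c powr p') powr (1 / p') = c" using p' c by (simp add: powr_powr)
      hence "(1 / vol Q * (?N powr p' * ?N * c powr p')) powr (1 / p') = (1 / vol Q) powr (1 / p') * (k * c)"
        unfolding k_def by (simp only: powr_mult mult.assoc)
      thus ?thesis using v by (subst enn_powr_ennreal) auto
    qed
    finally have "ennreal (vol Q powr (\<alpha> / real CARD('d) + 1 / q - 1 / p)) * enn_powr X (1 / p')
        \<le> ennreal (vol Q powr (\<alpha> / real CARD('d) + 1 / q - 1 / p)) * ennreal ((1 / vol Q) powr (1 / p') * (k * c))"
      by (rule mult_left_mono) simp
    also have "\<dots> = ennreal (vol Q powr (\<alpha> / real CARD('d) + 1 / q - 1 / p) * (1 / vol Q) powr (1 / p') * vol Q powr ?e * (k * C))"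
    proof -
      have "0 \<le> k" by (simp add: k_def)
      thus ?thesis using v C by (simp add: ennreal_mult[symmetric] c_def mult_ac)
    qed
    also have "vol Q powr (\<alpha> / real CARD('d) + 1 / q - 1 / p) * (1 / vol Q) powr (1 / p') * vol Q powr ?e = 1"
    proof -
      have "(1 / vol Q) powr (1 / p') = vol Q powr (- (1 / p'))" using v by (simp add: powr_divide powr_minus_divide)
      moreover have "\<alpha> / real CARD('d) + 1 / q - 1 / p + (- (1 / p')) + ?e = 0"
        using p1 by (simp add: p'_def field_simps)
      ultimately have "vol Q powr (\<alpha> / real CARD('d) + 1 / q - 1 / p) * (1 / vol Q) powr (1 / p') * vol Q powr ?e = vol Q powr 0"
        by (metis powr_add)
      thus ?thesis using v by simp
    qed
    also have "enn_powr X (1 / p') = enn_powr (dual_size Q (R Q)) (1 / q)"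
      unfolding dual_size_def X_def[symmetric] enn_powr_enn_powr using q_pos by simp
    finally show "ennreal (vol Q powr (\<alpha> / real CARD('d) + 1 / q - 1 / p)) * enn_powr (dual_size Q (R Q)) (1 / q) \<le> ennreal (k * C)"
      by simp
  qed (use C in \<open>simp add: k_def\<close>)
qed

lemma dual_of_testing_bound_1:
  assumes p1: "p = 1" and C: "0 \<le> C" and T: "testing_bound \<alpha> C"
  shows "\<exists>K\<ge>0. \<forall>Q\<in>cubes. AE y in lebesgue_on Q.
    vol Q powr (\<alpha> / real CARD('d) + 1 / q - 1) * op_norm (R Q ** V_inv_root y) \<le> K"
proof (intro exI[of _ "real CARD('n) * C"] conjI ballI)
  fix Q :: "(real ^ 'd) set" assume Q: "Q \<in> cubes"
  note v = cube_vol_pos[OF Q]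
  let ?e = "1 - \<alpha> / real CARD('d) - 1 / q"
  interpret Q: finite_measure "lebesgue_on Q"
    by (rule finite_measure_lebesgue_on[OF cube_lmeasurable[OF Q]])
  have "AE y in lebesgue_on Q. norm ((R Q ** V_inv_root y) *v axis i 1) \<le> C * vol Q powr ?e" for i
  proof (rule L1_dual_bound[OF Q.finite_measure_axioms _ measurable_norm_mult_V_inv_root])
    fix h assume "h \<in> borel_measurable (lebesgue_on Q)" "\<And>y. 0 \<le> h y" "(\<integral>\<^sup>+y. ennreal (h y) \<partial>lebesgue_on Q) < top"
    thus "(\<integral>\<^sup>+y. ennreal (norm ((R Q ** V_inv_root y) *v axis i 1) * h y) \<partial>lebesgue_on Q)
        \<le> ennreal (C * vol Q powr ?e) * (\<integral>\<^sup>+y. ennreal (h y) \<partial>lebesgue_on Q)"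
      using testing_bound_scalar[OF T C Q, of h i] by (simp add: p1 enn_powr_one)
  qed (use C in auto)
  hence "AE y in lebesgue_on Q. \<forall>i\<in>UNIV. norm ((R Q ** V_inv_root y) *v axis i 1) \<le> C * vol Q powr ?e"
    by (intro AE_finite_allI) auto
  thus "AE y in lebesgue_on Q. vol Q powr (\<alpha> / real CARD('d) + 1 / q - 1) * op_norm (R Q ** V_inv_root y) \<le> real CARD('n) * C"
  proof eventually_elim
    case (elim y)
    have "op_norm (R Q ** V_inv_root y) \<le> (\<Sum>i\<in>(UNIV::'n set). C * vol Q powr ?e)"
      by (rule order_trans[OF op_norm_le_sum_columns]) (intro sum_mono, use elim in auto)
    hence "vol Q powr (- ?e) * op_norm (R Q ** V_inv_root y) \<le> vol Q powr (- ?e) * (real CARD('n) * (C * vol Q powr ?e))"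
      by (intro mult_left_mono) auto
    also have "\<dots> = (vol Q powr (- ?e) * vol Q powr ?e) * (real CARD('n) * C)" by (simp add: mult_ac)
    also have "vol Q powr (- ?e) * vol Q powr ?e = 1" using v by (simp flip: powr_add)
    finally show ?case by (simp add: algebra_simps)
  qed
qed (use C in auto)

end

section \<open>Covering by cubes and the weak type bound\<close>

lemma emeasure_countable_Union_le:
  assumes "countable C" "\<And>i. i \<in> C \<Longrightarrow> B i \<in> sets M"
    and bound: "\<And>F. finite F \<Longrightarrow> F \<subseteq> C \<Longrightarrow> (\<Sum>i\<in>F. emeasure M (B i)) \<le> K"
  shows "emeasure M (\<Union>i\<in>C. B i) \<le> K"
proof (cases "C = {}")
  case False
  define D where "D n = (\<Union>i\<in>from_nat_into C ` {..<n}. B i)" for n :: nat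
  have sub: "from_nat_into C ` {..<n} \<subseteq> C" for n :: nat using from_nat_into[OF False] by auto
  have D: "range D \<subseteq> sets M" using sub assms(2) unfolding D_def by (auto intro!: sets.finite_UN)
  have "incseq D" unfolding incseq_def D_def by (intro allI impI UN_mono image_mono) auto
  have "(\<Union>n. D n) = (\<Union>i\<in>C. B i)"
  proof
    show "(\<Union>n. D n) \<subseteq> (\<Union>i\<in>C. B i)" using sub unfolding D_def by blast
    show "(\<Union>i\<in>C. B i) \<subseteq> (\<Union>n. D n)"
    proof (rule UN_least)
      fix i assume "i \<in> C"
      then obtain n where "i = from_nat_into C n" using from_nat_into_surj[OF assms(1)] by metis
      hence "B i \<subseteq> D (Suc n)" unfolding D_def by auto
      thus "B i \<subseteq> (\<Union>n. D n)" by blast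
    qed
  qed
  hence "emeasure M (\<Union>i\<in>C. B i) = (SUP n. emeasure M (D n))"
    using SUP_emeasure_incseq[OF D \<open>incseq D\<close>] by simp
  also have "\<dots> \<le> K"
  proof (rule SUP_least)
    fix n
    have "emeasure M (D n) \<le> (\<Sum>i\<in>from_nat_into C ` {..<n}. emeasure M (B i))"
      unfolding D_def using sub assms(2) by (intro emeasure_subadditive_finite) auto
    also have "\<dots> \<le> K" using sub by (intro bound) auto
    finally show "emeasure M (D n) \<le> K" .
  qed
  finally show ?thesis .
qed simp

lemma sum_powr_le_powr_sum:
  fixes f :: "'a \<Rightarrow> real"
  assumes "finite S" "\<And>i. i \<in> S \<Longrightarrow> 0 \<le> f i" "1 \<le> r"
  shows "(\<Sum>i\<in>S. f i powr r) \<le> (\<Sum>i\<in>S. f i) powr r"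
proof -
  have split: "x powr r = x * x powr (r - 1)" if "0 \<le> x" for x :: real
    using that by (simp add: powr_mult_base)
  have "(\<Sum>i\<in>S. f i powr r) \<le> (\<Sum>i\<in>S. f i * (\<Sum>i\<in>S. f i) powr (r - 1))"
  proof (rule sum_mono)
    fix i assume i: "i \<in> S"
    have "f i \<le> (\<Sum>i\<in>S. f i)" using assms i by (intro member_le_sum) auto
    thus "f i powr r \<le> f i * (\<Sum>i\<in>S. f i) powr (r - 1)"
      unfolding split[OF assms(2)[OF i]] using assms i by (intro mult_left_mono powr_mono2) auto
  qed
  also have "\<dots> = (\<Sum>i\<in>S. f i) powr r"
    using assms by (subst split) (auto simp: sum_distrib_right intro: sum_nonneg)
  finally show ?thesis .
qed

text \<open>Transfers the Vitali covering lemma from balls to cubes, at the price of a constant depending on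
the dimension. With side length \<open>l\<close> the ball about the centre of radius \<open>d l\<close> contains
the cube, since the Euclidean norm is at most the sum of the \<open>d\<close> coordinates; its fivefold
dilate lies in a cube of side \<open>10 d l\<close>.\<close>
lemma cube_enlargement:
  fixes Q :: "(real ^ 'd) set"
  assumes "Q \<in> cubes"
  obtains x r where "0 < r" "Q \<subseteq> ball x r" "r \<le> real CARD('d) * max 1 (vol Q)"
    "emeasure lebesgue (ball x (5 * r)) \<le> ennreal ((10 * real CARD('d)) ^ CARD('d) * vol Q)"
proof -
  let ?d = "real CARD('d)"
  obtain a :: "real ^ 'd" and l where al: "Q = box a (\<chi> i. a $ i + l)" "0 < l"
    using assms by (auto simp: cubes_def)
  have vol: "vol Q = l ^ CARD('d)" using cube_volume[OF al(2), of a] al(1) by simp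
  define x :: "real ^ 'd" where "x = (\<chi> i. a $ i + l / 2)"
  define r where "r = ?d * l"
  have r: "0 < r" using al by (simp add: r_def)
  have "Q \<subseteq> ball x r"
  proof
    fix y assume "y \<in> Q"
    hence "norm ((x - y) $ i) < l" for i using al by (auto simp: mem_box_cart x_def abs_less_iff dest: spec[of _ i])
    hence "(\<Sum>i\<in>UNIV. norm ((x - y) $ i)) < (\<Sum>i\<in>(UNIV::'d set). l)" by (intro sum_strict_mono) auto
    thus "y \<in> ball x r" using norm_vec_le_sum[of "x - y"] by (simp add: dist_norm r_def)
  qed
  moreover have "r \<le> ?d * max 1 (vol Q)"
  proof -
    have "l \<le> max 1 (vol Q)"
    proof (cases "l \<le> 1")
      case False
      hence "l \<le> l ^ CARD('d)" by (intro self_le_power) (auto simp: Suc_leI)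
      thus ?thesis by (simp add: vol)
    qed simp
    thus ?thesis unfolding r_def by (intro mult_left_mono) auto
  qed
  moreover have "emeasure lebesgue (ball x (5 * r)) \<le> ennreal ((10 * ?d) ^ CARD('d) * vol Q)"
  proof -
    define b :: "real ^ 'd" where "b = (\<chi> i. x $ i - 5 * r)"
    have "ball x (5 * r) \<subseteq> box b (\<chi> i. b $ i + 10 * r)"
    proof
      fix y assume "y \<in> ball x (5 * r)"
      hence y: "norm (x - y) < 5 * r" by (simp add: dist_norm)
      have "norm ((x - y) $ i) < 5 * r" for i
        using Finite_Cartesian_Product.norm_nth_le[of "x - y" i] y by linarith
      hence "\<bar>x $ i - y $ i\<bar> < 5 * r" for i by simp
      thus "y \<in> box b (\<chi> i. b $ i + 10 * r)"
        unfolding mem_box_cart b_def by (simp add: abs_less_iff) (smt (verit))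
    qed
    hence "emeasure lebesgue (ball x (5 * r)) \<le> emeasure lebesgue (box b (\<chi> i. b $ i + 10 * r))"
      by (intro emeasure_mono) auto
    also have "\<dots> = ennreal (vol (box b (\<chi> i. b $ i + 10 * r)))"
      by (rule emeasure_eq_measure2) (simp add: fmeasurableD2)
    also have "vol (box b (\<chi> i. b $ i + 10 * r)) = (10 * r) ^ CARD('d)"
      using r by (intro cube_volume) simp
    also have "\<dots> = (10 * ?d) ^ CARD('d) * vol Q" by (simp add: r_def vol power_mult_distrib)
    finally show ?thesis .
  qed
  ultimately show thesis using that r by blast
qed

text \<open>Select by Vitali's lemma a disjoint subfamily whose enlargements still cover. Since \<open>r \<ge> 1\<close>,
the sum of the \<open>r\<close>-th powers of the integrals over disjoint cubes is at most the
\<open>r\<close>-th power of the whole integral. The volume hypothesis also bounds the side lengths, as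
the covering lemma requires.\<close>
lemma cube_covering_bound:
  fixes f :: "real ^ 'd \<Rightarrow> ennreal" and \<Q> :: "(real ^ 'd) set set"
  assumes Q: "\<Q> \<subseteq> cubes" and f: "f \<in> borel_measurable lebesgue" "(\<integral>\<^sup>+x. f x \<partial>lebesgue) = ennreal F" "0 \<le> F"
    and r: "1 \<le> r" and A: "0 \<le> A"
    and vol: "\<And>Q. Q \<in> \<Q> \<Longrightarrow> ennreal (vol Q) \<le> ennreal A * enn_powr (\<integral>\<^sup>+x\<in>Q. f x \<partial>lebesgue) r"
  shows "emeasure lebesgue (\<Union>\<Q>) \<le> ennreal ((10 * real CARD('d)) ^ CARD('d) * A * F powr r)"
proof -
  let ?k = "(10 * real CARD('d)) ^ CARD('d)"
  define \<mu> where "\<mu> = density lebesgue f"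
  have mu: "emeasure \<mu> Q = (\<integral>\<^sup>+x\<in>Q. f x \<partial>lebesgue)" if "Q \<in> sets lebesgue" for Q
    unfolding \<mu>_def using f(1) that by (rule emeasure_density)
  have muF: "emeasure \<mu> X \<le> ennreal F" if "X \<in> sets lebesgue" for X
    unfolding mu[OF that] f(2)[symmetric] by (intro nn_integral_mono) (simp add: indicator_def)
  have Qs: "Q \<in> sets lebesgue" if "Q \<in> \<Q>" for Q using Q that cube_sets by auto
  define m where "m Q = enn2real (emeasure \<mu> Q)" for Q
  have m: "emeasure \<mu> Q = ennreal (m Q)" if "Q \<in> sets lebesgue" for Q
  proof -
    have "emeasure \<mu> Q < top" using muF[OF that] by (rule order_le_less_trans) simp
    thus ?thesis by (simp add: m_def)
  qed
  have m0: "0 \<le> m Q" for Q by (simp add: m_def)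
  have volm: "vol Q \<le> A * m Q powr r" if "Q \<in> \<Q>" for Q
  proof -
    have "ennreal (vol Q) \<le> ennreal (A * m Q powr r)"
      using vol[OF that] A m0 by (simp add: mu[OF Qs[OF that], symmetric] m[OF Qs[OF that]] enn_powr_ennreal ennreal_mult)
    thus ?thesis using A by simp
  qed
  have mF: "m Q \<le> F" if "Q \<in> sets lebesgue" for Q
    using muF[OF that] f(3) by (simp add: m[OF that])
  have "\<forall>Q\<in>(cubes :: (real ^ 'd) set set). \<exists>x r. 0 < r \<and> Q \<subseteq> ball x r \<and>
    r \<le> real CARD('d) * max 1 (vol Q) \<and> emeasure lebesgue (ball x (5 * r)) \<le> ennreal (?k * vol Q)"
  proof
    fix Q :: "(real ^ 'd) set" assume "Q \<in> cubes"
    then obtain x r where "0 < r" "Q \<subseteq> ball x r" "r \<le> real CARD('d) * max 1 (vol Q)"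
        "emeasure lebesgue (ball x (5 * r)) \<le> ennreal (?k * vol Q)" by (rule cube_enlargement)
    thus "\<exists>x r. 0 < r \<and> Q \<subseteq> ball x r \<and> r \<le> real CARD('d) * max 1 (vol Q) \<and>
        emeasure lebesgue (ball x (5 * r)) \<le> ennreal (?k * vol Q)" by blast
  qed
  then obtain x \<rho> where xr: "\<And>Q :: (real ^ 'd) set. Q \<in> cubes \<Longrightarrow> 0 < \<rho> Q \<and> Q \<subseteq> ball (x Q) (\<rho> Q) \<and>
      \<rho> Q \<le> real CARD('d) * max 1 (vol Q) \<and> emeasure lebesgue (ball (x Q) (5 * \<rho> Q)) \<le> ennreal (?k * vol Q)"
    by metis
  have cover: "\<Union>\<Q> \<subseteq> (\<Union>Q\<in>\<Q>. ball (x Q) (\<rho> Q))" using xr Q by blast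
  have radius: "0 < \<rho> Q \<and> \<rho> Q \<le> real CARD('d) * max 1 (A * F powr r)" if "Q \<in> \<Q>" for Q
  proof -
    have "vol Q \<le> A * F powr r"
      using volm[OF that] mF[OF Qs[OF that]] m0 r A by (meson mult_left_mono order_trans powr_mono2 zero_le_one)
    hence "real CARD('d) * max 1 (vol Q) \<le> real CARD('d) * max 1 (A * F powr r)"
      by (intro mult_left_mono) auto
    moreover have "Q \<in> cubes" using Q that by auto
    ultimately show ?thesis using xr[of Q] by linarith
  qed
  obtain C where C: "countable C" "C \<subseteq> \<Q>"
      and disj: "pairwise (\<lambda>i j. disjnt (ball (x i) (\<rho> i)) (ball (x j) (\<rho> j))) C"
      and sub: "\<Union>\<Q> \<subseteq> (\<Union>i\<in>C. ball (x i) (5 * \<rho> i))"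
    by (rule Vitali_covering_lemma_balls[OF cover radius])
  have "emeasure lebesgue (\<Union>\<Q>) \<le> emeasure lebesgue (\<Union>i\<in>C. ball (x i) (5 * \<rho> i))"
    by (intro emeasure_mono sub) (intro sets.countable_UN' C, auto)
  also have "\<dots> \<le> ennreal (?k * A * F powr r)"
  proof (rule emeasure_countable_Union_le[OF C(1)])
    fix T assume T: "finite T" "T \<subseteq> C"
    have TQ: "Q \<in> \<Q>" if "Q \<in> T" for Q using that T C by auto
    have "(\<Sum>Q\<in>T. emeasure lebesgue (ball (x Q) (5 * \<rho> Q))) \<le> (\<Sum>Q\<in>T. ennreal (?k * (A * m Q powr r)))"
    proof (rule sum_mono)
      fix Q assume QT: "Q \<in> T"
      have "emeasure lebesgue (ball (x Q) (5 * \<rho> Q)) \<le> ennreal (?k * vol Q)" using xr TQ[OF QT] Q by auto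
      also have "\<dots> \<le> ennreal (?k * (A * m Q powr r))"
        by (intro ennreal_leI mult_left_mono volm TQ QT) auto
      finally show "emeasure lebesgue (ball (x Q) (5 * \<rho> Q)) \<le> ennreal (?k * (A * m Q powr r))" .
    qed
    also have "\<dots> = ennreal (?k * A * (\<Sum>Q\<in>T. m Q powr r))"
      using A by (subst sum_ennreal) (auto simp: sum_distrib_left mult.assoc)
    also have "\<dots> \<le> ennreal (?k * A * F powr r)"
    proof (intro ennreal_leI mult_left_mono)
      have "disjoint_family_on (\<lambda>Q. Q) T"
        unfolding disjoint_family_on_def
      proof (intro ballI impI)
        fix P Q assume PQ: "P \<in> T" "Q \<in> T" "P \<noteq> Q"
        hence "disjnt (ball (x P) (\<rho> P)) (ball (x Q) (\<rho> Q))" using disj T by (auto simp: pairwise_def)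
        thus "P \<inter> Q = {}" using xr[of P] xr[of Q] TQ PQ Q unfolding disjnt_def by blast
      qed
      hence "(\<Sum>Q\<in>T. emeasure \<mu> Q) = emeasure \<mu> (\<Union>Q\<in>T. Q)"
        using T Qs TQ by (intro sum_emeasure) (auto simp: \<mu>_def)
      also have "\<dots> \<le> ennreal F" using T Qs TQ by (intro muF sets.finite_UN) auto
      finally have "(\<Sum>Q\<in>T. ennreal (m Q)) \<le> ennreal F" using Qs TQ by (simp add: m cong: sum.cong)
      hence "(\<Sum>Q\<in>T. m Q) \<le> F" using m0 f(3) by (simp add: sum_nonneg)
      hence "(\<Sum>Q\<in>T. m Q) powr r \<le> F powr r" using m0 r by (intro powr_mono2 sum_nonneg) auto
      thus "(\<Sum>Q\<in>T. m Q powr r) \<le> F powr r"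
        using sum_powr_le_powr_sum[of T m r, OF T(1) m0 r] by linarith
    qed (use A in auto)
    finally show "(\<Sum>Q\<in>T. emeasure lebesgue (ball (x Q) (5 * \<rho> Q))) \<le> ennreal (?k * A * F powr r)" .
  qed simp
  finally show ?thesis .
qed

context reduced_weights
begin

text \<open>\<open>B\<^sub>Q f\<close> only sees \<open>f\<close> on \<open>Q\<close>, so the bound for the restriction of
\<open>f\<close> to \<open>Q\<close> is a bound for \<open>f\<close>.\<close>
lemma testing_bound_local:
  assumes T: "testing_bound \<alpha> C" and Q: "Q \<in> cubes" and f: "f \<in> Lp p"
  shows "ennreal (vol Q powr (\<alpha> / real CARD('d) + 1 / q)) * nn_avg Q (\<lambda>y. ennreal (norm ((R Q ** V_inv_root y) *v f y)))
    \<le> ennreal C * enn_powr (\<integral>\<^sup>+x\<in>Q. ennreal (norm (f x) powr p) \<partial>lebesgue) (1 / p)"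
proof -
  define g where "g x = indicator Q x *\<^sub>R f x" for x
  have g: "g \<in> borel_measurable lebesgue" unfolding g_def using LpD(1)[OF f] cube_sets[OF Q] by measurable
  have ng: "(\<integral>\<^sup>+x. ennreal (norm (g x) powr p) \<partial>lebesgue) = (\<integral>\<^sup>+x\<in>Q. ennreal (norm (f x) powr p) \<partial>lebesgue)"
    using p by (intro nn_integral_cong) (auto simp: g_def indicator_def)
  have "(\<integral>\<^sup>+x\<in>Q. ennreal (norm (f x) powr p) \<partial>lebesgue) \<le> (\<integral>\<^sup>+x. ennreal (norm (f x) powr p) \<partial>lebesgue)"
    by (intro nn_integral_mono) (auto simp: indicator_def)
  hence "g \<in> Lp p" using g LpD(2)[OF f] by (auto simp: Lp_def Lp_norm_def enn_powr_less_top_iff ng)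
  from T[unfolded testing_bound_def, THEN bspec, OF Q, THEN bspec, OF this]
  have "ennreal (vol Q powr (\<alpha> / real CARD('d) + 1 / q)) * nn_avg Q (\<lambda>y. ennreal (norm ((R Q ** V_inv_root y) *v g y)))
    \<le> ennreal C * enn_powr (\<integral>\<^sup>+x\<in>Q. ennreal (norm (f x) powr p) \<partial>lebesgue) (1 / p)"
    by (simp add: Lp_norm_def ng)
  moreover have "nn_avg Q (\<lambda>y. ennreal (norm ((R Q ** V_inv_root y) *v f y))) \<le> nn_avg Q (\<lambda>y. ennreal (norm ((R Q ** V_inv_root y) *v g y)))"
    by (intro nn_avg_mono_AE[OF Q] always_eventually) (simp add: g_def)
  ultimately show ?thesis by (meson mult_left_mono order_trans zero_le)
qed

text \<open>The level set at height \<open>t\<close> is the union of the cubes on which \<open>B\<^sub>Q f\<close> exceeds \<open>t\<close>.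
For such a cube the localized testing bound says that \<open>|Q|\<close> is at most \<open>(C/t)\<^sup>q\<close> times the power
\<open>q/p \<ge> 1\<close> of the integral of \<open>|f|\<^sup>p\<close> over \<open>Q\<close>, which is the hypothesis of
\<open>cube_covering_bound\<close>.\<close>
lemma weak_type_aux_maximal:
  assumes pq: "p \<le> q" and C: "0 \<le> C" and T: "testing_bound \<alpha> C" and f: "f \<in> Lp p"
  shows "weak_norm q (aux_maximal \<alpha> p R V f)
    \<le> ennreal (((10 * real CARD('d)) ^ CARD('d)) powr (1 / q) * C) * Lp_norm p f"
proof -
  let ?k = "(10 * real CARD('d)) ^ CARD('d)"
  obtain F where F: "(\<integral>\<^sup>+x. ennreal (norm (f x) powr p) \<partial>lebesgue) = ennreal F" "0 \<le> F"
    using LpD(2)[OF f] by (cases "\<integral>\<^sup>+x. ennreal (norm (f x) powr p) \<partial>lebesgue") auto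
  have p0: "0 < p" using p by simp
  have "ennreal t * enn_powr (emeasure lebesgue {x. ennreal t < aux_maximal \<alpha> p R V f x}) (1 / q)
      \<le> ennreal (?k powr (1 / q) * C) * Lp_norm p f" if t: "0 < t" for t
  proof -
    define \<Q> where "\<Q> = {Q \<in> cubes. ennreal t < ennreal (vol Q powr (\<alpha> / real CARD('d))) *
        nn_avg Q (\<lambda>y. ennreal (norm ((R Q ** V_inv_root y) *v f y)))}"
    have "{x. ennreal t < aux_maximal \<alpha> p R V f x} = \<Union>\<Q>"
      unfolding aux_maximal_def less_SUP_iff avg_op_def V_inv_root_def[symmetric] \<Q>_def
      by (auto simp: indicator_def split: if_splits)
    moreover have "emeasure lebesgue (\<Union>\<Q>) \<le> ennreal (?k * (C / t) powr q * F powr (q / p))"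
    proof (rule cube_covering_bound)
      fix Q assume "Q \<in> \<Q>"
      hence Q: "Q \<in> cubes" and less: "ennreal t < ennreal (vol Q powr (\<alpha> / real CARD('d))) *
          nn_avg Q (\<lambda>y. ennreal (norm ((R Q ** V_inv_root y) *v f y)))" by (auto simp: \<Q>_def)
      note v = cube_vol_pos[OF Q]
      let ?I = "\<integral>\<^sup>+x\<in>Q. ennreal (norm (f x) powr p) \<partial>lebesgue"
      have "ennreal (t * vol Q powr (1 / q)) = ennreal (vol Q powr (1 / q)) * ennreal t"
        using t by (simp add: ennreal_mult mult.commute)
      also have "\<dots> \<le> ennreal (vol Q powr (1 / q)) * (ennreal (vol Q powr (\<alpha> / real CARD('d))) *
          nn_avg Q (\<lambda>y. ennreal (norm ((R Q ** V_inv_root y) *v f y))))"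
        using less by (intro mult_left_mono) auto
      also have "\<dots> = ennreal (vol Q powr (\<alpha> / real CARD('d) + 1 / q)) * nn_avg Q (\<lambda>y. ennreal (norm ((R Q ** V_inv_root y) *v f y)))"
        by (subst ennreal_mult_assoc2) (auto simp: powr_add mult.commute)
      also have "\<dots> \<le> ennreal C * enn_powr ?I (1 / p)" by (rule testing_bound_local[OF T Q f])
      finally have "ennreal (1 / t) * ennreal (t * vol Q powr (1 / q)) \<le> ennreal (1 / t) * (ennreal C * enn_powr ?I (1 / p))"
        by (rule mult_left_mono) simp
      hence "ennreal (vol Q powr (1 / q)) \<le> ennreal (C / t) * enn_powr ?I (1 / p)"
        using t C by (simp add: ennreal_mult[symmetric] ennreal_mult_assoc2)
      hence "enn_powr (ennreal (vol Q powr (1 / q))) q \<le> enn_powr (ennreal (C / t) * enn_powr ?I (1 / p)) q"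
        using q_pos by (intro enn_powr_mono) auto
      thus "ennreal (vol Q) \<le> ennreal ((C / t) powr q) * enn_powr ?I (q / p)"
        using q_pos v t C by (simp add: enn_powr_mult enn_powr_enn_powr enn_powr_ennreal powr_powr)
    qed (use F t C pq p0 LpD(1)[OF f] in \<open>auto simp: \<Q>_def\<close>)
    ultimately have "enn_powr (emeasure lebesgue {x. ennreal t < aux_maximal \<alpha> p R V f x}) (1 / q)
        \<le> enn_powr (ennreal (?k * (C / t) powr q * F powr (q / p))) (1 / q)"
      using q_pos by (intro enn_powr_mono) auto
    also have "\<dots> = ennreal (?k powr (1 / q) * (C / t) * F powr (1 / p))"
    proof -
      have "((C / t) powr q) powr (1 / q) = C / t" "(F powr (q / p)) powr (1 / q) = F powr (1 / p)"
        using q_pos t C by (auto simp: powr_powr)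
      hence "(?k * (C / t) powr q * F powr (q / p)) powr (1 / q) = ?k powr (1 / q) * (C / t) * F powr (1 / p)"
        by (simp only: powr_mult)
      thus ?thesis by (subst enn_powr_ennreal) auto
    qed
    finally have "ennreal t * enn_powr (emeasure lebesgue {x. ennreal t < aux_maximal \<alpha> p R V f x}) (1 / q)
        \<le> ennreal t * ennreal (?k powr (1 / q) * (C / t) * F powr (1 / p))" by (rule mult_left_mono) simp
    also have "\<dots> = ennreal (?k powr (1 / q) * C * F powr (1 / p))"
      using t C by (simp add: ennreal_mult[symmetric])
    also have "\<dots> = ennreal (?k powr (1 / q) * C) * Lp_norm p f"
      using C F by (simp add: Lp_norm_def enn_powr_ennreal ennreal_mult)
    finally show ?thesis .
  qed
  thus ?thesis unfolding weak_norm_def by (intro SUP_least) auto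
qed

text \<open>Pointwise domination. The larger level set is measurable because it is a union of open cubes.\<close>
lemma weak_norm_avg_op_le_aux_maximal:
  assumes Q: "Q \<in> cubes"
  shows "weak_norm q (avg_op \<alpha> p R V Q f) \<le> weak_norm q (aux_maximal \<alpha> p R V f)"
  unfolding weak_norm_def
proof (intro SUP_mono' mult_left_mono enn_powr_mono emeasure_mono)
  fix t :: real
  show "{x. ennreal t < avg_op \<alpha> p R V Q f x} \<subseteq> {x. ennreal t < aux_maximal \<alpha> p R V f x}"
    unfolding aux_maximal_def using Q by (auto simp: less_SUP_iff)
  have "{x. ennreal t < avg_op \<alpha> p R V P f x} = P \<or> {x. ennreal t < avg_op \<alpha> p R V P f x} = {}" for P
    unfolding avg_op_def by (auto simp: indicator_def split: if_splits)
  hence "open {x. ennreal t < avg_op \<alpha> p R V P f x}" if "P \<in> cubes" for P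
    using cube_open[OF that] by (metis open_empty)
  moreover have "{x. ennreal t < aux_maximal \<alpha> p R V f x} = (\<Union>P\<in>cubes. {x. ennreal t < avg_op \<alpha> p R V P f x})"
    unfolding aux_maximal_def by (auto simp: less_SUP_iff)
  ultimately have "open {x. ennreal t < aux_maximal \<alpha> p R V f x}" by auto
  thus "{x. ennreal t < aux_maximal \<alpha> p R V f x} \<in> sets lebesgue" by auto
qed (use q_pos in auto)

lemma maximal_bound_iff_testing_bound:
  assumes pq: "p \<le> q"
  shows "(\<exists>C<top. \<forall>f\<in>Lp p. weak_norm q (aux_maximal \<alpha> p R V f) \<le> C * Lp_norm p f) \<longleftrightarrow> (\<exists>C\<ge>0. testing_bound \<alpha> C)"
proof
  assume "\<exists>C<top. \<forall>f\<in>Lp p. weak_norm q (aux_maximal \<alpha> p R V f) \<le> C * Lp_norm p f"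
  then obtain C where C: "C < top" "\<forall>f\<in>Lp p. weak_norm q (aux_maximal \<alpha> p R V f) \<le> C * Lp_norm p f" by blast
  show "\<exists>C\<ge>0. testing_bound \<alpha> C" unfolding testing_bound_iff[symmetric]
    using C weak_norm_avg_op_le_aux_maximal by (meson order_trans)
next
  assume "\<exists>C\<ge>0. testing_bound \<alpha> C"
  then obtain C where "0 \<le> C" "testing_bound \<alpha> C" by blast
  thus "\<exists>C<top. \<forall>f\<in>Lp p. weak_norm q (aux_maximal \<alpha> p R V f) \<le> C * Lp_norm p f"
    using weak_type_aux_maximal[OF pq] ennreal_less_top by blast
qed

text \<open>In the constant, the average of the dual size over \<open>U\<^sup>1\<^sup>/\<^sup>q(x)\<close> may be replaced by its value at the
reducing operator.\<close>
lemma Apq_const_iff_dual: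
  assumes p1: "1 < p"
  shows "Apq_const \<alpha> p q U V < top \<longleftrightarrow> (\<exists>K\<ge>0. \<forall>Q\<in>cubes.
    ennreal (vol Q powr (\<alpha> / real CARD('d) + 1 / q - 1 / p)) * enn_powr (dual_size Q (R Q)) (1 / q) \<le> ennreal K)"
proof -
  define s where "s = \<alpha> / real CARD('d) + 1 / q - 1 / p"
  have Apq: "Apq_const \<alpha> p q U V =
      (SUP Q\<in>cubes. ennreal (vol Q powr s) * enn_powr (nn_avg Q (\<lambda>x. dual_size Q (U_root x))) (1 / q))"
    using p1 by (simp add: Apq_const_def Let_def dual_size_def U_root_def V_inv_root_def p'_def s_def)
  have fin: "X < top" if "ennreal (vol Q powr s) * enn_powr X (1 / q) \<le> ennreal K" "Q \<in> cubes" for Q X K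
  proof -
    have "enn_powr X (1 / q) \<noteq> top"
      using that cube_vol_pos[OF that(2)] by (auto simp: ennreal_mult_top top_unique)
    thus ?thesis by (simp add: less_top flip: enn_powr_less_top_iff[of X "1 / q"])
  qed
  have scale: "ennreal (vol Q powr s) * enn_powr Y (1 / q) \<le> ennreal (K powr (1 / q) * A)"
    if "Y \<le> ennreal K * X" "0 \<le> K" "0 \<le> A" "ennreal (vol Q powr s) * enn_powr X (1 / q) \<le> ennreal A" for Q X Y K A
  proof -
    have "enn_powr Y (1 / q) \<le> ennreal (K powr (1 / q)) * enn_powr X (1 / q)"
      using enn_powr_mono[OF _ that(1), of "1 / q"] q_pos that(2) by (simp add: enn_powr_mult enn_powr_ennreal)
    hence "ennreal (vol Q powr s) * enn_powr Y (1 / q) \<le> ennreal (K powr (1 / q)) * (ennreal (vol Q powr s) * enn_powr X (1 / q))"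
      by (metis mult_left_mono mult.left_commute zero_le)
    also have "\<dots> \<le> ennreal (K powr (1 / q)) * ennreal A" by (intro mult_left_mono that) auto
    finally show ?thesis using that by (simp add: ennreal_mult)
  qed
  show ?thesis unfolding s_def[symmetric]
  proof
    assume "Apq_const \<alpha> p q U V < top"
    then obtain A where A: "Apq_const \<alpha> p q U V = ennreal A" "0 \<le> A" by (cases "Apq_const \<alpha> p q U V") auto
    obtain K where K: "0 \<le> K" "\<forall>Q\<in>cubes. nn_avg Q (\<lambda>x. dual_size Q (U_root x)) < top \<longrightarrow> dual_size Q (R Q) \<le> ennreal K * nn_avg Q (\<lambda>x. dual_size Q (U_root x))"
      using dual_size_le_avg[OF p1] by blast
    have *: "ennreal (vol Q powr s) * enn_powr (nn_avg Q (\<lambda>x. dual_size Q (U_root x))) (1 / q) \<le> ennreal A" if "Q \<in> cubes" for Q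
      unfolding A(1)[symmetric] Apq by (rule SUP_upper[OF that])
    show "\<exists>K\<ge>0. \<forall>Q\<in>cubes. ennreal (vol Q powr s) * enn_powr (dual_size Q (R Q)) (1 / q) \<le> ennreal K"
      using K A(2) fin[OF *] by (intro exI[of _ "K powr (1 / q) * A"] conjI ballI scale[OF _ K(1) A(2) *]) auto
  next
    assume "\<exists>K\<ge>0. \<forall>Q\<in>cubes. ennreal (vol Q powr s) * enn_powr (dual_size Q (R Q)) (1 / q) \<le> ennreal K"
    then obtain A where A: "0 \<le> A" and *: "\<And>Q. Q \<in> cubes \<Longrightarrow> ennreal (vol Q powr s) * enn_powr (dual_size Q (R Q)) (1 / q) \<le> ennreal A" by blast
    obtain K where K: "0 \<le> K" "\<forall>Q\<in>cubes. dual_size Q (R Q) < top \<longrightarrow> nn_avg Q (\<lambda>x. dual_size Q (U_root x)) \<le> ennreal K * dual_size Q (R Q)"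
      using avg_dual_size_le[OF p1] by blast
    have "Apq_const \<alpha> p q U V \<le> ennreal (K powr (1 / q) * A)" unfolding Apq
      using K fin[OF *] by (intro SUP_least scale[OF _ K(1) A *]) auto
    thus "Apq_const \<alpha> p q U V < top" using ennreal_less_top order_le_less_trans by blast
  qed
qed

lemma Apq_const_iff_dual_1:
  assumes p1: "p = 1"
  shows "Apq_const \<alpha> p q U V < top \<longleftrightarrow> (\<exists>K\<ge>0. \<forall>Q\<in>cubes. AE y in lebesgue_on Q.
    vol Q powr (\<alpha> / real CARD('d) + 1 / q - 1) * op_norm (R Q ** V_inv_root y) \<le> K)"
proof -
  define s where "s = \<alpha> / real CARD('d) + 1 / q - 1"
  define H where "H Q y = enn_powr (nn_avg Q (\<lambda>x. ennreal (op_norm (U_root x ** V_inv_root y) powr q))) (1 / q)" for Q y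
  have Apq: "Apq_const \<alpha> p q U V = (SUP Q\<in>cubes. ennreal (vol Q powr s) * esssup (lebesgue_on Q) (H Q))"
    unfolding Apq_const_def U_root_def V_inv_root_def s_def H_def[abs_def] by (simp add: p1)
  have Hm: "H Q \<in> borel_measurable (lebesgue_on Q)" if "Q \<in> cubes" for Q
    unfolding H_def[abs_def] using measurable_avg_op_norm[OF that]
    by (intro measurable_restrict_space1 measurable_compose[OF _ borel_measurable_enn_powr])
  define k where "k = (real CARD('n) powr q / c1 powr q * real CARD('n)) powr (1 / q)"
  define k' where "k' = (real CARD('n) powr q * c2 powr q * real CARD('n)) powr (1 / q)"
  have opq: "enn_powr (ennreal (op_norm A powr q)) (1 / q) = ennreal (op_norm A)" for A :: "complex ^ 'n ^ 'n"
    using q_pos op_norm_nonneg[of A] by (simp add: enn_powr_ennreal powr_powr)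
  have lower: "ennreal (op_norm (R Q ** V_inv_root y)) \<le> ennreal k * H Q y" if "Q \<in> cubes" for Q y
    using enn_powr_mono[OF _ op_norm_le_avg[OF that], of "1 / q" "V_inv_root y"] q_pos c1
    unfolding opq enn_powr_mult H_def k_def by (simp add: enn_powr_ennreal)
  have upper: "H Q y \<le> ennreal k' * ennreal (op_norm (R Q ** V_inv_root y))" if "Q \<in> cubes" for Q y
    using enn_powr_mono[OF _ avg_op_norm_le[OF that], of "1 / q" "V_inv_root y"] q_pos c2
    unfolding enn_powr_mult opq H_def k'_def by (simp add: enn_powr_ennreal)
  have k0: "0 \<le> k" "0 \<le> k'" by (auto simp: k_def k'_def)
  show ?thesis unfolding s_def[symmetric]
  proof
    assume "Apq_const \<alpha> p q U V < top"
    then obtain A where A: "Apq_const \<alpha> p q U V = ennreal A" "0 \<le> A" by (cases "Apq_const \<alpha> p q U V") auto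
    show "\<exists>K\<ge>0. \<forall>Q\<in>cubes. AE y in lebesgue_on Q. vol Q powr s * op_norm (R Q ** V_inv_root y) \<le> K"
    proof (intro exI[of _ "k * A"] conjI ballI)
      fix Q :: "(real ^ 'd) set" assume Q: "Q \<in> cubes"
      have *: "ennreal (vol Q powr s) * esssup (lebesgue_on Q) (H Q) \<le> ennreal A"
        unfolding A(1)[symmetric] Apq by (rule SUP_upper[OF Q])
      show "AE y in lebesgue_on Q. vol Q powr s * op_norm (R Q ** V_inv_root y) \<le> k * A"
        using esssup_AE[of "H Q" "lebesgue_on Q"]
      proof eventually_elim
        case (elim y)
        have "ennreal (vol Q powr s * op_norm (R Q ** V_inv_root y)) = ennreal (vol Q powr s) * ennreal (op_norm (R Q ** V_inv_root y))"
          by (intro ennreal_mult op_norm_nonneg) auto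
        also have "\<dots> \<le> ennreal (vol Q powr s) * (ennreal k * esssup (lebesgue_on Q) (H Q))"
          by (intro mult_left_mono order_trans[OF lower[OF Q]] elim) auto
        also have "\<dots> = ennreal k * (ennreal (vol Q powr s) * esssup (lebesgue_on Q) (H Q))" by (rule mult.left_commute)
        also have "\<dots> \<le> ennreal k * ennreal A" by (intro mult_left_mono *) auto
        also have "\<dots> = ennreal (k * A)" using k0 A by (simp add: ennreal_mult)
        finally show ?case using k0 A by simp
      qed
    qed (use k0 A in auto)
  next
    assume "\<exists>K\<ge>0. \<forall>Q\<in>cubes. AE y in lebesgue_on Q. vol Q powr s * op_norm (R Q ** V_inv_root y) \<le> K"
    then obtain K where K: "0 \<le> K" "\<And>Q. Q \<in> cubes \<Longrightarrow> AE y in lebesgue_on Q. vol Q powr s * op_norm (R Q ** V_inv_root y) \<le> K" by blast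
    have "Apq_const \<alpha> p q U V \<le> ennreal (k' * K)" unfolding Apq
    proof (rule SUP_least)
      fix Q :: "(real ^ 'd) set" assume Q: "Q \<in> cubes"
      note v = cube_vol_pos[OF Q]
      have "esssup (lebesgue_on Q) (H Q) \<le> ennreal (k' * (vol Q powr (- s) * K))"
      proof (rule esssup_I[OF Hm[OF Q]])
        show "AE y in lebesgue_on Q. H Q y \<le> ennreal (k' * (vol Q powr (- s) * K))"
          using K(2)[OF Q]
        proof eventually_elim
          case (elim y)
          have "op_norm (R Q ** V_inv_root y) = vol Q powr (- s) * (vol Q powr s * op_norm (R Q ** V_inv_root y))"
            using v by (simp add: powr_add[symmetric] flip: mult.assoc)
          also have "\<dots> \<le> vol Q powr (- s) * K" by (intro mult_left_mono elim) auto
          finally have "ennreal k' * ennreal (op_norm (R Q ** V_inv_root y)) \<le> ennreal k' * ennreal (vol Q powr (- s) * K)"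
            by (intro mult_left_mono ennreal_leI) auto
          thus ?case using upper[OF Q, of y] k0 K(1) by (simp add: ennreal_mult)
        qed
      qed
      hence "ennreal (vol Q powr s) * esssup (lebesgue_on Q) (H Q) \<le> ennreal (vol Q powr s) * ennreal (k' * (vol Q powr (- s) * K))"
        by (rule mult_left_mono) simp
      also have "\<dots> = ennreal (vol Q powr s * vol Q powr (- s) * (k' * K))"
        using k0 K(1) by (simp add: ennreal_mult[symmetric] mult_ac)
      also have "vol Q powr s * vol Q powr (- s) = 1" using v by (simp flip: powr_add)
      finally show "ennreal (vol Q powr s) * esssup (lebesgue_on Q) (H Q) \<le> ennreal (k' * K)" by simp
    qed
    thus "Apq_const \<alpha> p q U V < top" using ennreal_less_top order_le_less_trans by blast
  qed
qed

lemma Apq_const_iff_testing_bound: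
  "Apq_const \<alpha> p q U V < top \<longleftrightarrow> (\<exists>C\<ge>0. testing_bound \<alpha> C)"
proof (cases "p = 1")
  case True
  show ?thesis unfolding Apq_const_iff_dual_1[OF True]
    using testing_bound_of_dual_1[OF True] dual_of_testing_bound_1[OF True] by blast
next
  case False
  hence p1: "1 < p" using p by simp
  show ?thesis unfolding Apq_const_iff_dual[OF p1]
    using testing_bound_of_dual[OF p1] dual_of_testing_bound[OF p1] by blast
qed

end

theorem theorem1p21:
  fixes U V :: "real ^ 'd \<Rightarrow> complex ^ 'n ^ 'n"
    and R :: "(real ^ 'd) set \<Rightarrow> complex ^ 'n ^ 'n"
    and \<alpha> p q c1 c2 :: real
  assumes "0 \<le> \<alpha>" and "\<alpha> < real CARD('d)"
    and "1 \<le> p" and "p \<le> q"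
    and "1 / p - 1 / q \<le> \<alpha> / real CARD('d)"
    and "matrix_weight U" and "matrix_weight V"
    and "0 < c1" and "0 < c2" and "reducing_operators c1 c2 q U R"
  shows "(Apq_const \<alpha> p q U V < top \<longleftrightarrow>
           (\<exists>C<top. \<forall>f\<in>Lp p. weak_norm q (aux_maximal \<alpha> p R V f) \<le> C * Lp_norm p f)) \<and>
         (Apq_const \<alpha> p q U V < top \<longleftrightarrow>
           (\<exists>C<top. \<forall>Q\<in>cubes. \<forall>f\<in>Lp p. weak_norm q (avg_op \<alpha> p R V Q f) \<le> C * Lp_norm p f))"
proof -
  interpret reduced_weights U V R p q c1 c2
    using assms by unfold_locales auto
  show ?thesis
    unfolding Apq_const_iff_testing_bound maximal_bound_iff_testing_bound[OF \<open>p \<le> q\<close>] testing_bound_iff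
    by simp
qed

end
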